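(* Let $f\in L^2(0,T;H)$ and $z_0\in V$. Assume: (i) $\Phi(0)\ge 0$ and $\Phi\colon H\to C^0([0,T];V)$ (elements of $H$ being regarded as constant-in-time elements of $L^2(0,T;H)$); (ii) $f\ge 0$, $t\mapsto f(t)$ is increasing, and $z_0\ge 0$; (iii) $z_0\le \Phi(z_0)(0)$ and $\langle Az_0-f(t),v\rangle\le 0$ for all $v\in V_+$ and a.e. $t\in[0,T]$; (iv) $t\mapsto\Phi(v)(t)$ is increasing for every $v\in V_+$; (v) for every $N\in\mathbb N$ and every $\{v_n\}\subset V_+$, $\sum_{n=1}^N\Phi(v_n)(t)\chi_{T^N_{n-1}}(t)\le \Phi\big(\sum_{n=1}^N v_n\chi_{T^N_{n-1}}(\cdot)\big)(t)$; (vi) if $v_n\rightharpoonup v$ in $L^2(0,T;V)$ and weakly-$*$ in $L^\infty(0,T;H)$ with $v_n(t)\le\Phi(v_n)(t)$, then $v(t)\le\Phi(v)(t)$; (vii) for every $\epsilon>0$ and every sequence $\{w_N\}$ with $w_N\rightharpoonup w$ in $L^2(0,T;V)$ and weakly-$*$ in $L^\infty(0,T;H)$ there is $N_0\in\mathbb N$ such that for all $N\ge N_0$, $$\sum_{n=1}^N\int_{T^N_{n-1}}\|\Phi(w_N(t))(t^N_{n-1})-\Phi(w)(t)\|_V^2\,dt\le\epsilon .$$ Then there exists a non-negative $z\in W_s(0,T)$ that solves the parabolic quasi-variational inequality: $z(0)=z_0$, $z(t)\le\Phi(z)(t)$ for a.e. $t$, and $$\int_0^T\langle z'(t)+Az(t)-f(t),z(t)-v(t)\rangle\,dt\le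 0\quad\text{for all } v\in L^2(0,T;V)\text{ with } v(t)\le\Phi(z)(t)\text{ a.e. } t.$$ This $z$ is the limit of the interpolants $\{z^N\}$, $\{\hat z^N\}$ in the sense that, for a subsequence, $z^N\rightharpoonup z$ in $L^2(0,T;V)$ and weakly-$*$ in $L^\infty(0,T;H)$, and $\hat z^N\rightharpoonup z$ in $W_s(0,T)$. Furthermore, $t\mapsto z(t)$ is increasing.
   Context: Setting. $T>0$; $V\subset H\subset V^*$ is a Gelfand triple of separable Hilbert spaces with $V$ compactly embedded in $H$; $\langle\cdot,\cdot\rangle$ is the duality pairing of $V^*$ and $V$. $H$ is ordered by a closed convex cone $H_+$ with $H_+=\{h\in H:(h,g)_H\ge 0\ \forall g\in H_+\}$: $\psi_1\le\psi_2$ iff $\psi_2-\psi_1\in H_+$. This induces orderings on $V$, on $V^*$ (by duality) and, pointwise a.e. in time, on Bochner spaces such as $L^2(0,T;H)$, $L^2(0,T;V)$. $V_+=\{v\in V:v\ge0\}$. $v^+$ is the orthogonal projection of $v\in H$ onto $H_+$ and $v=v^+-v^-$; it is assumed that $v\in V$ implies $v^+\in V$ with $\|v^+\|_V\le C\|v\|_V$. $A\colon V\to V^*$ is linear, symmetric, bounded, coercive and T-monotone: $\langle Av^+,v^-\rangle\le 0$ for all $v\in V$. $\Phi\colon L^2(0,T;H)\to L^2(0,T;V)$ is increasing: $\psi_1\le\psi_2$ implies $\Phi(\psi_1)\le\Phi(\psi_2)$. A time-dependent function $w$ is increasing (in time) if $w(s)\le w(t)$ for (a.e.) $s\le t$.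 $W_s(0,T)=L^2(0,T;V)\cap H^1(0,T;H)$. Discretisation. For $N\in\mathbb N$: $h=T/N$, $t^N_n=nh$, $T^N_{n}=[t^N_{n},t^N_{n+1})$, $f^N_n=\frac1h\int_{t^N_{n-1}}^{t^N_n}f(t)\,dt$, $z^N_0=z_0$. For $n=1,\dots,N$, $\bar z_{n,N}\in V$ solves $\bar z_{n,N}+hA\bar z_{n,N}=hf^N_n+z^N_{n-1}$, and $z^N_n\in V$ is a solution in the order interval $[z^N_{n-1},\bar z_{n,N}]$ (which exists under (i)–(iv)) of the elliptic quasi-variational inequality $$z^N_n\le\Phi(z^N_n)(t^N_{n-1}),\qquad \Big\langle \tfrac{z^N_n-z^N_{n-1}}{h}+Az^N_n-f^N_n,\,z^N_n-v\Big\rangle\le0\quad\forall v\in V:\ v\le\Phi(z^N_n)(t^N_{n-1}).$$ Interpolants: $z^N(t)=\sum_{n=1}^N z^N_n\chi_{T^N_{n-1}}(t)$ and $\hat z^N(t)=z^N_{n-1}+\frac{z^N_n-z^N_{n-1}}{h}(t-t^N_{n-1})$ for $t\in T^N_{n-1}$.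
   Formalization: The formal statement also assumes that v^+ is the least upper bound of v and 0 in the order of H; self-duality of H_+ alone does not give this, and the claim fails without it (cone of positive semidefinite 2×2 matrices). *)

theory Defs
  imports "HOL-Analysis.Analysis"
begin

text \<open>
  The Gelfand triple \<open>V \<subseteq> H \<subseteq> V*\<close> is given by two types \<open>'v\<close>, \<open>'h\<close> of separable Hilbert spaces,
  the inclusion \<open>\<iota> :: 'v \<Rightarrow> 'h\<close>, and the dual \<open>'v \<Rightarrow>\<^sub>L real\<close>, whose application is the duality
  pairing.  Elements of Bochner spaces over \<open>(0,T)\<close> are represented by functions of time; equality
  and order of such elements are meant almost everywhere.
\<close>


section \<open>Bochner spaces over a time interval\<close>

abbreviation timeM :: "real \<Rightarrow> real measure" where
  "timeM T \<equiv> lebesgue_on {0<..<T}"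

definition L1 :: "real \<Rightarrow> (real \<Rightarrow> 'a::{banach,second_countable_topology}) set" where
  "L1 T = {u. integrable (timeM T) u}"

definition L2 :: "real \<Rightarrow> (real \<Rightarrow> 'a::{banach,second_countable_topology}) set" where
  "L2 T = {u \<in> borel_measurable (timeM T). integrable (timeM T) (\<lambda>t. (norm (u t))\<^sup>2)}"

definition Linf :: "real \<Rightarrow> (real \<Rightarrow> 'a::{banach,second_countable_topology}) set" where
  "Linf T = {u \<in> borel_measurable (timeM T). \<exists>C. AE t in timeM T. norm (u t) \<le> C}"

definition L2_norm :: "real \<Rightarrow> (real \<Rightarrow> 'a::{banach,second_countable_topology}) \<Rightarrow> real" where
  "L2_norm T u = sqrt (\<integral>t. (norm (u t))\<^sup>2 \<partial>timeM T)"

definition test_function :: "real \<Rightarrow> (real \<Rightarrow> real) \<Rightarrow> bool" where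
  "test_function T \<phi> \<longleftrightarrow>
     (\<forall>k x. ((deriv ^^ k) \<phi>) differentiable (at x)) \<and>
     (\<exists>a b. 0 < a \<and> b < T \<and> (\<forall>t. t \<notin> {a..b} \<longrightarrow> \<phi> t = 0))"

definition has_weak_derivative ::
    "real \<Rightarrow> (real \<Rightarrow> 'a::{banach,second_countable_topology}) \<Rightarrow> (real \<Rightarrow> 'a) \<Rightarrow> bool" where
  "has_weak_derivative T u u' \<longleftrightarrow>
     (\<forall>\<phi>. test_function T \<phi> \<longrightarrow>
        (\<integral>t. deriv \<phi> t *\<^sub>R u t \<partial>timeM T) = - (\<integral>t. \<phi> t *\<^sub>R u' t \<partial>timeM T))"

definition H1 :: "real \<Rightarrow> (real \<Rightarrow> 'a::{banach,second_countable_topology}) set" where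
  "H1 T = {u \<in> L2 T. \<exists>u'\<in>L2 T. has_weak_derivative T u u'}"

text \<open>On \<open>H1 T\<close> the weak derivative is unique up to null sets.\<close>

definition weak_derivative ::
    "real \<Rightarrow> (real \<Rightarrow> 'a::{banach,second_countable_topology}) \<Rightarrow> real \<Rightarrow> 'a" where
  "weak_derivative T u = (SOME u'. u' \<in> L2 T \<and> has_weak_derivative T u u')"

definition H1_norm :: "real \<Rightarrow> (real \<Rightarrow> 'a::{banach,second_countable_topology}) \<Rightarrow> real" where
  "H1_norm T u = sqrt ((L2_norm T u)\<^sup>2 + (L2_norm T (weak_derivative T u))\<^sup>2)"

text \<open>\<open>L2(0,T;V) \<inter> H1(0,T;H)\<close> with the norm of the intersection.\<close>

definition Ws ::
    "real \<Rightarrow> ('v::{banach,second_countable_topology} \<Rightarrow> 'h::{banach,second_countable_topology})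
      \<Rightarrow> (real \<Rightarrow> 'v) set" where
  "Ws T \<iota> = {u \<in> L2 T. \<iota> \<circ> u \<in> H1 T}"

definition Ws_norm ::
    "real \<Rightarrow> ('v::{banach,second_countable_topology} \<Rightarrow> 'h::{banach,second_countable_topology})
      \<Rightarrow> (real \<Rightarrow> 'v) \<Rightarrow> real" where
  "Ws_norm T \<iota> u = L2_norm T u + H1_norm T (\<iota> \<circ> u)"

text \<open>The value at time 0 is that of the continuous representative.\<close>

definition has_initial_value :: "real \<Rightarrow> (real \<Rightarrow> 'a::{banach,second_countable_topology}) \<Rightarrow> 'a \<Rightarrow> bool" where
  "has_initial_value T u x \<longleftrightarrow>
     (\<exists>c. continuous_on {0..T} c \<and> (AE t in timeM T. u t = c t) \<and> c 0 = x)"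


section \<open>Weak and weak-* convergence\<close>

text \<open>
  Bounded linear functionals on a space \<open>S\<close> of functions of time with (semi)norm \<open>nrm\<close>;
  boundedness makes them invariant under changes on null sets.
\<close>

definition bounded_functional ::
    "(real \<Rightarrow> 'a::real_vector) set \<Rightarrow> ((real \<Rightarrow> 'a) \<Rightarrow> real) \<Rightarrow> ((real \<Rightarrow> 'a) \<Rightarrow> real) \<Rightarrow> bool" where
  "bounded_functional S nrm F \<longleftrightarrow>
     (\<forall>u\<in>S. \<forall>w\<in>S. F (\<lambda>t. u t + w t) = F u + F w) \<and>
     (\<forall>u\<in>S. \<forall>c. F (\<lambda>t. c *\<^sub>R u t) = c * F u) \<and>
     (\<exists>C. \<forall>u\<in>S. \<bar>F u\<bar> \<le> C * nrm u)"

definition converges_weakly ::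
    "(real \<Rightarrow> 'a::real_vector) set \<Rightarrow> ((real \<Rightarrow> 'a) \<Rightarrow> real) \<Rightarrow> (nat \<Rightarrow> real \<Rightarrow> 'a) \<Rightarrow> (real \<Rightarrow> 'a) \<Rightarrow> bool"
  where
  "converges_weakly S nrm u\<^sub>n u \<longleftrightarrow>
     (\<forall>n. u\<^sub>n n \<in> S) \<and> u \<in> S \<and>
     (\<forall>F. bounded_functional S nrm F \<longrightarrow> (\<lambda>n. F (u\<^sub>n n)) \<longlonglongrightarrow> F u)"

text \<open>Weak-* convergence in \<open>Linf(0,T;H)\<close>, as the dual of \<open>L1(0,T;H)\<close>.\<close>

definition converges_weak_star_Linf ::
    "real \<Rightarrow> (nat \<Rightarrow> real \<Rightarrow> 'h::{real_inner,banach,second_countable_topology})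
      \<Rightarrow> (real \<Rightarrow> 'h) \<Rightarrow> bool" where
  "converges_weak_star_Linf T u\<^sub>n u \<longleftrightarrow>
     (\<forall>n. u\<^sub>n n \<in> Linf T) \<and> u \<in> Linf T \<and>
     (\<forall>g\<in>L1 T. (\<lambda>n. \<integral>t. u\<^sub>n n t \<bullet> g t \<partial>timeM T) \<longlonglongrightarrow> (\<integral>t. u t \<bullet> g t \<partial>timeM T))"


section \<open>Gelfand triple, order, and operator\<close>

definition gelfand_embedding :: "('v::real_inner \<Rightarrow> 'h::real_inner) \<Rightarrow> bool" where
  "gelfand_embedding \<iota> \<longleftrightarrow>
     bounded_linear \<iota> \<and> inj \<iota> \<and> closure (range \<iota>) = UNIV \<and>
     (\<forall>S. bounded S \<longrightarrow> compact (closure (\<iota> ` S)))"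

text \<open>The inclusion of \<open>H\<close> into \<open>V*\<close>.\<close>

definition to_dual :: "('v::real_inner \<Rightarrow> 'h::real_inner) \<Rightarrow> 'h \<Rightarrow> 'v \<Rightarrow>\<^sub>L real" where
  "to_dual \<iota> x = Blinfun (\<lambda>v. x \<bullet> \<iota> v)"

lemma to_dual_apply:
  assumes "bounded_linear \<iota>"
  shows "blinfun_apply (to_dual \<iota> x) v = x \<bullet> \<iota> v"
  unfolding to_dual_def
  by (subst bounded_linear_Blinfun_apply)
     (use bounded_linear_compose[OF bounded_linear_inner_right assms] in \<open>auto simp: o_def\<close>)

definition self_dual_cone :: "'h::real_inner set \<Rightarrow> bool" where
  "self_dual_cone K \<longleftrightarrow> closed K \<and> convex K \<and> cone K \<and> K = {x. \<forall>g\<in>K. x \<bullet> g \<ge> 0}"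

definition ord_le :: "'h::real_inner set \<Rightarrow> 'h \<Rightarrow> 'h \<Rightarrow> bool" where
  "ord_le K x y \<longleftrightarrow> y - x \<in> K"

text \<open>
  The orthogonal projection \<open>v\<^sup>+\<close> onto \<open>K\<close>, and the complementary part in \<open>v = v\<^sup>+ - v\<^sup>-\<close>.
  Self-duality of \<open>K\<close> alone does not make \<open>v\<^sup>+\<close> the supremum of \<open>v\<close> and \<open>0\<close> (the cone of positive
  semidefinite matrices is self-dual, but not a lattice cone); that is a separate hypothesis.
\<close>

definition pos_part :: "'h::real_inner set \<Rightarrow> 'h \<Rightarrow> 'h" where
  "pos_part K v = (THE p. p \<in> K \<and> (\<forall>q\<in>K. norm (v - p) \<le> norm (v - q)))"

definition neg_part :: "'h::real_inner set \<Rightarrow> 'h \<Rightarrow> 'h" where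
  "neg_part K v = pos_part K v - v"

definition pos_part_bounded_on_V :: "('v::real_inner \<Rightarrow> 'h::real_inner) \<Rightarrow> 'h set \<Rightarrow> bool" where
  "pos_part_bounded_on_V \<iota> K \<longleftrightarrow>
     (\<exists>C. \<forall>v. \<exists>p. \<iota> p = pos_part K (\<iota> v) \<and> norm p \<le> C * norm v)"

definition admissible_operator ::
    "('v::real_inner \<Rightarrow> 'h::real_inner) \<Rightarrow> 'h set \<Rightarrow> ('v \<Rightarrow>\<^sub>L 'v \<Rightarrow>\<^sub>L real) \<Rightarrow> bool" where
  "admissible_operator \<iota> K A \<longleftrightarrow>
     (\<forall>u v. A u v = A v u) \<and>
     (\<exists>\<alpha>>0. \<forall>v. A v v \<ge> \<alpha> * (norm v)\<^sup>2) \<and>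
     (\<forall>v p m. \<iota> p = pos_part K (\<iota> v) \<longrightarrow> \<iota> m = neg_part K (\<iota> v) \<longrightarrow> A p m \<le> 0)"

text \<open>\<open>w(s) \<le> w(t)\<close> for almost all \<open>s \<le> t\<close>.\<close>

definition increasing_in_time :: "real \<Rightarrow> 'h::real_inner set \<Rightarrow> (real \<Rightarrow> 'h) \<Rightarrow> bool" where
  "increasing_in_time T K w \<longleftrightarrow>
     (AE s in timeM T. AE t in timeM T. s \<le> t \<longrightarrow> ord_le K (w s) (w t))"

text \<open>
  The map \<open>\<Phi> : L2(0,T;H) \<rightarrow> L2(0,T;V)\<close>.  Monotonicity with respect to the a.e. order (a partial
  order on classes, as a self-dual cone is pointed) makes \<open>\<Phi>\<close> well defined on a.e. classes.
\<close>

definition increasing_map ::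
    "real \<Rightarrow> ('v::{real_inner,banach,second_countable_topology}
        \<Rightarrow> 'h::{real_inner,banach,second_countable_topology})
      \<Rightarrow> 'h set \<Rightarrow> ((real \<Rightarrow> 'h) \<Rightarrow> real \<Rightarrow> 'v) \<Rightarrow> bool" where
  "increasing_map T \<iota> K \<Phi> \<longleftrightarrow>
     (\<forall>\<psi>\<in>L2 T. \<Phi> \<psi> \<in> L2 T) \<and>
     (\<forall>\<psi>\<^sub>1\<in>L2 T. \<forall>\<psi>\<^sub>2\<in>L2 T. (AE t in timeM T. ord_le K (\<psi>\<^sub>1 t) (\<psi>\<^sub>2 t)) \<longrightarrow>
        (AE t in timeM T. ord_le K (\<iota> (\<Phi> \<psi>\<^sub>1 t)) (\<iota> (\<Phi> \<psi>\<^sub>2 t))))"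


section \<open>Time discretisation\<close>

definition grid :: "real \<Rightarrow> nat \<Rightarrow> nat \<Rightarrow> real" where
  "grid T N n = real n * (T / real N)"

definition cell :: "real \<Rightarrow> nat \<Rightarrow> nat \<Rightarrow> real set" where
  "cell T N n = {grid T N n ..< grid T N (Suc n)}"

definition cell_mean ::
    "real \<Rightarrow> nat \<Rightarrow> (real \<Rightarrow> 'a::{banach,second_countable_topology}) \<Rightarrow> nat \<Rightarrow> 'a" where
  "cell_mean T N f n =
     (1 / (T / real N)) *\<^sub>R (LINT t:{grid T N (n - 1)..grid T N n}|lebesgue. f t)"

definition step_interpolant :: "real \<Rightarrow> nat \<Rightarrow> (nat \<Rightarrow> 'a::real_vector) \<Rightarrow> real \<Rightarrow> 'a" where
  "step_interpolant T N w t = (\<Sum>n=1..N. indicat_real (cell T N (n - 1)) t *\<^sub>R w n)"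

definition affine_interpolant :: "real \<Rightarrow> nat \<Rightarrow> (nat \<Rightarrow> 'a::real_vector) \<Rightarrow> real \<Rightarrow> 'a" where
  "affine_interpolant T N w t =
     (\<Sum>n=1..N. indicat_real (cell T N (n - 1)) t *\<^sub>R
        (w (n - 1) + ((t - grid T N (n - 1)) / (T / real N)) *\<^sub>R (w n - w (n - 1))))"

text \<open>
  \<open>zb n\<close> and \<open>zs n\<close> are the iterates of the scheme with \<open>N\<close> time steps.  An element \<open>v\<close> of \<open>V\<close> enters
  \<open>\<Phi>\<close> as the constant function \<open>\<lambda>_. \<iota> v\<close>; for such arguments \<open>\<Phi>\<close> returns the continuous representative,
  so that evaluation at a grid point makes sense.
\<close>

definition discrete_solution ::
    "real \<Rightarrow> ('v::{real_inner,banach,second_countable_topology}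
        \<Rightarrow> 'h::{real_inner,banach,second_countable_topology})
      \<Rightarrow> 'h set \<Rightarrow> ('v \<Rightarrow>\<^sub>L 'v \<Rightarrow>\<^sub>L real) \<Rightarrow> ((real \<Rightarrow> 'h) \<Rightarrow> real \<Rightarrow> 'v)
      \<Rightarrow> (real \<Rightarrow> 'h) \<Rightarrow> 'v \<Rightarrow> nat \<Rightarrow> (nat \<Rightarrow> 'v) \<Rightarrow> (nat \<Rightarrow> 'v) \<Rightarrow> bool" where
  "discrete_solution T \<iota> K A \<Phi> f z\<^sub>0 N zb zs \<longleftrightarrow>
     (let h = T / real N in
      zs 0 = z\<^sub>0 \<and>
      (\<forall>n\<in>{1..N}.
         to_dual \<iota> (\<iota> (zb n)) + h *\<^sub>R A (zb n)
           = h *\<^sub>R to_dual \<iota> (cell_mean T N f n) + to_dual \<iota> (\<iota> (zs (n - 1))) \<and>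
         ord_le K (\<iota> (zs (n - 1))) (\<iota> (zs n)) \<and>
         ord_le K (\<iota> (zs n)) (\<iota> (zb n)) \<and>
         ord_le K (\<iota> (zs n)) (\<iota> (\<Phi> (\<lambda>_. \<iota> (zs n)) (grid T N (n - 1)))) \<and>
         (\<forall>v. ord_le K (\<iota> v) (\<iota> (\<Phi> (\<lambda>_. \<iota> (zs n)) (grid T N (n - 1)))) \<longrightarrow>
            (to_dual \<iota> ((1 / h) *\<^sub>R \<iota> (zs n - zs (n - 1))) + A (zs n) - to_dual \<iota> (cell_mean T N f n))
              (zs n - v) \<le> 0)))"


section \<open>The parabolic quasi-variational inequality\<close>

definition solves_parabolic_qvi ::
    "real \<Rightarrow> ('v::{real_inner,banach,second_countable_topology}
        \<Rightarrow> 'h::{real_inner,banach,second_countable_topology})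
      \<Rightarrow> 'h set \<Rightarrow> ('v \<Rightarrow>\<^sub>L 'v \<Rightarrow>\<^sub>L real) \<Rightarrow> ((real \<Rightarrow> 'h) \<Rightarrow> real \<Rightarrow> 'v)
      \<Rightarrow> (real \<Rightarrow> 'h) \<Rightarrow> 'v \<Rightarrow> (real \<Rightarrow> 'v) \<Rightarrow> bool" where
  "solves_parabolic_qvi T \<iota> K A \<Phi> f z\<^sub>0 z \<longleftrightarrow>
     z \<in> Ws T \<iota> \<and>
     has_initial_value T (\<iota> \<circ> z) (\<iota> z\<^sub>0) \<and>
     (AE t in timeM T. ord_le K (\<iota> (z t)) (\<iota> (\<Phi> (\<iota> \<circ> z) t))) \<and>
     (\<forall>v\<in>L2 T. (AE t in timeM T. ord_le K (\<iota> (v t)) (\<iota> (\<Phi> (\<iota> \<circ> z) t))) \<longrightarrow>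
        (\<integral>t. (to_dual \<iota> (weak_derivative T (\<iota> \<circ> z) t) + A (z t) - to_dual \<iota> (f t)) (z t - v t)
           \<partial>timeM T) \<le> 0)"

end

theory Submission
  imports Defs "HOL-Computational_Algebra.Polynomial" "HOL-Library.Diagonal_Subsequence"
begin

text \<open>
  Each time step is solved by a fixed point of the map sending \<open>x\<close> to the solution of the obstacle problem
  with obstacle \<open>\<Phi>(x)(t\<^sub>n)\<close>; the previous iterate is a subsolution because \<open>f\<close> and the obstacle increase in time.
  Testing the discrete inequality with the previous iterate, which is admissible because the iterates increase,
  bounds them in \<open>V\<close> and their difference quotients in \<open>L2(0,T;H)\<close>.  By compactness of \<open>V \<subseteq> H\<close> a
  subsequence converges pointwise in \<open>H\<close>.

  Weak limits are identified without representing dual spaces: by Mazur's lemma a sequence converges weakly to \<open>z\<close>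
  as soon as every norm-Cauchy sequence of iterated midpoints of its tails converges to \<open>z\<close>, and such sequences
  have pointwise limits in \<open>H\<close>.  In the limit of the inequality the test function is \<open>v - \<Phi>(z)\<close>
  plus the discrete obstacle, which converges strongly by the last hypothesis, and the quadratic term is bounded
  below by \<open>\<langle>A a, a\<rangle> \<ge> 2 \<langle>A a, z\<rangle> - \<langle>A z, z\<rangle>\<close>.
\<close>

section \<open>Variational inequalities and self-dual cones\<close>

text \<open>The pointwise limit in H serves three purposes. It makes the iterates converge strongly
  in L2(0,T;H), so that their product with the weakly convergent difference quotients passes to the
  limit; it supplies a continuous representative that carries the initial value; and it keeps the
  order between any two times. It rests on a Hoelder modulus of exponent 1/2, the Cauchy-Schwarz
  consequence of the bound on the difference quotients, up to an error of one step size.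

  Two mismatches shape the rest. The order hypotheses on \<Phi> hold for almost every time, while
  the scheme evaluates \<Phi> at grid points; continuity in time for constant arguments and
  closedness of the cone bridge this. The hypothesis on the discrete obstacles speaks of sequences
  indexed by all N, each on the grid of N, while convergence is known only along a subsequence; the
  missing indices are filled with the limit.

  Weak derivatives are chosen representatives, so identities about them hold only almost everywhere;
  the fundamental lemma of the calculus of variations provides them.\<close>

lemma variational_inequality_solvable:
  fixes b :: "'v::{real_inner,banach} \<Rightarrow> 'v \<Rightarrow> real"
  assumes b: "bounded_bilinear b" and sym: "\<And>u v. b u v = b v u"
    and \<alpha>: "\<alpha> > 0" and coercive: "\<And>v. b v v \<ge> \<alpha> * (norm v)\<^sup>2"
    and l: "bounded_linear l"
    and C: "closed C" "convex C" "C \<noteq> {}"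
  shows "\<exists>z\<in>C. \<forall>v\<in>C. b z (z - v) \<le> l (z - v)"
proof -
  interpret b: bounded_bilinear b by fact
  interpret l: bounded_linear l by fact
  \<comment> \<open>As \<open>b\<close> is symmetric, the inequality is the first-order condition
    for minimising \<open>J\<close> over \<open>C\<close>; coercivity bounds \<open>J\<close> from
    below by completing a square.\<close>
  define J where "J v = b v v - 2 * l v" for v
  obtain L where L: "L > 0" "\<And>v. \<bar>l v\<bar> \<le> norm v * L"
    using l.pos_bounded by (auto simp: real_norm_def)
  have "- (L\<^sup>2 / \<alpha>) \<le> J v" for v
  proof -
    have "0 \<le> (\<alpha> * norm v - L)\<^sup>2 / \<alpha>" using \<alpha> by simp
    also have "\<dots> = \<alpha> * (norm v)\<^sup>2 - 2 * (norm v * L) + L\<^sup>2 / \<alpha>"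
      using \<alpha> by (simp add: field_simps power2_eq_square)
    also have "\<dots> \<le> J v + L\<^sup>2 / \<alpha>"
      using coercive[of v] L(2)[of v] by (auto simp: J_def)
    finally show ?thesis by simp
  qed
  then have bdd: "bdd_below (J ` C)" by (auto intro!: bdd_belowI[of _ "- (L\<^sup>2 / \<alpha>)"])
  define m where "m = Inf (J ` C)"
  have m_le: "m \<le> J v" if "v \<in> C" for v
    unfolding m_def using bdd that by (intro cInf_lower) auto
  have "\<exists>v\<in>C. J v < m + 1 / Suc k" for k
  proof -
    have "\<exists>x\<in>J ` C. x < m + 1 / Suc k"
      using C(3) bdd by (subst cInf_less_iff[symmetric]) (auto simp: m_def)
    then show ?thesis by auto
  qed
  then obtain w where w: "\<And>k. w k \<in> C" "\<And>k. J (w k) < m + 1 / Suc k" by metis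
  \<comment> \<open>Parallelogram identity: the linear part of \<open>J\<close> cancels. Midpoints
    stay in \<open>C\<close>, where \<open>J\<close> is at least \<open>m\<close>, so two
    near-minimisers are close to each other.\<close>
  have par: "J u + J v - 2 * J ((1/2) *\<^sub>R (u + v)) = (1/2) * b (u - v) (u - v)" for u v
    by (simp add: J_def b.add_left b.add_right b.diff_left b.diff_right b.scaleR_left b.scaleR_right
        l.add l.scaleR field_simps sym[of v u])
  have mid: "(1/2) *\<^sub>R (u + v) \<in> C" if "u \<in> C" "v \<in> C" for u v
    using convexD[OF C(2) that, of "1/2" "1/2"] by (simp add: scaleR_add_right)
  have close: "\<alpha> * (norm (w j - w k))\<^sup>2 \<le> 2 * (1 / Suc j + 1 / Suc k)" for j k
  proof -
    have "b (w j - w k) (w j - w k) = 2 * (J (w j) + J (w k) - 2 * J ((1/2) *\<^sub>R (w j + w k)))"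
      by (simp add: par)
    also have "\<dots> \<le> 2 * (1 / Suc j + 1 / Suc k)"
      using m_le[OF mid[OF w(1) w(1)], of j k] w(2)[of j] w(2)[of k] by argo
    finally show ?thesis using coercive[of "w j - w k"] by simp
  qed
  have "Cauchy w"
  proof (rule metric_CauchyI)
    fix e :: real assume e: "e > 0"
    then have "\<alpha> * e\<^sup>2 / 4 > 0" using \<alpha> by simp
    then obtain M where M: "1 / Suc M < \<alpha> * e\<^sup>2 / 4"
      using nat_approx_posE by blast
    show "\<exists>M. \<forall>m\<ge>M. \<forall>n\<ge>M. dist (w m) (w n) < e"
    proof (intro exI allI impI)
      fix j k assume jk: "M \<le> j" "M \<le> k"
      have "1 / Suc j \<le> 1 / Suc M" "1 / Suc k \<le> 1 / Suc M" using jk by (auto simp: field_simps)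
      then have "\<alpha> * (norm (w j - w k))\<^sup>2 < \<alpha> * e\<^sup>2" using close[of j k] M by argo
      then have "(norm (w j - w k))\<^sup>2 < e\<^sup>2" using \<alpha> by simp
      then show "dist (w j) (w k) < e" using e by (auto simp: dist_norm intro: power2_less_imp_less)
    qed
  qed
  then obtain z where z: "w \<longlonglongrightarrow> z" using Cauchy_convergent convergent_def by blast
  have zC: "z \<in> C" using C(1) w(1) z closed_sequentially by blast
  have "(\<lambda>k. J (w k)) \<longlonglongrightarrow> J z"
    unfolding J_def by (intro tendsto_intros b.tendsto l.tendsto z)
  moreover have "(\<lambda>k. m + 1 / real (Suc k)) \<longlonglongrightarrow> m + 0"
    using LIMSEQ_Suc[OF lim_1_over_n] by (intro tendsto_intros) auto
  ultimately have Jz: "J z \<le> m"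
    using w(2) by (metis (mono_tags, lifting) LIMSEQ_le add_0_right less_imp_le)
  show ?thesis
  proof (intro bexI ballI)
    fix v assume v: "v \<in> C"
    define d where "d = v - z"
    \<comment> \<open>Multiplied by \<open>t\<close> this is
      \<open>J (z + t *\<^sub>R d) - J z\<close>; dividing by \<open>t\<close> and letting it tend
      to 0 leaves the derivative of \<open>J\<close> in the direction \<open>d\<close>.\<close>
    have key: "0 \<le> 2 * (b z d - l d) + t * b d d" if t: "0 < t" "t \<le> 1" for t
    proof -
      have "z + t *\<^sub>R d = (1 - t) *\<^sub>R z + t *\<^sub>R v" by (simp add: d_def algebra_simps)
      then have "z + t *\<^sub>R d \<in> C" using convexD_alt[OF C(2) zC v] t by auto
      then have "J z \<le> J (z + t *\<^sub>R d)" using Jz m_le by force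
      also have "J (z + t *\<^sub>R d) = J z + t * (2 * (b z d - l d) + t * b d d)"
        by (simp add: J_def b.add_left b.add_right b.scaleR_left b.scaleR_right
            l.add l.scaleR algebra_simps sym[of d z])
      finally show ?thesis using t by (simp add: zero_le_mult_iff)
    qed
    have "0 \<le> 2 * (b z d - l d)"
    proof (rule tendsto_lowerbound)
      show "((\<lambda>t. 2 * (b z d - l d) + t * b d d) \<longlongrightarrow> 2 * (b z d - l d)) (at_right 0)"
        by (auto intro!: tendsto_eq_intros)
      show "\<forall>\<^sub>F t in at_right 0. 0 \<le> 2 * (b z d - l d) + t * b d d"
        by (rule eventually_mono[OF eventually_at_right_real[of 0 1]]) (simp, rule key, auto)
    qed auto
    then show "b z (z - v) \<le> l (z - v)"
      by (simp add: d_def b.diff_right l.diff)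
  qed fact
qed

section \<open>The order of a self-dual cone\<close>

lemma ord_le_refl: "self_dual_cone K \<Longrightarrow> ord_le K x x"
  unfolding self_dual_cone_def ord_le_def by auto

lemma self_dual_coneD: "self_dual_cone K \<Longrightarrow> x \<in> K \<longleftrightarrow> (\<forall>g\<in>K. x \<bullet> g \<ge> 0)"
  unfolding self_dual_cone_def by auto

lemma self_dual_cone_add: "self_dual_cone K \<Longrightarrow> x \<in> K \<Longrightarrow> y \<in> K \<Longrightarrow> x + y \<in> K"
  by (auto simp: self_dual_coneD[of K "x + y"] self_dual_coneD[of K x] self_dual_coneD[of K y] inner_add_left)

lemma self_dual_cone_scale: "self_dual_cone K \<Longrightarrow> x \<in> K \<Longrightarrow> c \<ge> 0 \<Longrightarrow> c *\<^sub>R x \<in> K"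
  unfolding self_dual_cone_def cone_def by auto

lemma self_dual_cone_inner: "self_dual_cone K \<Longrightarrow> x \<in> K \<Longrightarrow> y \<in> K \<Longrightarrow> 0 \<le> x \<bullet> y"
  unfolding self_dual_cone_def by auto

lemma ord_le_trans: "self_dual_cone K \<Longrightarrow> ord_le K x y \<Longrightarrow> ord_le K y z \<Longrightarrow> ord_le K x z"
  using self_dual_cone_add[of K "y - x" "z - y"] by (simp add: ord_le_def)

text \<open>Self-duality makes the cone pointed: \<open>y - x\<close> and its negative both lie in
  \<open>K\<close>, so their inner product, which is minus a squared norm, is nonnegative.\<close>

lemma ord_le_antisym:
  assumes K: "self_dual_cone K" and xy: "ord_le K x y" "ord_le K y x"
  shows "x = y"
proof -
  have "0 \<le> (y - x) \<bullet> (x - y)" using self_dual_cone_inner[OF K] xy by (auto simp: ord_le_def)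
  then have "(y - x) \<bullet> (y - x) \<le> 0" by (simp add: inner_diff_left inner_diff_right inner_commute)
  then show ?thesis by (metis inner_eq_zero_iff inner_ge_zero order_antisym right_minus_eq)
qed

lemma closed_self_dual_cone: "self_dual_cone K \<Longrightarrow> closed K"
  unfolding self_dual_cone_def by auto

lemma ord_le_lim:
  assumes K: "self_dual_cone K" and "F \<noteq> bot" "(u \<longlongrightarrow> x) F" "(w \<longlongrightarrow> y) F"
    and ev: "\<forall>\<^sub>F n in F. ord_le K (u n) (w n)"
  shows "ord_le K x y"
proof -
  have "((\<lambda>n. w n - u n) \<longlongrightarrow> y - x) F" using assms by (intro tendsto_intros)
  then show ?thesis
    using Lim_in_closed_set[OF closed_self_dual_cone[OF K], of "\<lambda>n. w n - u n" F "y - x"] assms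
    unfolding ord_le_def by auto
qed

text \<open>Expanding the square, the claim is that \<open>(y - x) \<bullet> x\<close> is
  nonnegative. The distance of comparable nonnegative elements is thus controlled by the growth of
  the norm, which makes suitable sequences in order-bounded chains Cauchy.\<close>

lemma norm_diff_le_of_ord_le:
  assumes K: "self_dual_cone K" and "ord_le K 0 x" "ord_le K x y"
  shows "(norm (y - x))\<^sup>2 \<le> (norm y)\<^sup>2 - (norm x)\<^sup>2"
proof -
  have "0 \<le> (y - x) \<bullet> x" using assms by (intro self_dual_cone_inner[OF K]) (auto simp: ord_le_def)
  then show ?thesis
    by (simp add: power2_norm_eq_inner inner_diff_left inner_diff_right inner_commute)
qed

text \<open>Moreau's decomposition; the polar of a self-dual cone is its negative, so both parts lie
  in \<open>K\<close>. The projection \<open>p\<close> solves the variational inequality for the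
  inner product; testing it with \<open>p + q\<close> puts \<open>p - v\<close> into
  \<open>K\<close>, and testing it with 0 gives orthogonality.\<close>

lemma pos_part_decomposition:
  fixes v :: "'h::{real_inner,banach}"
  assumes K: "self_dual_cone K"
  shows "pos_part K v \<in> K" "neg_part K v \<in> K" "pos_part K v \<bullet> neg_part K v = 0"
proof -
  have cl: "closed K" "convex K" "K \<noteq> {}" and cone: "cone K" and zero: "0 \<in> K"
    using K self_dual_coneD[OF K, of 0] by (auto simp: self_dual_cone_def)
  have "\<exists>p\<in>K. \<forall>q\<in>K. p \<bullet> (p - q) \<le> v \<bullet> (p - q)"
    by (rule variational_inequality_solvable[where \<alpha>=1])
      (use cl in \<open>auto simp: inner_commute bounded_bilinear_inner bounded_linear_inner_right power2_norm_eq_inner\<close>)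
  then obtain p where p: "p \<in> K" and vi: "\<And>q. q \<in> K \<Longrightarrow> p \<bullet> (p - q) \<le> v \<bullet> (p - q)" by auto
  \<comment> \<open>A strict form of minimality: it makes \<open>p\<close> the only minimiser, so
    that the definite description in \<open>pos_part\<close> denotes it.\<close>
  have expand: "(norm (v - q))\<^sup>2 \<ge> (norm (v - p))\<^sup>2 + (norm (p - q))\<^sup>2" if "q \<in> K" for q
    using vi[OF that]
    by (simp add: power2_norm_eq_inner inner_diff_left inner_diff_right inner_commute)
  have "pos_part K v = p"
    unfolding pos_part_def
  proof (rule the_equality)
    show "p \<in> K \<and> (\<forall>q\<in>K. norm (v - p) \<le> norm (v - q))"
    proof (intro conjI ballI)
      fix q assume "q \<in> K"
      then have "(norm (v - p))\<^sup>2 \<le> (norm (v - q))\<^sup>2" using expand[of q] zero_le_power2[of "norm (p - q)"] by linarith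
      then show "norm (v - p) \<le> norm (v - q)" by (rule power2_le_imp_le) simp
    qed fact
    fix q assume q: "q \<in> K \<and> (\<forall>r\<in>K. norm (v - q) \<le> norm (v - r))"
    then have "(norm (v - q))\<^sup>2 \<le> (norm (v - p))\<^sup>2" using p by (simp add: power_mono)
    then have "(norm (p - q))\<^sup>2 \<le> 0" using expand[of q] q by linarith
    then show "q = p" by simp
  qed
  then have n: "neg_part K v = p - v" by (simp add: neg_part_def)
  have ge: "0 \<le> (p - v) \<bullet> q" if "q \<in> K" for q
    using vi[OF self_dual_cone_add[OF K p that]] by (simp add: inner_diff_left)
  have eq: "(p - v) \<bullet> p = 0"
    using vi[OF zero] ge[OF p] by (simp add: inner_diff_left)
  show "pos_part K v \<in> K" using \<open>pos_part K v = p\<close> p by simp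
  show "neg_part K v \<in> K" unfolding n using ge by (subst self_dual_coneD[OF K]) auto
  show "pos_part K v \<bullet> neg_part K v = 0"
    unfolding n \<open>pos_part K v = p\<close> using eq by (simp add: inner_commute)
qed

lemma frequently_subseq:
  assumes "\<exists>\<^sub>F n in sequentially. P n"
  shows "\<exists>r :: nat \<Rightarrow> nat. strict_mono r \<and> (\<forall>n. P (r n))"
  using assms infinite_enumerate[of "{n. P n}"]
  by (auto simp: frequently_cofinite simp flip: cofinite_eq_sequentially)

text \<open>On elements above \<open>a\<close> the squared distance \<open>q\<close> to
  \<open>a\<close> increases with the order, and its increase controls the distance of comparable
  elements. A sequence in the chain that maximises \<open>q\<close> is therefore Cauchy, and its
  limit bounds the chain from above.\<close>

lemma chain_sup_exists:
  fixes a b :: "'h::{real_inner,banach}"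
  assumes K: "self_dual_cone K" and ne: "C \<noteq> {}"
    and bd: "\<And>x. x \<in> C \<Longrightarrow> ord_le K a x \<and> ord_le K x b"
    and chain: "\<And>x y. x \<in> C \<Longrightarrow> y \<in> C \<Longrightarrow> ord_le K x y \<or> ord_le K y x"
  shows "\<exists>w s. (\<forall>n. w n \<in> C) \<and> w \<longlonglongrightarrow> s \<and> (\<forall>x\<in>C. ord_le K x s)"
proof -
  define q where "q x = (norm (x - a))\<^sup>2" for x
  have mono: "(norm (y - x))\<^sup>2 \<le> q y - q x" if "ord_le K a x" "ord_le K x y" for x y
    using norm_diff_le_of_ord_le[OF K, of "x - a" "y - a"] that by (auto simp: ord_le_def q_def)
  have dist: "(norm (y - x))\<^sup>2 \<le> \<bar>q y - q x\<bar>" if "x \<in> C" "y \<in> C" for x y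
    using mono[of x y] mono[of y x] bd[OF that(1)] bd[OF that(2)] chain[OF that]
    by (auto simp: norm_minus_commute)
  have "q x \<le> q b" if "x \<in> C" for x
    using mono[of x b] bd[OF that] zero_le_power2[of "norm (b - x)"] by linarith
  then have bdd: "bdd_above (q ` C)" by (intro bdd_aboveI[of _ "q b"]) auto
  define S where "S = Sup (q ` C)"
  have le_S: "q x \<le> S" if "x \<in> C" for x
    unfolding S_def using bdd that by (intro cSup_upper) auto
  have "\<exists>x\<in>C. S - 1 / Suc k < q x" for k
  proof -
    have "\<exists>y\<in>q ` C. S - 1 / Suc k < y"
      using ne bdd by (subst less_cSup_iff[symmetric]) (auto simp: S_def)
    then show ?thesis by auto
  qed
  then obtain w where w: "\<And>k. w k \<in> C" "\<And>k. S - 1 / Suc k < q (w k)" by metis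
  have "Cauchy w"
  proof (rule metric_CauchyI)
    fix e :: real assume e: "e > 0"
    then obtain M where M: "1 / Suc M < e\<^sup>2" using nat_approx_posE[of "e\<^sup>2"] by auto
    show "\<exists>M. \<forall>m\<ge>M. \<forall>n\<ge>M. dist (w m) (w n) < e"
    proof (intro exI allI impI)
      fix j k assume jk: "M \<le> j" "M \<le> k"
      have "1 / Suc j \<le> 1 / Suc M" "1 / Suc k \<le> 1 / Suc M" using jk by (auto simp: field_simps)
      then have "\<bar>q (w j) - q (w k)\<bar> \<le> 1 / Suc M"
        using le_S[OF w(1)[of j]] le_S[OF w(1)[of k]] w(2)[of j] w(2)[of k] by argo
      then have "(norm (w j - w k))\<^sup>2 < e\<^sup>2" using dist[OF w(1)[of k] w(1)[of j]] M by linarith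
      then show "dist (w j) (w k) < e" using e by (auto simp: dist_norm intro: power2_less_imp_less)
    qed
  qed
  then obtain s where s: "w \<longlonglongrightarrow> s" using Cauchy_convergent convergent_def by blast
  have "ord_le K x s" if x: "x \<in> C" for x
  \<comment> \<open>Either \<open>x\<close> lies below infinitely many \<open>w n\<close> and the
    closed order passes to the limit, or the chain puts almost all \<open>w n\<close> below
    \<open>x\<close>; then near-maximality of \<open>q (w n)\<close> forces \<open>w\<close> to
    converge to \<open>x\<close>.\<close>
  proof (cases "\<exists>\<^sub>F n in sequentially. ord_le K x (w n)")
    case True
    obtain r :: "nat \<Rightarrow> nat" where r: "strict_mono r" "\<And>n. ord_le K x (w (r n))"
      using frequently_subseq[OF True] by blast
    show ?thesis
      by (rule ord_le_lim[OF K, of sequentially "\<lambda>_. x" _ "\<lambda>n. w (r n)"])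
        (use r LIMSEQ_subseq_LIMSEQ[OF s r(1)] in \<open>auto simp: o_def\<close>)
  next
    case False
    then have ev: "\<forall>\<^sub>F n in sequentially. \<not> ord_le K x (w n)" by (simp add: not_frequently)
    have "(\<lambda>n. (norm (x - w n))\<^sup>2) \<longlonglongrightarrow> 0"
    proof (rule tendsto_sandwich[of "\<lambda>_. 0"])
      show "\<forall>\<^sub>F n in sequentially. (norm (x - w n))\<^sup>2 \<le> 1 / real (Suc n)"
        using ev
      proof eventually_elim
        case (elim n)
        then have "ord_le K (w n) x" using chain[OF x w(1)] by blast
        then have "(norm (x - w n))\<^sup>2 \<le> q x - q (w n)" using mono bd w(1) by blast
        then show ?case using le_S[OF x] w(2)[of n] by linarith
      qed
      show "(\<lambda>n. 1 / real (Suc n)) \<longlonglongrightarrow> 0" using LIMSEQ_Suc[OF lim_1_over_n] .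
    qed auto
    moreover have "(\<lambda>n. (norm (x - w n))\<^sup>2) \<longlonglongrightarrow> (norm (x - s))\<^sup>2"
      by (intro tendsto_intros s)
    ultimately have "(norm (x - s))\<^sup>2 = 0" using LIMSEQ_unique by blast
    then show ?thesis using ord_le_refl[OF K] by simp
  qed
  then show ?thesis using w(1) s by blast
qed

text \<open>Order intervals need not be complete lattices, but chains have suprema in norm, so Zorn's lemma
  yields a maximal post-fixed point.\<close>

lemma monotone_fixed_point:
  fixes a b :: "'h::{real_inner,banach}"
  assumes K: "self_dual_cone K" and ab: "ord_le K a b"
    and mono: "\<And>x y. ord_le K a x \<Longrightarrow> ord_le K x y \<Longrightarrow> ord_le K y b \<Longrightarrow> ord_le K (S x) (S y)"
    and a: "ord_le K a (S a)" and b: "\<And>x. ord_le K a x \<Longrightarrow> ord_le K x b \<Longrightarrow> ord_le K (S x) b"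
  shows "\<exists>x. ord_le K a x \<and> ord_le K x b \<and> S x = x"
proof -
  define P where "P = {x. ord_le K a x \<and> ord_le K x b \<and> ord_le K x (S x)}"
  define r where "r = {(x, y). x \<in> P \<and> y \<in> P \<and> ord_le K x y}"
  have aP: "a \<in> P" using a ab ord_le_refl[OF K] by (auto simp: P_def)
  have Field: "Field r = P" unfolding r_def Field_def using ord_le_refl[OF K] by auto
  have po: "Partial_order r"
    unfolding partial_order_on_def preorder_on_def Field
    using ord_le_refl[OF K] ord_le_trans[OF K] ord_le_antisym[OF K]
    by (auto simp: refl_on_def trans_def antisym_def r_def)
  have ub: "\<exists>u\<in>Field r. \<forall>x\<in>C. (x, u) \<in> r" if C: "C \<in> Chains r" for C
  proof (cases "C = {}")
    case True then show ?thesis using aP Field by auto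
  next
    case False
    have CP: "C \<subseteq> P" using C unfolding Chains_def r_def by blast
    have ch: "ord_le K x y \<or> ord_le K y x" if "x \<in> C" "y \<in> C" for x y
      using C that unfolding Chains_def r_def by blast
    obtain w s where w: "\<And>n. w n \<in> C" "w \<longlonglongrightarrow> s" and s: "\<And>x. x \<in> C \<Longrightarrow> ord_le K x s"
      using chain_sup_exists[OF K False _ ch, of a b] CP unfolding P_def by blast
    have wP: "ord_le K a (w n)" "ord_le K (w n) b" "ord_le K (w n) (S (w n))" for n
      using w(1)[of n] CP by (auto simp: P_def)
    have as: "ord_le K a s"
      by (rule ord_le_lim[OF K, of sequentially "\<lambda>_. a" _ w]) (use w wP in auto)
    have sb: "ord_le K s b"
      by (rule ord_le_lim[OF K, of sequentially w _ "\<lambda>_. b"]) (use w wP in auto)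
    \<comment> \<open>\<open>w n\<close> lies below \<open>S (w n)\<close>, which lies below
      \<open>S s\<close> by monotonicity. Closedness of the order then gives \<open>s\<close> below
      \<open>S s\<close>; no continuity of \<open>S\<close> enters.\<close>
    have "ord_le K (w n) (S s)" for n
      using ord_le_trans[OF K wP(3) mono] wP s w(1) sb by blast
    then have "ord_le K s (S s)"
      by (intro ord_le_lim[OF K, of sequentially w _ "\<lambda>_. S s"]) (use w in auto)
    then have "s \<in> P" using as sb by (auto simp: P_def)
    then show ?thesis using Field CP s by (auto simp: r_def)
  qed
  obtain m where m: "m \<in> P" and max: "\<And>x. x \<in> P \<Longrightarrow> ord_le K m x \<Longrightarrow> x = m"
    using Zorns_po_lemma[OF po ub] unfolding Field by (auto simp: r_def)
  have mm: "ord_le K a m" "ord_le K m b" "ord_le K m (S m)" using m by (auto simp: P_def)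
  have Sb: "ord_le K (S m) b" using b mm by blast
  have aS: "ord_le K a (S m)" using ord_le_trans[OF K] mm by blast
  have "S m \<in> P" using mono[OF mm(1) mm(3) Sb] aS Sb by (simp add: P_def)
  then have "S m = m" using max mm(3) by blast
  then show ?thesis using mm by blast
qed

section \<open>The space L2 and the Mazur lemma\<close>

lemma finite_measure_timeM: "finite_measure (timeM T)"
  by (intro finite_measure_lebesgue_on) auto

lemma measure_timeM: "T > 0 \<Longrightarrow> measure (timeM T) (space (timeM T)) = T"
  by (simp add: measure_restrict_space)

lemma AE_timeM_I: "(\<And>t. 0 < t \<Longrightarrow> t < T \<Longrightarrow> P t) \<Longrightarrow> AE t in timeM T. P t"
  by (auto intro: AE_I2)

lemma integrable_timeM_bounded:
  fixes u :: "real \<Rightarrow> 'a::{banach,second_countable_topology}"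
  assumes "u \<in> borel_measurable (timeM T)" "AE t in timeM T. norm (u t) \<le> C"
  shows "integrable (timeM T) u"
proof -
  interpret finite_measure "timeM T" by (rule finite_measure_timeM)
  show ?thesis using assms by (intro integrable_const_bound[of _ C]) auto
qed

lemma L2_measurable: "u \<in> L2 T \<Longrightarrow> u \<in> borel_measurable (timeM T)"
  and L2_integrable_sq: "u \<in> L2 T \<Longrightarrow> integrable (timeM T) (\<lambda>t. (norm (u t))\<^sup>2)"
  by (auto simp: L2_def)

lemma L2_I:
  assumes "u \<in> borel_measurable (timeM T)" "integrable (timeM T) g"
    and "AE t in timeM T. (norm (u t))\<^sup>2 \<le> g t"
  shows "u \<in> L2 T"
proof -
  have "integrable (timeM T) (\<lambda>t. (norm (u t))\<^sup>2)"
    by (rule Bochner_Integration.integrable_bound[OF assms(2)])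
      (use assms(1,3) in \<open>auto elim!: eventually_mono\<close>)
  then show ?thesis using assms(1) by (simp add: L2_def)
qed

lemma L2_bounded:
  assumes "u \<in> borel_measurable (timeM T)" "AE t in timeM T. norm (u t) \<le> C"
  shows "u \<in> L2 T"
proof (rule L2_I[OF assms(1), of "\<lambda>_. C\<^sup>2"])
  interpret finite_measure "timeM T" by (rule finite_measure_timeM)
  show "integrable (timeM T) (\<lambda>_. C\<^sup>2)" by simp
  show "AE t in timeM T. (norm (u t))\<^sup>2 \<le> C\<^sup>2"
    using assms(2) by eventually_elim (simp add: power_mono)
qed

lemma L2_const: "(\<lambda>_. x) \<in> L2 T"
  by (rule L2_bounded[of _ _ "norm x"]) auto

lemma L2_linear:
  assumes "bounded_linear g" "u \<in> L2 T"
  shows "(\<lambda>t. g (u t)) \<in> L2 T"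
proof -
  obtain k where k: "k \<ge> 0" "\<And>x. norm (g x) \<le> norm x * k"
    using bounded_linear.nonneg_bounded[OF assms(1)] by auto
  show ?thesis
  proof (rule L2_I[where g="\<lambda>t. k\<^sup>2 * (norm (u t))\<^sup>2"])
    show "(\<lambda>t. g (u t)) \<in> borel_measurable (timeM T)"
      using measurable_compose[OF L2_measurable[OF assms(2)]
          borel_measurable_continuous_onI[OF linear_continuous_on[OF assms(1)]]] by simp
    show "integrable (timeM T) (\<lambda>t. k\<^sup>2 * (norm (u t))\<^sup>2)" using L2_integrable_sq[OF assms(2)] by auto
    show "AE t in timeM T. (norm (g (u t)))\<^sup>2 \<le> k\<^sup>2 * (norm (u t))\<^sup>2"
      using power_mono[OF k(2) norm_ge_zero, of _ 2] by (intro AE_I2) (simp add: power_mult_distrib mult.commute)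
  qed
qed

lemma L2_scaleR: "u \<in> L2 T \<Longrightarrow> (\<lambda>t. c *\<^sub>R u t) \<in> L2 T"
  by (rule L2_linear[OF bounded_linear_scaleR_right])

lemma norm_add_sq_le: "(norm (x + y :: 'a::real_normed_vector))\<^sup>2 \<le> 2 * (norm x)\<^sup>2 + 2 * (norm y)\<^sup>2"
proof -
  have "(norm (x + y))\<^sup>2 \<le> (norm x + norm y)\<^sup>2" by (intro power_mono norm_triangle_ineq) auto
  then show ?thesis using sum_squares_bound[of "norm x" "norm y"]
    by (simp add: power2_sum)
qed

lemma L2_add:
  assumes "u \<in> L2 T" "w \<in> L2 T" shows "(\<lambda>t. u t + w t) \<in> L2 T"
proof (rule L2_I[where g="\<lambda>t. 2 * (norm (u t))\<^sup>2 + 2 * (norm (w t))\<^sup>2"])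
  show "(\<lambda>t. u t + w t) \<in> borel_measurable (timeM T)"
    using assms[THEN L2_measurable] by measurable
  show "integrable (timeM T) (\<lambda>t. 2 * (norm (u t))\<^sup>2 + 2 * (norm (w t))\<^sup>2)"
    using assms[THEN L2_integrable_sq] by simp
qed (simp add: norm_add_sq_le)

lemma L2_diff:
  assumes "u \<in> L2 T" "w \<in> L2 T" shows "(\<lambda>t. u t - w t) \<in> L2 T"
  using L2_add[OF assms(1) L2_scaleR[OF assms(2), of "-1"]] by simp

lemma L2_bilinear_integrable:
  fixes u :: "real \<Rightarrow> 'a::{banach,second_countable_topology}"
    and w :: "real \<Rightarrow> 'b::{banach,second_countable_topology}"
    and \<beta> :: "'a \<Rightarrow> 'b \<Rightarrow> 'c::{banach,second_countable_topology}"
  assumes \<beta>: "bounded_bilinear \<beta>" and u: "u \<in> L2 T" and w: "w \<in> L2 T"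
  shows "integrable (timeM T) (\<lambda>t. \<beta> (u t) (w t))"
proof -
  obtain k where k: "k \<ge> 0" "\<And>x y. norm (\<beta> x y) \<le> norm x * norm y * k"
    using bounded_bilinear.nonneg_bounded[OF \<beta>] by auto
  show ?thesis
  proof (rule Bochner_Integration.integrable_bound)
    show "integrable (timeM T) (\<lambda>t. k * ((norm (u t))\<^sup>2 + (norm (w t))\<^sup>2))"
      using u w by (auto intro: L2_integrable_sq)
    show "(\<lambda>t. \<beta> (u t) (w t)) \<in> borel_measurable (timeM T)"
      using L2_measurable[OF u] L2_measurable[OF w]
      by (rule borel_measurable_continuous_Pair)
        (intro bounded_bilinear.continuous_on[OF \<beta>] continuous_intros)
    show "AE t in timeM T. norm (\<beta> (u t) (w t)) \<le> norm (k * ((norm (u t))\<^sup>2 + (norm (w t))\<^sup>2))"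
    proof (rule AE_I2)
      fix t
      have "norm (u t) * norm (w t) \<le> (norm (u t))\<^sup>2 + (norm (w t))\<^sup>2"
        using sum_squares_bound[of "norm (u t)" "norm (w t)"]
          mult_nonneg_nonneg[OF norm_ge_zero norm_ge_zero, of "u t" "w t"] by linarith
      from mult_left_mono[OF this k(1)]
      show "norm (\<beta> (u t) (w t)) \<le> norm (k * ((norm (u t))\<^sup>2 + (norm (w t))\<^sup>2))"
        using k(1) k(2)[of "u t" "w t"] by (simp add: mult.commute)
    qed
  qed
qed

lemma L2_norm_sq: "(L2_norm T u)\<^sup>2 = (\<integral>t. (norm (u t))\<^sup>2 \<partial>timeM T)"
  unfolding L2_norm_def by (rule real_sqrt_pow2) (auto intro: integral_nonneg_AE)

lemma L2_norm_nonneg: "0 \<le> L2_norm T u"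
  unfolding L2_norm_def by (auto intro: integral_nonneg_AE)

lemma L2_norm_cong_AE:
  assumes "u \<in> borel_measurable (timeM T)" "w \<in> borel_measurable (timeM T)" "AE t in timeM T. u t = w t"
  shows "L2_norm T u = L2_norm T w"
  unfolding L2_norm_def
  by (intro arg_cong[of _ _ sqrt] integral_cong_AE) (use assms in \<open>auto elim: eventually_mono\<close>)

lemma L2_norm_scaleR: "L2_norm T (\<lambda>t. c *\<^sub>R u t) = \<bar>c\<bar> * L2_norm T u"
  by (simp add: L2_norm_def power_mult_distrib real_sqrt_mult)

lemma L2_norm_le:
  assumes "u \<in> L2 T" "AE t in timeM T. norm (u t) \<le> C" "T > 0" "C \<ge> 0"
  shows "L2_norm T u \<le> C * sqrt T"
proof -
  interpret finite_measure "timeM T" by (rule finite_measure_timeM)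
  have "(\<integral>t. (norm (u t))\<^sup>2 \<partial>timeM T) \<le> (\<integral>t. C\<^sup>2 \<partial>timeM T)"
    using assms by (intro integral_mono_AE) (auto intro: L2_integrable_sq power_mono elim: eventually_mono)
  also have "\<dots> = C\<^sup>2 * T" using measure_timeM[OF \<open>T > 0\<close>] by simp
  finally have "(L2_norm T u)\<^sup>2 \<le> (C * sqrt T)\<^sup>2"
    using assms(3) by (simp add: L2_norm_sq power_mult_distrib)
  then show ?thesis by (rule power2_le_imp_le) (use assms in auto)
qed

lemma quadratic_nonneg_discriminant:
  fixes a b c :: real
  assumes "\<And>s. 0 \<le> a * s\<^sup>2 - 2 * c * s + b" "a \<ge> 0"
  shows "c\<^sup>2 \<le> a * b"
proof (cases "a = 0")
  case True
  have "c = 0"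
  proof (rule ccontr)
    assume "c \<noteq> 0"
    \<comment> \<open>At this point the affine function takes the value -1.\<close>
    then show False using assms(1)[of "(b + 1) / (2 * c)"] True by simp
  qed
  then show ?thesis using True by simp
next
  case False
  have "0 \<le> a * (a * (c / a)\<^sup>2 - 2 * c * (c / a) + b)"
    by (rule mult_nonneg_nonneg[OF assms(2) assms(1)])
  also have "\<dots> = a * b - c\<^sup>2" using False by (simp add: field_simps power2_eq_square)
  finally show ?thesis by simp
qed

lemma L2_Cauchy_Schwarz:
  assumes u: "u \<in> L2 T" and w: "w \<in> L2 T"
  shows "(\<integral>t. norm (u t) * norm (w t) \<partial>timeM T) \<le> L2_norm T u * L2_norm T w"
proof -
  define c where "c = (\<integral>t. norm (u t) * norm (w t) \<partial>timeM T)"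
  have nu: "(\<lambda>t. norm (u t)) \<in> L2 T" "(\<lambda>t. norm (w t)) \<in> L2 T"
    using u w by (auto simp: L2_def)
  have int: "integrable (timeM T) (\<lambda>t. norm (u t) * norm (w t))"
    using L2_bilinear_integrable[OF bounded_bilinear_mult nu] .
  have "c\<^sup>2 \<le> (L2_norm T u)\<^sup>2 * (L2_norm T w)\<^sup>2"
  proof (rule quadratic_nonneg_discriminant)
    fix s
    have "0 \<le> (\<integral>t. (s * norm (u t) - norm (w t))\<^sup>2 \<partial>timeM T)"
      by (intro integral_nonneg_AE) auto
    also have "\<dots> = (\<integral>t. s\<^sup>2 * (norm (u t))\<^sup>2 - (2 * s) * (norm (u t) * norm (w t)) + (norm (w t))\<^sup>2 \<partial>timeM T)"
      by (intro Bochner_Integration.integral_cong) (auto simp: power2_eq_square algebra_simps)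
    also have "\<dots> = s\<^sup>2 * (L2_norm T u)\<^sup>2 - (2 * s) * c + (L2_norm T w)\<^sup>2"
      unfolding L2_norm_sq c_def
      using int L2_integrable_sq[OF u] L2_integrable_sq[OF w] by simp
    finally show "0 \<le> (L2_norm T u)\<^sup>2 * s\<^sup>2 - 2 * c * s + (L2_norm T w)\<^sup>2"
      by (simp add: mult_ac)
  qed simp
  then have "c\<^sup>2 \<le> (L2_norm T u * L2_norm T w)\<^sup>2" by (simp add: power_mult_distrib)
  then show ?thesis unfolding c_def by (rule power2_le_imp_le) (simp add: L2_norm_nonneg)
qed

lemma L2_bilinear_bound:
  fixes \<beta> :: "'a::{banach,second_countable_topology} \<Rightarrow> 'b::{banach,second_countable_topology} \<Rightarrow> real"
  assumes \<beta>: "bounded_bilinear \<beta>"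
  shows "\<exists>k\<ge>0. \<forall>T. \<forall>u\<in>L2 T. \<forall>w\<in>L2 T. \<bar>\<integral>t. \<beta> (u t) (w t) \<partial>timeM T\<bar> \<le> k * L2_norm T u * L2_norm T w"
proof -
  obtain k where k: "k \<ge> 0" "\<And>x y. norm (\<beta> x y) \<le> norm x * norm y * k"
    using bounded_bilinear.nonneg_bounded[OF \<beta>] by auto
  have "\<bar>\<integral>t. \<beta> (u t) (w t) \<partial>timeM T\<bar> \<le> k * L2_norm T u * L2_norm T w"
    if u: "u \<in> L2 T" and w: "w \<in> L2 T" for u w T
  proof -
    have nu: "(\<lambda>t. norm (u t)) \<in> L2 T" "(\<lambda>t. norm (w t)) \<in> L2 T"
      using u w by (auto simp: L2_def)
    have int: "integrable (timeM T) (\<lambda>t. norm (u t) * norm (w t))"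
      using L2_bilinear_integrable[OF bounded_bilinear_mult nu] .
    have "\<bar>\<integral>t. \<beta> (u t) (w t) \<partial>timeM T\<bar> \<le> (\<integral>t. \<bar>\<beta> (u t) (w t)\<bar> \<partial>timeM T)"
      by (rule integral_abs_bound)
    also have "\<dots> \<le> (\<integral>t. k * (norm (u t) * norm (w t)) \<partial>timeM T)"
      using L2_bilinear_integrable[OF \<beta> u w] int k(2)
      by (intro integral_mono) (auto simp: mult_ac)
    also have "\<dots> \<le> k * (L2_norm T u * L2_norm T w)"
      using mult_left_mono[OF L2_Cauchy_Schwarz[OF u w] k(1)] by simp
    finally show ?thesis by (simp add: mult_ac)
  qed
  then show ?thesis using k(1) by blast
qed

lemma L2_integrable: "u \<in> L2 T \<Longrightarrow> integrable (timeM T) u"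
  using L2_bilinear_integrable[OF bounded_bilinear_scaleR L2_const[of "1::real" T], of u] by simp

lemma L2_norm_one: "T > 0 \<Longrightarrow> L2_norm T (\<lambda>_. 1::real) = sqrt T"
  using measure_timeM[of T] by (simp add: L2_norm_def)

lemma L1_norm_le_L2_norm:
  assumes "u \<in> L2 T" "T > 0"
  shows "(\<integral>t. norm (u t) \<partial>timeM T) \<le> sqrt T * L2_norm T u"
  using L2_Cauchy_Schwarz[OF assms(1) L2_const[of "1::real" T]] L2_norm_one[OF assms(2)]
  by (simp add: mult.commute)

lemma L2_norm_triangle:
  assumes u: "u \<in> L2 T" and w: "w \<in> L2 T"
  shows "L2_norm T (\<lambda>t. u t + w t) \<le> L2_norm T u + L2_norm T w"
proof (rule power2_le_imp_le)
  have nu: "(\<lambda>t. norm (u t)) \<in> L2 T" "(\<lambda>t. norm (w t)) \<in> L2 T"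
    using u w by (auto simp: L2_def)
  have int: "integrable (timeM T) (\<lambda>t. norm (u t) * norm (w t))"
    using L2_bilinear_integrable[OF bounded_bilinear_mult nu] .
  have "(L2_norm T (\<lambda>t. u t + w t))\<^sup>2 \<le>
      (\<integral>t. (norm (u t))\<^sup>2 + 2 * (norm (u t) * norm (w t)) + (norm (w t))\<^sup>2 \<partial>timeM T)"
    unfolding L2_norm_sq
  proof (intro integral_mono)
    fix t
    have "(norm (u t + w t))\<^sup>2 \<le> (norm (u t) + norm (w t))\<^sup>2"
      by (intro power_mono norm_triangle_ineq) auto
    then show "(norm (u t + w t))\<^sup>2 \<le> (norm (u t))\<^sup>2 + 2 * (norm (u t) * norm (w t)) + (norm (w t))\<^sup>2"
      by (simp add: power2_sum)
  qed (use int L2_integrable_sq[OF u] L2_integrable_sq[OF w] L2_integrable_sq[OF L2_add[OF u w]] in simp_all)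
  also have "\<dots> = (L2_norm T u)\<^sup>2 + 2 * (\<integral>t. norm (u t) * norm (w t) \<partial>timeM T) + (L2_norm T w)\<^sup>2"
    unfolding L2_norm_sq using int L2_integrable_sq[OF u] L2_integrable_sq[OF w] by simp
  also have "\<dots> \<le> (L2_norm T u + L2_norm T w)\<^sup>2"
    using L2_Cauchy_Schwarz[OF u w] by (simp add: power2_sum)
  finally show "(L2_norm T (\<lambda>t. u t + w t))\<^sup>2 \<le> (L2_norm T u + L2_norm T w)\<^sup>2" .
qed (simp add: L2_norm_nonneg)

lemma L2_parallelogram:
  fixes u w :: "real \<Rightarrow> 'a::{real_inner,banach,second_countable_topology}"
  assumes u: "u \<in> L2 T" and w: "w \<in> L2 T"
  shows "2 * (L2_norm T u)\<^sup>2 + 2 * (L2_norm T w)\<^sup>2 - 4 * (L2_norm T (\<lambda>t. (1/2) *\<^sub>R (u t + w t)))\<^sup>2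
    = (L2_norm T (\<lambda>t. u t - w t))\<^sup>2"
proof -
  have "4 * (norm ((1/2) *\<^sub>R (x + y)))\<^sup>2 + (norm (x - y))\<^sup>2 = 2 * (norm x)\<^sup>2 + 2 * (norm y)\<^sup>2" for x y :: 'a
    by (simp add: power2_norm_eq_inner inner_diff_left inner_diff_right inner_add_left inner_add_right
        inner_commute algebra_simps)
  then have "(\<integral>t. 4 * (norm ((1/2) *\<^sub>R (u t + w t)))\<^sup>2 + (norm (u t - w t))\<^sup>2 \<partial>timeM T)
      = (\<integral>t. 2 * (norm (u t))\<^sup>2 + 2 * (norm (w t))\<^sup>2 \<partial>timeM T)" by simp
  moreover note L2_integrable_sq[OF u] L2_integrable_sq[OF w] L2_integrable_sq[OF L2_diff[OF u w]]
    L2_integrable_sq[OF L2_scaleR[OF L2_add[OF u w], of "1/2"]]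
  ultimately show ?thesis unfolding L2_norm_sq by (simp del: norm_scaleR)
qed

lemma strict_mono_choice:
  assumes "\<And>n. \<exists>m0. \<forall>m\<ge>m0. P n m"
  shows "\<exists>s :: nat \<Rightarrow> nat. strict_mono s \<and> (\<forall>n. P n (s n))"
proof -
  have "\<exists>s. \<forall>n. P n (s n) \<and> s n < s (Suc n)"
  proof (rule dependent_nat_choice)
    show "\<exists>x. P 0 x" using assms[of 0] by auto
    fix x n assume "P n x"
    obtain m0 where "\<forall>m\<ge>m0. P (Suc n) m" using assms by blast
    then show "\<exists>y. P (Suc n) y \<and> x < y" by (intro exI[of _ "max m0 (Suc x)"]) auto
  qed
  then show ?thesis by (auto simp: strict_mono_Suc_iff)
qed

text \<open>Riesz-Fischer. The almost everywhere convergent subsequence belongs to the conclusion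
  because it later identifies the limit through pointwise limits in H.\<close>

lemma L2_complete:
  fixes w :: "nat \<Rightarrow> real \<Rightarrow> 'a::{banach,second_countable_topology}"
  assumes T: "T > 0" and w: "\<And>n. w n \<in> L2 T"
    and Cauchy: "\<And>e. e > 0 \<Longrightarrow> \<exists>n0. \<forall>j\<ge>n0. \<forall>k\<ge>n0. L2_norm T (\<lambda>t. w j t - w k t) < e"
  obtains u s where "u \<in> L2 T" "(\<lambda>k. L2_norm T (\<lambda>t. w k t - u t)) \<longlonglongrightarrow> 0"
    "strict_mono s" "AE t in timeM T. (\<lambda>k. w (s k) t) \<longlonglongrightarrow> u t"
proof -
  have [measurable]: "w n \<in> borel_measurable (timeM T)" for n using w by (rule L2_measurable)
  \<comment> \<open>Along a subsequence with geometrically small tails the L1 norms of the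
    increments are summable, so the telescoping series converges absolutely almost
    everywhere.\<close>
  have small: "\<exists>m0. \<forall>m\<ge>m0. \<forall>j\<ge>m. \<forall>k\<ge>m. L2_norm T (\<lambda>t. w j t - w k t) < (1/2) ^ n" for n
  proof -
    obtain n0 where "\<forall>j\<ge>n0. \<forall>k\<ge>n0. L2_norm T (\<lambda>t. w j t - w k t) < (1/2) ^ n"
      using Cauchy[of "(1/2) ^ n"] by auto
    then show ?thesis by (intro exI[of _ n0]) auto
  qed
  obtain s where s: "strict_mono s"
    "\<And>n. \<forall>j\<ge>s n. \<forall>k\<ge>s n. L2_norm T (\<lambda>t. w j t - w k t) < (1/2) ^ n"
    using strict_mono_choice[of "\<lambda>n m. \<forall>j\<ge>m. \<forall>k\<ge>m. L2_norm T (\<lambda>t. w j t - w k t) < (1/2) ^ n", OF small]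
    by blast
  define v where "v k t = w (s (Suc k)) t - w (s k) t" for k t
  have v: "v k \<in> L2 T" for k unfolding v_def by (intro L2_diff w)
  have [measurable]: "v k \<in> borel_measurable (timeM T)" for k using v by (rule L2_measurable)
  have sS: "s n \<le> s (Suc n)" for n using s(1) by (simp add: strict_mono_less_eq)
  have "(\<integral>\<^sup>+t. ennreal (norm (v k t)) \<partial>timeM T) \<le> ennreal (sqrt T * (1/2) ^ k)" for k
  proof -
    have "(\<integral>\<^sup>+t. ennreal (norm (v k t)) \<partial>timeM T) = ennreal (\<integral>t. norm (v k t) \<partial>timeM T)"
      using L2_integrable[OF v] by (intro nn_integral_eq_integral) auto
    also have "(\<integral>t. norm (v k t) \<partial>timeM T) \<le> sqrt T * L2_norm T (v k)"
      by (rule L1_norm_le_L2_norm[OF v T])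
    also have "\<dots> \<le> sqrt T * (1/2) ^ k"
      using s(2)[rule_format, of k "s (Suc k)" "s k"] sS[of k] T by (intro mult_left_mono) (auto simp: v_def[abs_def])
    finally show ?thesis by (simp add: ennreal_leI)
  qed
  then have "(\<Sum>k. \<integral>\<^sup>+t. ennreal (norm (v k t)) \<partial>timeM T) \<le> (\<Sum>k. ennreal (sqrt T * (1/2) ^ k))"
    by (intro suminf_le) auto
  also have "\<dots> = ennreal (\<Sum>k. sqrt T * (1/2) ^ k)"
    using T by (intro suminf_ennreal2 summable_mult summable_geometric) auto
  finally have "(\<integral>\<^sup>+t. (\<Sum>k. ennreal (norm (v k t))) \<partial>timeM T) \<noteq> \<infinity>"
    by (subst nn_integral_suminf) (auto simp: top_unique)
  then have "AE t in timeM T. (\<Sum>k. ennreal (norm (v k t))) \<noteq> \<infinity>"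
    by (intro nn_integral_PInf_AE) auto
  then have conv: "AE t in timeM T. convergent (\<lambda>k. w (s k) t)"
  proof eventually_elim
    case (elim t)
    have "summable (\<lambda>k. norm (v k t))"
      by (rule summable_suminf_not_top) (use elim in \<open>auto simp: top_unique infinity_ennreal_def\<close>)
    then have "summable (\<lambda>k. v k t)" by (rule summable_norm_cancel)
    then have "convergent (\<lambda>n. \<Sum>k<n. v k t)" by (simp add: summable_iff_convergent)
    moreover have "(\<Sum>k<n. v k t) = w (s n) t - w (s 0) t" for n
      unfolding v_def by (rule sum_lessThan_telescope)
    ultimately have "convergent (\<lambda>n. (w (s n) t - w (s 0) t) + w (s 0) t)"
      by (intro convergent_add) (auto simp: convergent_const)
    then show ?case by simp
  qed
  define u where "u t = lim (\<lambda>k. w (s k) t)" for t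
  have u_meas[measurable]: "u \<in> borel_measurable (timeM T)"
    unfolding u_def by (intro borel_measurable_lim_metric) auto
  have lim: "AE t in timeM T. (\<lambda>k. w (s k) t) \<longlonglongrightarrow> u t"
    using conv by eventually_elim (simp add: u_def convergent_LIMSEQ_iff)
  \<comment> \<open>Fatou's lemma carries the Cauchy estimate over to the limit. It is stated for
    the nonnegative integral because square integrability of \<open>w k - u\<close> is not known
    yet.\<close>
  have bound: "(\<integral>\<^sup>+t. ennreal ((norm (w k t - u t))\<^sup>2) \<partial>timeM T) \<le> ennreal (e\<^sup>2)"
    if e: "e > 0" and k: "\<forall>j\<ge>n0. L2_norm T (\<lambda>t. w k t - w j t) < e" for e k n0
  proof -
    have "(\<integral>\<^sup>+t. ennreal ((norm (w k t - u t))\<^sup>2) \<partial>timeM T)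
        = (\<integral>\<^sup>+t. liminf (\<lambda>j. ennreal ((norm (w k t - w (s j) t))\<^sup>2)) \<partial>timeM T)"
    proof (rule nn_integral_cong_AE)
      show "AE t in timeM T. ennreal ((norm (w k t - u t))\<^sup>2) = liminf (\<lambda>j. ennreal ((norm (w k t - w (s j) t))\<^sup>2))"
        using lim
      proof eventually_elim
        case (elim t)
        have "(\<lambda>j. ennreal ((norm (w k t - w (s j) t))\<^sup>2)) \<longlonglongrightarrow> ennreal ((norm (w k t - u t))\<^sup>2)"
          by (intro tendsto_intros elim)
        then show ?case by (rule lim_imp_Liminf[OF sequentially_bot, symmetric])
      qed
    qed
    also have "\<dots> \<le> liminf (\<lambda>j. \<integral>\<^sup>+t. ennreal ((norm (w k t - w (s j) t))\<^sup>2) \<partial>timeM T)"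
      by (rule nn_integral_liminf) auto
    also have "\<dots> \<le> liminf (\<lambda>j. ennreal (e\<^sup>2))"
    proof (rule Liminf_mono)
      show "\<forall>\<^sub>F j in sequentially. (\<integral>\<^sup>+t. ennreal ((norm (w k t - w (s j) t))\<^sup>2) \<partial>timeM T) \<le> ennreal (e\<^sup>2)"
      proof (rule eventually_sequentiallyI[of n0])
        fix j assume "n0 \<le> j"
        then have "s j \<ge> n0" using seq_suble[OF s(1), of j] by simp
        then have "L2_norm T (\<lambda>t. w k t - w (s j) t) < e" using k by blast
        then have "(L2_norm T (\<lambda>t. w k t - w (s j) t))\<^sup>2 \<le> e\<^sup>2"
          using L2_norm_nonneg by (intro power_mono) auto
        then show "(\<integral>\<^sup>+t. ennreal ((norm (w k t - w (s j) t))\<^sup>2) \<partial>timeM T) \<le> ennreal (e\<^sup>2)"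
          unfolding L2_norm_sq
          by (subst nn_integral_eq_integral) (auto intro!: L2_integrable_sq L2_diff w ennreal_leI)
      qed
    qed
    finally show ?thesis by (simp add: Liminf_const)
  qed
  have diff: "(\<lambda>t. w k t - u t) \<in> L2 T \<and> L2_norm T (\<lambda>t. w k t - u t) \<le> e"
    if "e > 0" "\<forall>j\<ge>n0. L2_norm T (\<lambda>t. w k t - w j t) < e" for e k n0
  proof -
    note b = bound[OF that]
    have int: "integrable (timeM T) (\<lambda>t. (norm (w k t - u t))\<^sup>2)"
      by (rule integrableI_bounded) (use b in \<open>auto simp: less_top[symmetric] top_unique\<close>)
    then have "ennreal (\<integral>t. (norm (w k t - u t))\<^sup>2 \<partial>timeM T) \<le> ennreal (e\<^sup>2)"
      using b by (subst (asm) nn_integral_eq_integral) auto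
    then have "(L2_norm T (\<lambda>t. w k t - u t))\<^sup>2 \<le> e\<^sup>2"
      unfolding L2_norm_sq by (simp add: ennreal_le_iff)
    then have "L2_norm T (\<lambda>t. w k t - u t) \<le> e" by (rule power2_le_imp_le) (use \<open>e > 0\<close> in auto)
    then show ?thesis using int by (simp add: L2_def)
  qed
  obtain n1 where "\<forall>j\<ge>n1. \<forall>k\<ge>n1. L2_norm T (\<lambda>t. w j t - w k t) < 1" using Cauchy[of 1] by auto
  then have "(\<lambda>t. w n1 t - u t) \<in> L2 T" using diff[of 1 n1 n1] by auto
  from L2_diff[OF w[of n1] this] have uL2: "u \<in> L2 T" by simp
  have "(\<lambda>k. L2_norm T (\<lambda>t. w k t - u t)) \<longlonglongrightarrow> 0"
  proof (rule LIMSEQ_I)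
    fix e :: real assume e: "e > 0"
    obtain n0 where n0: "\<forall>j\<ge>n0. \<forall>k\<ge>n0. L2_norm T (\<lambda>t. w j t - w k t) < e / 2" using Cauchy[of "e/2"] e by auto
    have "norm (L2_norm T (\<lambda>t. w k t - u t) - 0) < e" if "k \<ge> n0" for k
      using diff[of "e/2" n0 k] n0 that e L2_norm_nonneg[of T "\<lambda>t. w k t - u t"] by auto
    then show "\<exists>no. \<forall>n\<ge>no. norm (L2_norm T (\<lambda>t. w n t - u t) - 0) < e" by blast
  qed
  then show ?thesis using that uL2 s(1) lim by blast
qed

text \<open>Closure of a set under midpoints: a cheap substitute for the convex hull, which suffices
  for Mazur's lemma because the parallelogram identity only involves midpoints.\<close>

inductive_set midpoint_hull :: "('x \<Rightarrow> 'x \<Rightarrow> 'x) \<Rightarrow> 'x set \<Rightarrow> 'x set" for mid U where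
  base: "x \<in> U \<Longrightarrow> x \<in> midpoint_hull mid U"
| mid: "x \<in> midpoint_hull mid U \<Longrightarrow> y \<in> midpoint_hull mid U \<Longrightarrow> mid x y \<in> midpoint_hull mid U"

lemma midpoint_hull_mono:
  assumes "x \<in> midpoint_hull mid U" "U \<subseteq> W"
  shows "x \<in> midpoint_hull mid W"
  using assms by (induction rule: midpoint_hull.induct) (auto intro: midpoint_hull.intros)

text \<open>The infimum \<open>d k\<close> of \<open>Q\<close> over the midpoint hull of the tail
  from \<open>k\<close> on increases with \<open>k\<close> and is bounded by \<open>B\<close>, so it
  converges. Midpoints of near-minimisers lie in a common tail hull and cannot have a much smaller
  \<open>Q\<close>; hence the defect in the parallelogram identity tends to 0. \<open>Q\<close>
  becomes a squared Hilbert norm only in the applications.\<close>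

lemma Mazur_midpoints:
  fixes Q :: "'x \<Rightarrow> real" and u :: "nat \<Rightarrow> 'x"
  assumes Q: "\<And>x. 0 \<le> Q x" and bounded: "\<And>n. Q (u n) \<le> B"
  obtains w where "\<And>k. w k \<in> midpoint_hull mid (u ` {k..})"
    "\<And>e. e > 0 \<Longrightarrow> \<exists>k0. \<forall>j\<ge>k0. \<forall>k\<ge>k0. 2 * Q (w j) + 2 * Q (w k) - 4 * Q (mid (w j) (w k)) < e"
proof -
  define H where "H k = midpoint_hull mid (u ` {k..})" for k
  define d where "d k = Inf (Q ` H k)" for k
  have uH: "u k \<in> H k" for k unfolding H_def by (intro midpoint_hull.base) auto
  have bdd: "bdd_below (Q ` H k)" for k using Q by (intro bdd_belowI[of _ 0]) auto
  have d_le: "d k \<le> Q x" if "x \<in> H k" for k x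
    unfolding d_def using bdd that by (intro cInf_lower) auto
  have H_mono: "H j \<subseteq> H k" if "k \<le> j" for j k
  proof -
    have "u ` {j..} \<subseteq> u ` {k..}" using that by auto
    then show ?thesis unfolding H_def by (intro subsetI) (rule midpoint_hull_mono)
  qed
  have "incseq d"
  proof (rule incseq_SucI)
    fix n show "d n \<le> d (Suc n)"
      unfolding d_def
    proof (rule cInf_superset_mono)
      show "Q ` H (Suc n) \<noteq> {}" using uH[of "Suc n"] by blast
      show "Q ` H (Suc n) \<subseteq> Q ` H n" by (rule image_mono[OF H_mono]) simp
    qed (rule bdd)
  qed
  moreover have "d n \<le> B" for n using d_le[OF uH] bounded[of n] by (meson order_trans)
  ultimately obtain l where l: "d \<longlonglongrightarrow> l" and d_l: "\<And>n. d n \<le> l" using incseq_convergent[of d B] by blast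
  have "\<exists>x\<in>H k. Q x < d k + 1 / Suc k" for k
  proof -
    have "\<exists>y\<in>Q ` H k. y < d k + 1 / Suc k"
      using uH bdd by (subst cInf_less_iff[symmetric]) (auto simp: d_def)
    then show ?thesis by auto
  qed
  then obtain w where w: "\<And>k. w k \<in> H k" "\<And>k. Q (w k) < d k + 1 / Suc k" by metis
  \<comment> \<open>Once \<open>d\<close> is within \<open>e / 8\<close> of its limit
    \<open>l\<close> and \<open>1 / Suc n\<close> is below \<open>e / 8\<close>, both
    \<open>2 * Q (w j)\<close> and \<open>2 * Q (w k)\<close> are less than
    \<open>2 * l + e / 4\<close>, while four times \<open>Q\<close> of the midpoint exceeds
    \<open>4 * l - e / 2\<close>.\<close>
  have "\<exists>k0. \<forall>j\<ge>k0. \<forall>k\<ge>k0. 2 * Q (w j) + 2 * Q (w k) - 4 * Q (mid (w j) (w k)) < e" if e: "e > 0" for e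
  proof -
    have "\<forall>\<^sub>F n in sequentially. l - e / 8 < d n" using l e by (intro order_tendstoD) auto
    moreover have "\<forall>\<^sub>F n in sequentially. 1 / real (Suc n) < e / 8"
      using LIMSEQ_Suc[OF lim_1_over_n] e by (intro order_tendstoD) auto
    ultimately have "\<forall>\<^sub>F n in sequentially. l - e / 8 < d n \<and> 1 / real (Suc n) < e / 8"
      by eventually_elim auto
    then obtain k0 where k0: "\<And>n. n \<ge> k0 \<Longrightarrow> l - e / 8 < d n \<and> 1 / real (Suc n) < e / 8"
      by (auto simp: eventually_sequentially)
    show ?thesis
    proof (intro exI[of _ k0] allI impI)
      fix j k assume jk: "k0 \<le> j" "k0 \<le> k"
      have "w j \<in> H k0" "w k \<in> H k0" using w(1)[of j] w(1)[of k] H_mono jk by blast+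
      then have "mid (w j) (w k) \<in> H k0"
        unfolding H_def by (rule midpoint_hull.mid)
      then have "d k0 \<le> Q (mid (w j) (w k))" by (rule d_le)
      then show "2 * Q (w j) + 2 * Q (w k) - 4 * Q (mid (w j) (w k)) < e"
        using k0[OF order_refl] k0[OF jk(1)] k0[OF jk(2)] w(2)[of j] w(2)[of k] d_l[of j] d_l[of k] by linarith
    qed
  qed
  then show ?thesis using that w(1) unfolding H_def by blast
qed

section \<open>Test functions, weak derivatives, and weak convergence\<close>

definition smooth :: "(real \<Rightarrow> real) \<Rightarrow> bool" where
  "smooth f \<longleftrightarrow> (\<forall>k x. ((deriv ^^ k) f) differentiable (at x))"

text \<open>A coinduction principle that replaces formulas for higher derivatives: each use exhibits
  a family of differentiable functions that \<open>deriv\<close> does not leave.\<close>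

lemma smoothI:
  assumes "f \<in> S" "\<And>g. g \<in> S \<Longrightarrow> deriv g \<in> S" "\<And>g x. g \<in> S \<Longrightarrow> g differentiable (at x)"
  shows "smooth f"
proof -
  have "(deriv ^^ k) f \<in> S" for k by (induction k) (use assms(1,2) in auto)
  then show ?thesis using assms(3) by (auto simp: smooth_def)
qed

lemma smooth_differentiable: "smooth f \<Longrightarrow> f differentiable (at x)"
  unfolding smooth_def by (metis funpow_0)

lemma smooth_deriv: "smooth f \<Longrightarrow> smooth (deriv f)"
  unfolding smooth_def
proof (intro allI)
  fix k x assume "\<forall>k x. ((deriv ^^ k) f) differentiable (at x)"
  then have "((deriv ^^ Suc k) f) differentiable (at x)" by blast
  then show "((deriv ^^ k) (deriv f)) differentiable (at x)" by (simp only: funpow_Suc_right o_apply)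
qed

lemma smooth_DERIV: "smooth f \<Longrightarrow> (f has_real_derivative deriv f x) (at x)"
  using smooth_differentiable DERIV_deriv_iff_real_differentiable by blast

text \<open>By the Leibniz rule, \<open>deriv\<close> leads from single products to sums of
  products; the span is closed under it.\<close>

inductive_set product_span :: "(real \<Rightarrow> real) set" where
  mult: "smooth f \<Longrightarrow> smooth g \<Longrightarrow> (\<lambda>x. f x * g x) \<in> product_span"
| add: "f \<in> product_span \<Longrightarrow> g \<in> product_span \<Longrightarrow> (\<lambda>x. f x + g x) \<in> product_span"

lemma product_span_differentiable:
  assumes "f \<in> product_span"
  shows "f differentiable (at x)"
  using assms by induction (simp_all add: differentiable_mult differentiable_add smooth_differentiable)

lemma product_span_deriv:
  assumes "f \<in> product_span"
  shows "deriv f \<in> product_span"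
  using assms
proof induction
  case (mult f g)
  have "deriv (\<lambda>x. f x * g x) = (\<lambda>x. deriv f x * g x + f x * deriv g x)"
    by (intro ext DERIV_imp_deriv) (auto intro!: derivative_eq_intros smooth_DERIV mult)
  then show ?case using mult by (auto intro!: product_span.intros smooth_deriv)
next
  case (add f g)
  have "deriv (\<lambda>x. f x + g x) = (\<lambda>x. deriv f x + deriv g x)"
    by (intro ext DERIV_imp_deriv DERIV_add)
      (use add product_span_differentiable DERIV_deriv_iff_real_differentiable in blast)+
  then show ?case using add by (auto intro: product_span.add)
qed

lemma smooth_mult: "smooth f \<Longrightarrow> smooth g \<Longrightarrow> smooth (\<lambda>x. f x * g x)"
  by (rule smoothI[of _ product_span])
    (auto intro: product_span.mult product_span_deriv product_span_differentiable)

lemma smooth_affine: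
  assumes "smooth f"
  shows "smooth (\<lambda>x. f (c * x + d))"
\<comment> \<open>The multiplier \<open>m\<close> absorbs the factor \<open>c\<close> that the chain
  rule produces at each differentiation.\<close>
proof (rule smoothI[of _ "{h. \<exists>g m. smooth g \<and> h = (\<lambda>x. m * g (c * x + d))}"])
  show "(\<lambda>x. f (c * x + d)) \<in> {h. \<exists>g m. smooth g \<and> h = (\<lambda>x. m * g (c * x + d))}"
    using assms by (auto intro!: exI[of _ f] exI[of _ 1])
next
  have D: "((\<lambda>x. m * g (c * x + d)) has_real_derivative (m * c) * deriv g (c * x + d)) (at x)"
    if "smooth g" for m g x
  proof -
    have "((\<lambda>x. g (c * x + d)) has_real_derivative deriv g (c * x + d) * c) (at x)"
      by (rule DERIV_chain2[OF smooth_DERIV[OF that]]) (auto intro!: derivative_eq_intros)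
    from DERIV_cmult[OF this, of m] show ?thesis by (simp add: mult_ac)
  qed
  fix h assume "h \<in> {h. \<exists>g m. smooth g \<and> h = (\<lambda>x. m * g (c * x + d))}"
  then obtain g m where g: "smooth g" "h = (\<lambda>x. m * g (c * x + d))" by auto
  have "deriv h = (\<lambda>x. (m * c) * deriv g (c * x + d))"
    unfolding g(2) using D[OF g(1)] by (intro ext DERIV_imp_deriv)
  then show "deriv h \<in> {h. \<exists>g m. smooth g \<and> h = (\<lambda>x. m * g (c * x + d))}"
    using smooth_deriv[OF g(1)] by blast
  show "h differentiable (at x)" for x
    unfolding g(2) using D[OF g(1)] real_differentiable_def by blast
qed

lemma poly_div_exp_tendsto_0: "((\<lambda>y. poly q y / exp y) \<longlongrightarrow> (0::real)) at_top"
proof -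
  have "((\<lambda>y. \<Sum>i\<le>degree q. coeff q i * (y ^ i / exp y)) \<longlongrightarrow> (\<Sum>i\<le>degree q. coeff q i * 0)) at_top"
    by (intro tendsto_intros tendsto_power_div_exp_0)
  then show ?thesis by (simp add: poly_altdef sum_divide_distrib)
qed

text \<open>The polynomial factor makes the family closed under differentiation.\<close>

definition flat_exp :: "real poly \<Rightarrow> real \<Rightarrow> real" where
  "flat_exp p x = (if x > 0 then poly p (1 / x) * exp (- (1 / x)) else 0)"

text \<open>With \<open>y = 1 / x\<close> the derivative in \<open>x\<close> of
  \<open>p y * exp (- y)\<close> is \<open>y^2 * (p y - p' y) * exp (- y)\<close>;
  \<open>[:0, 0, 1:]\<close> is the polynomial \<open>y^2\<close>. At 0 the exponential beats every
  polynomial.\<close>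

lemma flat_exp_DERIV:
  "(flat_exp p has_real_derivative flat_exp ([:0, 0, 1:] * (p - pderiv p)) x) (at x)"
proof -
  consider "x > 0" | "x < 0" | "x = 0" by linarith
  then show ?thesis
  proof cases
    case 1
    have "((\<lambda>x. poly p (1 / x) * exp (- (1 / x))) has_real_derivative
        flat_exp ([:0, 0, 1:] * (p - pderiv p)) x) (at x)"
      using 1 by (auto intro!: derivative_eq_intros DERIV_chain2[OF poly_DERIV]
          simp: flat_exp_def field_simps power2_eq_square)
    then show ?thesis
      by (rule has_field_derivative_transform_within_open[of _ _ _ "{0<..}"])
        (use 1 in \<open>auto simp: flat_exp_def\<close>)
  next
    case 2
    have "((\<lambda>x. 0) has_real_derivative 0) (at x)" by simp
    then have "(flat_exp p has_real_derivative 0) (at x)"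
      by (rule has_field_derivative_transform_within_open[of _ _ _ "{..<0}"])
        (use 2 in \<open>auto simp: flat_exp_def\<close>)
    then show ?thesis using 2 by (simp add: flat_exp_def)
  next
    case 3
    have "((\<lambda>h. (flat_exp p (0 + h) - flat_exp p 0) / h) \<longlongrightarrow> 0) (at 0)"
    proof (rule filterlim_split_at)
      show "((\<lambda>h. (flat_exp p (0 + h) - flat_exp p 0) / h) \<longlongrightarrow> 0) (at_left 0)"
        by (rule tendsto_eventually) (auto simp: eventually_at_left_field flat_exp_def intro: exI[of _ "-1"])
      \<comment> \<open>With \<open>y = 1 / h\<close> the difference quotient at 0 from the right is
        \<open>y * p y / exp y\<close>, and \<open>pCons 0 p\<close> is the polynomial
        \<open>y * p y\<close>.\<close>
      have "((\<lambda>h. poly (pCons 0 p) (inverse h) / exp (inverse h)) \<longlongrightarrow> 0) (at_right 0)"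
        by (rule filterlim_compose[OF poly_div_exp_tendsto_0 filterlim_inverse_at_top_right])
      then show "((\<lambda>h. (flat_exp p (0 + h) - flat_exp p 0) / h) \<longlongrightarrow> 0) (at_right 0)"
        by (rule Lim_transform_eventually)
          (auto simp: eventually_at_right_field flat_exp_def exp_minus field_simps intro!: exI[of _ 1])
    qed
    then show ?thesis unfolding DERIV_def using 3 by (simp add: flat_exp_def)
  qed
qed

lemma smooth_flat_exp: "smooth (flat_exp p)"
proof (rule smoothI[of _ "range flat_exp"])
  have "deriv (flat_exp q) = flat_exp ([:0, 0, 1:] * (q - pderiv q))" for q
    by (intro ext DERIV_imp_deriv flat_exp_DERIV)
  then show "\<And>g. g \<in> range flat_exp \<Longrightarrow> deriv g \<in> range flat_exp" by auto
  show "\<And>g x. g \<in> range flat_exp \<Longrightarrow> g differentiable (at x)"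
    using flat_exp_DERIV real_differentiable_def by blast
qed auto

text \<open>To be read as
  \<open>flat_exp 1 (n * (x - a) - 1) * flat_exp 1 (n * (b - x) - 1)\<close>. The shift by 1 leaves
  a gap of width \<open>1 / n\<close> at either end of the interval, so the support is compact in
  it; the slope \<open>n\<close> drives the values inside to 1. The arguments are expanded to the
  form that \<open>smooth_affine\<close> expects.\<close>

definition bump :: "real \<Rightarrow> real \<Rightarrow> nat \<Rightarrow> real \<Rightarrow> real" where
  "bump a b n x = flat_exp 1 (real n * x + (- real n * a - 1)) * flat_exp 1 (- real n * x + (real n * b - 1))"

lemma flat_exp_one_bounds: "0 \<le> flat_exp 1 x" "flat_exp 1 x \<le> 1"
  by (auto simp: flat_exp_def)

lemma bump_bounds: "0 \<le> bump a b n x" "bump a b n x \<le> 1"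
  unfolding bump_def using flat_exp_one_bounds by (auto intro!: mult_nonneg_nonneg mult_le_one)

lemma bump_test_function:
  assumes "0 \<le> a" "b \<le> T" "n \<ge> 1"
  shows "test_function T (bump a b n)"
proof -
  have "smooth (bump a b n)"
    unfolding bump_def by (intro smooth_mult smooth_affine smooth_flat_exp)
  moreover have "bump a b n t = 0" if "t \<notin> {a + 1 / n .. b - 1 / n}" for t
  proof -
    have "real n * t + (- real n * a - 1) \<le> 0 \<or> - real n * t + (real n * b - 1) \<le> 0"
      using that assms(3) by (auto simp: field_simps not_le)
    then show ?thesis by (auto simp: bump_def flat_exp_def)
  qed
  moreover have "0 < a + 1 / n" "b - 1 / n < T"
  proof -
    have "0 < 1 / real n" using assms(3) by simp
    then show "0 < a + 1 / n" "b - 1 / n < T" using assms(1,2) by linarith+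
  qed
  ultimately show ?thesis unfolding test_function_def smooth_def by blast
qed

lemma flat_exp_one_tendsto:
  assumes "y > 0" shows "(\<lambda>n. flat_exp 1 (real n * y - 1)) \<longlonglongrightarrow> 1"
proof -
  have lim: "filterlim (\<lambda>n. real n * y - 1) at_top sequentially"
    using filterlim_tendsto_add_at_top[OF tendsto_const[of "-1"]
        filterlim_at_top_mult_tendsto_pos[OF tendsto_const assms filterlim_real_sequentially]]
    by (simp add: mult.commute)
  have "(\<lambda>n. exp (- (1 / (real n * y - 1)))) \<longlonglongrightarrow> exp (- 0)"
    by (intro tendsto_intros tendsto_divide_0[OF tendsto_const] filterlim_at_top_imp_at_infinity lim)
  moreover have "\<forall>\<^sub>F n in sequentially. exp (- (1 / (real n * y - 1))) = flat_exp 1 (real n * y - 1)"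
    using filterlim_at_top_dense[THEN iffD1, OF lim, rule_format, of 0]
    by eventually_elim (auto simp: flat_exp_def)
  ultimately show ?thesis by (simp add: Lim_transform_eventually)
qed

lemma bump_tendsto: "(\<lambda>n. bump a b n x) \<longlonglongrightarrow> indicat_real {a<..<b} x"
proof (cases "a < x \<and> x < b")
  case True
  have "(\<lambda>n. flat_exp 1 (real n * (x - a) - 1) * flat_exp 1 (real n * (b - x) - 1)) \<longlonglongrightarrow> 1 * 1"
    by (intro tendsto_mult flat_exp_one_tendsto) (use True in auto)
  then show ?thesis using True by (simp add: bump_def algebra_simps)
next
  case False
  have "bump a b n x = 0" for n
  proof -
    have "real n * (x - a) \<le> 0 \<or> real n * (b - x) \<le> 0" using False by (auto simp: mult_le_0_iff)
    then show ?thesis by (auto simp: bump_def flat_exp_def algebra_simps)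
  qed
  then show ?thesis using False by auto
qed

lemma continuous_measurable_timeM:
  fixes \<phi> :: "real \<Rightarrow> 'a::{real_normed_vector,second_countable_topology}"
  assumes "continuous_on UNIV \<phi>" shows "\<phi> \<in> borel_measurable (timeM T)"
  using borel_measurable_continuous_onI[OF assms]
  by (intro measurable_restrict_space1 measurable_completion) simp

lemma test_function_smooth: "test_function T \<phi> \<Longrightarrow> smooth \<phi>"
  by (simp add: test_function_def smooth_def)

lemma test_function_continuous: "test_function T \<phi> \<Longrightarrow> continuous_on UNIV \<phi>"
  using test_function_smooth smooth_differentiable
  by (metis continuous_at_imp_continuous_on differentiable_imp_continuous_within)

lemma test_function_bounded:
  assumes "test_function T \<phi>" shows "\<exists>B. \<forall>t. \<bar>\<phi> t\<bar> \<le> B"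
proof -
  obtain a b where ab: "\<And>t. t \<notin> {a..b} \<Longrightarrow> \<phi> t = 0" using assms by (auto simp: test_function_def)
  have "compact (\<phi> ` {a..b})"
    using test_function_continuous[OF assms] by (intro compact_continuous_image) (auto intro: continuous_on_subset)
  then have "\<exists>B. \<forall>x\<in>\<phi> ` {a..b}. norm x \<le> B"
    using compact_imp_bounded bounded_iff by blast
  then obtain B where B: "\<And>t. t \<in> {a..b} \<Longrightarrow> \<bar>\<phi> t\<bar> \<le> B" by fastforce
  have "\<bar>\<phi> t\<bar> \<le> max B 0" for t using B[of t] ab[of t] by (cases "t \<in> {a..b}") auto
  then show ?thesis by blast
qed

lemma test_function_deriv:
  assumes "test_function T \<phi>" shows "test_function T (deriv \<phi>)"
proof -
  obtain a b where ab: "0 < a" "b < T" "\<And>t. t \<notin> {a..b} \<Longrightarrow> \<phi> t = 0" using assms by (auto simp: test_function_def)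
  have "deriv \<phi> t = 0" if "t \<notin> {a..b}" for t
  proof (rule DERIV_imp_deriv)
    have "((\<lambda>t. 0) has_real_derivative 0) (at t)" by simp
    then show "(\<phi> has_real_derivative 0) (at t)"
      by (rule has_field_derivative_transform_within_open[of _ _ _ "- {a..b}"]) (use that ab(3) in auto)
  qed
  then show ?thesis using ab(1,2) smooth_deriv[OF test_function_smooth[OF assms]]
    unfolding test_function_def smooth_def by blast
qed

lemma bounded_scaleR_integrable:
  fixes g :: "real \<Rightarrow> 'a::{banach,second_countable_topology}"
  assumes "integrable (timeM T) g" "\<phi> \<in> borel_measurable (timeM T)" "\<And>t. \<bar>\<phi> t\<bar> \<le> (B::real)"
  shows "integrable (timeM T) (\<lambda>t. \<phi> t *\<^sub>R g t)"
proof (rule Bochner_Integration.integrable_bound)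
  show "integrable (timeM T) (\<lambda>t. B *\<^sub>R g t)" using assms(1) by simp
  show "(\<lambda>t. \<phi> t *\<^sub>R g t) \<in> borel_measurable (timeM T)" using assms(1,2) by measurable
  show "AE t in timeM T. norm (\<phi> t *\<^sub>R g t) \<le> norm (B *\<^sub>R g t)"
    using order_trans[OF assms(3) abs_ge_self] by (intro AE_I2) (auto intro!: mult_right_mono)
qed

lemma test_function_integrable:
  fixes g :: "real \<Rightarrow> 'a::{banach,second_countable_topology}"
  assumes "test_function T \<phi>" "integrable (timeM T) g"
  shows "integrable (timeM T) (\<lambda>t. \<phi> t *\<^sub>R g t)"
  using test_function_bounded[OF assms(1)] bounded_scaleR_integrable[OF assms(2)
      continuous_measurable_timeM[OF test_function_continuous[OF assms(1)]]] by blast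

text \<open>Bumps approximate indicators of open intervals boundedly, so \<open>g\<close> integrates
  to 0 over intervals. These generate the Borel sets and are stable under intersection, so the
  property spreads to Borel and then to Lebesgue sets; a function all of whose set integrals vanish
  is 0 almost everywhere.\<close>

lemma fundamental_lemma_calculus_of_variations:
  fixes g :: "real \<Rightarrow> 'a::{banach,second_countable_topology}"
  assumes g: "integrable (timeM T) g"
    and zero: "\<And>\<phi>. test_function T \<phi> \<Longrightarrow> (\<integral>t. \<phi> t *\<^sub>R g t \<partial>timeM T) = 0"
  shows "AE t in timeM T. g t = 0"
proof -
  let ?M = "timeM T"
  interpret finite_measure ?M by (rule finite_measure_timeM)
  have borel_sets: "B \<inter> {0<..<T} \<in> sets ?M" if "B \<in> sets borel" for B
    using that by (auto simp: sets_restrict_space intro: sets_completionI_sets)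
  have [measurable]: "g \<in> borel_measurable ?M" using g by auto
  have interval: "(\<integral>t. indicator {a<..<b} t *\<^sub>R g t \<partial>?M) = 0" if ab: "0 \<le> a" "b \<le> T" for a b
  proof (rule LIMSEQ_unique)
    show "(\<lambda>n. \<integral>t. bump a b (Suc n) t *\<^sub>R g t \<partial>?M) \<longlonglongrightarrow> 0"
      using zero[OF bump_test_function[OF ab]] by simp
    show "(\<lambda>n. \<integral>t. bump a b (Suc n) t *\<^sub>R g t \<partial>?M) \<longlonglongrightarrow> (\<integral>t. indicator {a<..<b} t *\<^sub>R g t \<partial>?M)"
    proof (rule integral_dominated_convergence[where w="\<lambda>t. norm (g t)"])
      show "(\<lambda>t. bump a b (Suc n) t *\<^sub>R g t) \<in> borel_measurable ?M" for n
        using test_function_integrable[OF bump_test_function[OF ab] g, of "Suc n"] by auto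
      show "(\<lambda>t. indicat_real {a<..<b} t *\<^sub>R g t) \<in> borel_measurable ?M"
      proof (rule borel_measurable_scaleR)
        show "indicat_real {a<..<b} \<in> borel_measurable ?M"
          by (intro measurable_restrict_space1 measurable_completion) auto
      qed measurable
      show "AE t in ?M. (\<lambda>n. bump a b (Suc n) t *\<^sub>R g t) \<longlonglongrightarrow> indicat_real {a<..<b} t *\<^sub>R g t"
        by (intro AE_I2 tendsto_intros LIMSEQ_Suc[OF bump_tendsto])
      show "AE t in ?M. norm (bump a b (Suc n) t *\<^sub>R g t) \<le> norm (g t)" for n
        using bump_bounds[of a b "Suc n"] by (intro AE_I2) (auto intro: mult_left_le_one_le)
    qed (use g in auto)
  qed
  define P where "P B \<longleftrightarrow> (LINT t:(B \<inter> {0<..<T})|?M. g t) = 0" for B :: "real set"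
  have int: "set_integrable ?M A g" if "A \<in> sets ?M" for A
    unfolding set_integrable_def using g that by (rule integrable_mult_indicator[rotated])
  have borel: "P B" if "B \<in> sets borel" for B
  proof -
    let ?G = "range (\<lambda>(a, b). {a<..<b::real})"
    have sig: "sets borel = sigma_sets UNIV ?G"
      unfolding borel_eq_box box_real by (simp add: sets_measure_of)
    have "Int_stable ?G"
    proof (rule Int_stableI_image)
      show "\<exists>k\<in>UNIV. (case i of (a, b) \<Rightarrow> {a<..<b}) \<inter> (case j of (a, b) \<Rightarrow> {a<..<b}) = (case k of (a, b) \<Rightarrow> {a<..<b})"
        for i j :: "real \<times> real"
        by (intro bexI[of _ "(max (fst i) (fst j), min (snd i) (snd j))"]) (auto split: prod.splits)
    qed
    moreover have "?G \<subseteq> Pow UNIV" by auto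
    moreover have "B \<in> sigma_sets UNIV ?G" using that sig by simp
    ultimately show ?thesis
    proof (induction rule: sigma_sets_induct_disjoint)
      case (basic A)
      then obtain a b where A: "A = {a<..<b}" by auto
      have "A \<inter> {0<..<T} = {max a 0<..<min b T}" unfolding A by auto
      then show ?case using interval[of "max a 0" "min b T"] by (simp add: P_def set_lebesgue_integral_def)
    next
      case empty then show ?case by (simp add: P_def set_lebesgue_integral_def)
    next
      case (compl A)
      then have A: "A \<inter> {0<..<T} \<in> sets ?M" "(UNIV - A) \<inter> {0<..<T} \<in> sets ?M"
        by (auto intro!: borel_sets simp: sig[symmetric])
      have "(LINT t:(A \<inter> {0<..<T}) \<union> ((UNIV - A) \<inter> {0<..<T})|?M. g t)
          = (LINT t:(A \<inter> {0<..<T})|?M. g t) + (LINT t:((UNIV - A) \<inter> {0<..<T})|?M. g t)"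
        by (rule set_integral_Un) (use A int in auto)
      moreover have "(A \<inter> {0<..<T}) \<union> ((UNIV - A) \<inter> {0<..<T}) = {0<..<T}" by auto
      moreover have "(LINT t:{0<..<T}|?M. g t) = 0" using interval[of 0 T] by (simp add: set_lebesgue_integral_def)
      ultimately show ?case using compl by (simp add: P_def)
    next
      case (union A)
      have A: "A i \<inter> {0<..<T} \<in> sets ?M" for i
        using union by (auto intro!: borel_sets simp: sig[symmetric])
      have "(LINT t:(\<Union>i. A i \<inter> {0<..<T})|?M. g t) = (\<Sum>i. (LINT t:(A i \<inter> {0<..<T})|?M. g t))"
      proof (rule lebesgue_integral_countable_add)
        show "A i \<inter> {0<..<T} \<inter> (A j \<inter> {0<..<T}) = {}" if "i \<noteq> j" for i j
          using union(1) that by (auto simp: disjoint_family_on_def)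
        show "set_integrable ?M (\<Union>i. A i \<inter> {0<..<T}) g" by (intro int sets.countable_UN) (use A in auto)
      qed (use A in auto)
      then show ?case using union by (simp add: P_def)
    qed
  qed
  \<comment> \<open>A Lebesgue set is a Borel set up to part of a Borel null set, which the integral
    does not see.\<close>
  have "(LINT t:A|?M. g t) = 0" if "A \<in> sets ?M" for A
  proof -
    have "A \<in> (\<inter>) {0<..<T} ` sets lebesgue" using that by (simp only: sets_restrict_space)
    then obtain A' where A': "A = A' \<inter> {0<..<T}" "A' \<in> sets lebesgue" by blast
    obtain S N N' where SN: "A' = S \<union> N" "N \<subseteq> N'" "N' \<in> null_sets lborel" "S \<in> sets lborel"
      using sets_completionE[OF A'(2)] by blast
    have null: "AE t in lebesgue. t \<notin> N'" using SN(3) AE_not_in AE_completion by blast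
    have "AE t in ?M. t \<notin> N'"
      by (subst AE_restrict_space_iff) (use null in auto)
    then have "AE t in ?M. indicator A t *\<^sub>R g t = indicator (S \<inter> {0<..<T}) t *\<^sub>R g t"
    proof eventually_elim
      case (elim t)
      then have "t \<in> A \<longleftrightarrow> t \<in> S \<inter> {0<..<T}" using SN(1,2) A'(1) by auto
      then show ?case by (simp add: indicator_def)
    qed
    then have "(LINT t:A|?M. g t) = (LINT t:(S \<inter> {0<..<T})|?M. g t)"
      unfolding set_lebesgue_integral_def
      by (intro integral_cong_AE) (use \<open>A \<in> sets ?M\<close> borel_sets[of S] SN(4) in auto)
    then show ?thesis using borel[of S] SN(4) by (simp add: P_def)
  qed
  then show ?thesis by (rule density_zero[OF g])
qed

section \<open>Weak derivatives\<close>

lemma weak_derivative: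
  assumes "u \<in> H1 T"
  shows "weak_derivative T u \<in> L2 T" "has_weak_derivative T u (weak_derivative T u)"
proof -
  have "\<exists>u'. u' \<in> L2 T \<and> has_weak_derivative T u u'" using assms by (auto simp: H1_def)
  from someI_ex[OF this]
  show "weak_derivative T u \<in> L2 T" "has_weak_derivative T u (weak_derivative T u)"
    by (auto simp: weak_derivative_def)
qed

lemma has_weak_derivative_unique:
  assumes "u' \<in> L2 T" "u'' \<in> L2 T" "has_weak_derivative T u u'" "has_weak_derivative T u u''"
  shows "AE t in timeM T. u' t = u'' t"
proof -
  have "AE t in timeM T. u' t - u'' t = 0"
  proof (rule fundamental_lemma_calculus_of_variations)
    show "integrable (timeM T) (\<lambda>t. u' t - u'' t)" using assms by (auto intro: L2_integrable)
    fix \<phi> assume \<phi>: "test_function T \<phi>"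
    have "(\<integral>t. \<phi> t *\<^sub>R u' t \<partial>timeM T) = (\<integral>t. \<phi> t *\<^sub>R u'' t \<partial>timeM T)"
      using assms(3,4)[unfolded has_weak_derivative_def, rule_format, OF \<phi>] by simp
    then show "(\<integral>t. \<phi> t *\<^sub>R (u' t - u'' t) \<partial>timeM T) = 0"
      using assms(1,2) by (simp add: scaleR_diff_right test_function_integrable[OF \<phi>] L2_integrable)
  qed
  then show ?thesis by simp
qed

text \<open>Pins down the choice made in \<open>weak_derivative\<close>: a concrete square
  integrable weak derivative may replace it under integrals.\<close>

lemma weak_derivative_AE:
  assumes "u \<in> L2 T" "u' \<in> L2 T" "has_weak_derivative T u u'"
  shows "AE t in timeM T. weak_derivative T u t = u' t"
proof -
  have "u \<in> H1 T" using assms by (auto simp: H1_def)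
  then show ?thesis using has_weak_derivative_unique[OF weak_derivative(1) assms(2) weak_derivative(2) assms(3)] by simp
qed

lemma has_weak_derivative_lincomb:
  assumes "u \<in> L2 T" "u' \<in> L2 T" "w \<in> L2 T" "w' \<in> L2 T"
    and "has_weak_derivative T u u'" "has_weak_derivative T w w'"
  shows "has_weak_derivative T (\<lambda>t. a *\<^sub>R u t + b *\<^sub>R w t) (\<lambda>t. a *\<^sub>R u' t + b *\<^sub>R w' t)"
  unfolding has_weak_derivative_def
proof (intro allI impI)
  fix \<phi> assume \<phi>: "test_function T \<phi>"
  note i = test_function_integrable[OF \<phi>] test_function_integrable[OF test_function_deriv[OF \<phi>]]
  have "(\<integral>t. deriv \<phi> t *\<^sub>R (a *\<^sub>R u t + b *\<^sub>R w t) \<partial>timeM T)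
      = a *\<^sub>R (\<integral>t. deriv \<phi> t *\<^sub>R u t \<partial>timeM T) + b *\<^sub>R (\<integral>t. deriv \<phi> t *\<^sub>R w t \<partial>timeM T)"
  proof -
    have "(\<lambda>t. deriv \<phi> t *\<^sub>R (a *\<^sub>R u t + b *\<^sub>R w t)) = (\<lambda>t. a *\<^sub>R (deriv \<phi> t *\<^sub>R u t) + b *\<^sub>R (deriv \<phi> t *\<^sub>R w t))"
      by (simp add: scaleR_add_right mult.commute)
    then show ?thesis using assms(1-4) by (simp del: scaleR_scaleR add: i L2_integrable)
  qed
  moreover have "(\<integral>t. \<phi> t *\<^sub>R (a *\<^sub>R u' t + b *\<^sub>R w' t) \<partial>timeM T)
      = a *\<^sub>R (\<integral>t. \<phi> t *\<^sub>R u' t \<partial>timeM T) + b *\<^sub>R (\<integral>t. \<phi> t *\<^sub>R w' t \<partial>timeM T)"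
  proof -
    have "(\<lambda>t. \<phi> t *\<^sub>R (a *\<^sub>R u' t + b *\<^sub>R w' t)) = (\<lambda>t. a *\<^sub>R (\<phi> t *\<^sub>R u' t) + b *\<^sub>R (\<phi> t *\<^sub>R w' t))"
      by (simp add: scaleR_add_right mult.commute)
    then show ?thesis using assms(1-4) by (simp del: scaleR_scaleR add: i L2_integrable)
  qed
  ultimately show "(\<integral>t. deriv \<phi> t *\<^sub>R (a *\<^sub>R u t + b *\<^sub>R w t) \<partial>timeM T)
      = - (\<integral>t. \<phi> t *\<^sub>R (a *\<^sub>R u' t + b *\<^sub>R w' t) \<partial>timeM T)"
    using assms(5,6) \<phi> by (simp add: has_weak_derivative_def)
qed

lemma L2_limit_integral:
  fixes w :: "nat \<Rightarrow> real \<Rightarrow> 'a::{banach,second_countable_topology}"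
  assumes T: "T > 0" and w: "\<And>k. w k \<in> L2 T" and u: "u \<in> L2 T"
    and lim: "(\<lambda>k. L2_norm T (\<lambda>t. w k t - u t)) \<longlonglongrightarrow> 0"
    and \<phi>: "test_function T \<phi>"
  shows "(\<lambda>k. \<integral>t. \<phi> t *\<^sub>R w k t \<partial>timeM T) \<longlonglongrightarrow> (\<integral>t. \<phi> t *\<^sub>R u t \<partial>timeM T)"
proof -
  obtain B where B: "\<And>t. \<bar>\<phi> t\<bar> \<le> B" using test_function_bounded[OF \<phi>] by auto
  have B0: "0 \<le> B" using B[of 0] by auto
  have i: "integrable (timeM T) (\<lambda>t. \<phi> t *\<^sub>R w k t)" "integrable (timeM T) (\<lambda>t. \<phi> t *\<^sub>R u t)" for k
    using test_function_integrable[OF \<phi>] w u L2_integrable by blast+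
  have d: "(\<lambda>t. w k t - u t) \<in> L2 T" for k by (intro L2_diff w u)
  have "norm ((\<integral>t. \<phi> t *\<^sub>R w k t \<partial>timeM T) - (\<integral>t. \<phi> t *\<^sub>R u t \<partial>timeM T))
      \<le> B * (sqrt T * L2_norm T (\<lambda>t. w k t - u t))" for k
  proof -
    have "(\<integral>t. \<phi> t *\<^sub>R w k t \<partial>timeM T) - (\<integral>t. \<phi> t *\<^sub>R u t \<partial>timeM T) = (\<integral>t. \<phi> t *\<^sub>R (w k t - u t) \<partial>timeM T)"
      using i by (simp add: scaleR_diff_right)
    also have "norm \<dots> \<le> (\<integral>t. norm (\<phi> t *\<^sub>R (w k t - u t)) \<partial>timeM T)"
      by (rule integral_norm_bound)
    also have "\<dots> \<le> (\<integral>t. B * norm (w k t - u t) \<partial>timeM T)"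
    proof (rule integral_mono)
      show "integrable (timeM T) (\<lambda>t. norm (\<phi> t *\<^sub>R (w k t - u t)))"
        using test_function_integrable[OF \<phi> L2_integrable[OF d]] by (rule integrable_norm)
      show "integrable (timeM T) (\<lambda>t. B * norm (w k t - u t))"
        using integrable_norm[OF L2_integrable[OF d]] by simp
    qed (use B in \<open>auto intro: mult_right_mono\<close>)
    also have "\<dots> \<le> B * (sqrt T * L2_norm T (\<lambda>t. w k t - u t))"
      using mult_left_mono[OF L1_norm_le_L2_norm[OF d T] B0] by simp
    finally show ?thesis .
  qed
  moreover have "(\<lambda>k. B * (sqrt T * L2_norm T (\<lambda>t. w k t - u t))) \<longlonglongrightarrow> B * (sqrt T * 0)"
    by (intro tendsto_intros lim)
  ultimately have "(\<lambda>k. (\<integral>t. \<phi> t *\<^sub>R w k t \<partial>timeM T) - (\<integral>t. \<phi> t *\<^sub>R u t \<partial>timeM T)) \<longlonglongrightarrow> 0"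
    by (auto intro: Lim_null_comparison[of _ "\<lambda>k. B * (sqrt T * L2_norm T (\<lambda>t. w k t - u t))"])
  then show ?thesis by (simp add: LIM_zero_iff)
qed

text \<open>The weak derivative is a closed operator: for a fixed test function both sides of the
  defining identity are continuous in L2.\<close>

lemma has_weak_derivative_limit:
  assumes T: "T > 0" and L2: "\<And>k. w k \<in> L2 T" "\<And>k. w' k \<in> L2 T" "u \<in> L2 T" "u' \<in> L2 T"
    and wd: "\<And>k. has_weak_derivative T (w k) (w' k)"
    and lim: "(\<lambda>k. L2_norm T (\<lambda>t. w k t - u t)) \<longlonglongrightarrow> 0" "(\<lambda>k. L2_norm T (\<lambda>t. w' k t - u' t)) \<longlonglongrightarrow> 0"
  shows "has_weak_derivative T u u'"
  unfolding has_weak_derivative_def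
proof (intro allI impI)
  fix \<phi> assume \<phi>: "test_function T \<phi>"
  have "(\<lambda>k. \<integral>t. deriv \<phi> t *\<^sub>R w k t \<partial>timeM T) \<longlonglongrightarrow> (\<integral>t. deriv \<phi> t *\<^sub>R u t \<partial>timeM T)"
    by (rule L2_limit_integral[OF T L2(1,3) lim(1) test_function_deriv[OF \<phi>]])
  moreover have "(\<lambda>k. - (\<integral>t. \<phi> t *\<^sub>R w' k t \<partial>timeM T)) \<longlonglongrightarrow> - (\<integral>t. \<phi> t *\<^sub>R u' t \<partial>timeM T)"
    by (intro tendsto_minus L2_limit_integral[OF T L2(2,4) lim(2) \<phi>])
  moreover have "(\<integral>t. deriv \<phi> t *\<^sub>R w k t \<partial>timeM T) = - (\<integral>t. \<phi> t *\<^sub>R w' k t \<partial>timeM T)" for k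
    using wd \<phi> by (simp add: has_weak_derivative_def)
  ultimately show "(\<integral>t. deriv \<phi> t *\<^sub>R u t \<partial>timeM T) = - (\<integral>t. \<phi> t *\<^sub>R u' t \<partial>timeM T)"
    using LIMSEQ_unique by simp
qed

section \<open>Weak convergence by midpoints\<close>

definition pointwise_mid :: "(real \<Rightarrow> 'a::real_vector) \<Rightarrow> (real \<Rightarrow> 'a) \<Rightarrow> real \<Rightarrow> 'a" where
  "pointwise_mid u w t = (1/2) *\<^sub>R (u t + w t)"

lemma bounded_functional_uminus:
  "bounded_functional S nrm F \<Longrightarrow> bounded_functional S nrm (\<lambda>u. - F u)"
  unfolding bounded_functional_def by auto

text \<open>Suppose the bound fails along a subsequence. The functions on which \<open>F\<close> is
  at least \<open>F x + e\<close> are closed under midpoints, so a Mazur sequence of that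
  subsequence stays among them; yet \<open>key\<close> makes it converge to \<open>x\<close> in
  \<open>nrm\<close>, against boundedness of \<open>F\<close>. Tails of the subsequence lie in tails
  of \<open>u\<close>, so \<open>key\<close> for \<open>u\<close> applies.\<close>

lemma weak_limit_upper:
  fixes u :: "nat \<Rightarrow> real \<Rightarrow> 'a::real_vector" and Q :: "(real \<Rightarrow> 'a) \<Rightarrow> real"
  assumes S: "\<And>u w. u \<in> S \<Longrightarrow> w \<in> S \<Longrightarrow> (\<lambda>t. u t + w t) \<in> S" "\<And>u c. u \<in> S \<Longrightarrow> (\<lambda>t. c *\<^sub>R u t) \<in> S"
    and Q: "\<And>x. 0 \<le> Q x" "\<And>n. Q (u n) \<le> B"
    and u: "\<And>n. u n \<in> S" and x: "x \<in> S"
    and key: "\<And>w. (\<And>k. w k \<in> midpoint_hull pointwise_mid (u ` {k..})) \<Longrightarrow>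
       (\<And>e. e > 0 \<Longrightarrow> \<exists>k0. \<forall>j\<ge>k0. \<forall>k\<ge>k0. 2 * Q (w j) + 2 * Q (w k) - 4 * Q (pointwise_mid (w j) (w k)) < e) \<Longrightarrow>
       (\<lambda>k. nrm (\<lambda>t. w k t - x t)) \<longlonglongrightarrow> 0"
    and F: "bounded_functional S nrm F" and e: "e > 0"
  shows "\<forall>\<^sub>F n in sequentially. F (u n) < F x + e"
proof (rule ccontr)
  assume "\<not> ?thesis"
  then have "\<exists>\<^sub>F n in sequentially. F x + e \<le> F (u n)" by (simp add: not_eventually not_less)
  then obtain r :: "nat \<Rightarrow> nat" where r: "strict_mono r" "\<And>n. F x + e \<le> F (u (r n))"
    using frequently_subseq by blast
  obtain w where w: "\<And>k. w k \<in> midpoint_hull pointwise_mid ((\<lambda>n. u (r n)) ` {k..})"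
    "\<And>e. e > 0 \<Longrightarrow> \<exists>k0. \<forall>j\<ge>k0. \<forall>k\<ge>k0. 2 * Q (w j) + 2 * Q (w k) - 4 * Q (pointwise_mid (w j) (w k)) < e"
    using Mazur_midpoints[where u="\<lambda>n. u (r n)" and Q=Q and B=B and mid=pointwise_mid] Q by blast
  have sub: "(\<lambda>n. u (r n)) ` {k..} \<subseteq> u ` {k..}" for k
    using seq_suble[OF r(1)] by (auto intro!: imageI elim: order_trans)
  have lim: "(\<lambda>k. nrm (\<lambda>t. w k t - x t)) \<longlonglongrightarrow> 0"
    by (rule key) (use w midpoint_hull_mono[OF w(1) sub] in auto)
  obtain C where C: "\<And>u. u \<in> S \<Longrightarrow> \<bar>F u\<bar> \<le> C * nrm u"
    and add: "\<And>u w. u \<in> S \<Longrightarrow> w \<in> S \<Longrightarrow> F (\<lambda>t. u t + w t) = F u + F w"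
    and scale: "\<And>u c. u \<in> S \<Longrightarrow> F (\<lambda>t. c *\<^sub>R u t) = c * F u"
    using F unfolding bounded_functional_def by blast
  have hull: "v \<in> S \<and> F x + e \<le> F v" if "v \<in> midpoint_hull pointwise_mid ((\<lambda>n. u (r n)) ` {k..})" for v k
    using that
  proof induction
    case (base v) then show ?case using u r(2) by auto
  next
    case (mid v v')
    have "F (pointwise_mid v v') = (1/2) * (F v + F v')"
      unfolding pointwise_mid_def using mid S add scale by simp
    moreover have "pointwise_mid v v' \<in> S" unfolding pointwise_mid_def using mid S by simp
    ultimately show ?case using mid by (simp add: field_simps)
  qed
  have "e \<le> C * nrm (\<lambda>t. w k t - x t)" for k
  proof -
    have wS: "w k \<in> S" "F x + e \<le> F (w k)" using hull[OF w(1)] by auto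
    have "F (\<lambda>t. w k t + (-1) *\<^sub>R x t) = F (w k) - F x"
      using add[OF wS(1) S(2)[OF x, of "-1"]] scale[OF x, of "-1"] by simp
    moreover have "(\<lambda>t. w k t + (-1) *\<^sub>R x t) \<in> S" using S wS(1) x by blast
    ultimately show ?thesis using C[of "\<lambda>t. w k t + (-1) *\<^sub>R x t"] wS(2) by simp
  qed
  moreover have "(\<lambda>k. C * nrm (\<lambda>t. w k t - x t)) \<longlonglongrightarrow> C * 0" by (intro tendsto_intros lim)
  ultimately have "e \<le> C * 0" using LIMSEQ_le_const by blast
  then show False using e by simp
qed

lemma converges_weaklyI_Mazur:
  fixes u :: "nat \<Rightarrow> real \<Rightarrow> 'a::real_vector" and Q :: "(real \<Rightarrow> 'a) \<Rightarrow> real"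
  assumes S: "\<And>u w. u \<in> S \<Longrightarrow> w \<in> S \<Longrightarrow> (\<lambda>t. u t + w t) \<in> S" "\<And>u c. u \<in> S \<Longrightarrow> (\<lambda>t. c *\<^sub>R u t) \<in> S"
    and Q: "\<And>x. 0 \<le> Q x" "\<And>n. Q (u n) \<le> B"
    and u: "\<And>n. u n \<in> S" and x: "x \<in> S"
    and key: "\<And>w. (\<And>k. w k \<in> midpoint_hull pointwise_mid (u ` {k..})) \<Longrightarrow>
       (\<And>e. e > 0 \<Longrightarrow> \<exists>k0. \<forall>j\<ge>k0. \<forall>k\<ge>k0. 2 * Q (w j) + 2 * Q (w k) - 4 * Q (pointwise_mid (w j) (w k)) < e) \<Longrightarrow>
       (\<lambda>k. nrm (\<lambda>t. w k t - x t)) \<longlonglongrightarrow> 0"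
  shows "converges_weakly S nrm u x"
  unfolding converges_weakly_def
proof (intro conjI allI impI)
  fix F assume F: "bounded_functional S nrm F"
  show "(\<lambda>n. F (u n)) \<longlonglongrightarrow> F x"
  proof (rule tendstoI)
    fix e :: real assume e: "e > 0"
    have up: "\<forall>\<^sub>F n in sequentially. G (u n) < G x + e" if G: "bounded_functional S nrm G" for G
      by (rule weak_limit_upper[where S=S and nrm=nrm and Q=Q and B=B]) (fact S Q u x key G e)+
    show "\<forall>\<^sub>F n in sequentially. dist (F (u n)) (F x) < e"
      using up[OF F] up[OF bounded_functional_uminus[OF F]]
      by eventually_elim (auto simp: dist_real_def)
  qed
qed (use u x in auto)

section \<open>Solvability of the discrete scheme\<close>

lemma bounded_bilinear_plus:
  assumes "bounded_bilinear f" "bounded_bilinear g"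
  shows "bounded_bilinear (\<lambda>x y. f x y + g x y)"
proof -
  interpret f: bounded_bilinear f by fact
  interpret g: bounded_bilinear g by fact
  obtain k l where k: "\<And>x y. norm (f x y) \<le> norm x * norm y * k"
    and l: "\<And>x y. norm (g x y) \<le> norm x * norm y * l"
    using f.bounded g.bounded by auto
  have "norm (f x y + g x y) \<le> norm x * norm y * (k + l)" for x y
    using norm_triangle_ineq[of "f x y" "g x y"] k[of x y] l[of x y] by (simp add: distrib_left)
  then show ?thesis
    by unfold_locales (auto simp: f.add_left f.add_right g.add_left g.add_right f.scaleR_left
        f.scaleR_right g.scaleR_left g.scaleR_right scaleR_add_right)
qed

locale gelfand_order =
  fixes \<iota> :: "'v::{real_inner,banach,second_countable_topology}
      \<Rightarrow> 'h::{real_inner,banach,second_countable_topology}"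
    and K :: "'h set" and A :: "'v \<Rightarrow>\<^sub>L 'v \<Rightarrow>\<^sub>L real"
  assumes gelfand: "gelfand_embedding \<iota>"
    and cone: "self_dual_cone K"
    and pos_part_sup: "\<And>x y. ord_le K 0 y \<Longrightarrow> ord_le K x y \<Longrightarrow> ord_le K (pos_part K x) y"
    and pos_part_V: "pos_part_bounded_on_V \<iota> K"
    and operator: "admissible_operator \<iota> K A"
begin

lemma bounded_linear_\<iota>: "bounded_linear \<iota>"
  using gelfand by (simp add: gelfand_embedding_def)

sublocale \<iota>: bounded_linear \<iota> by (rule bounded_linear_\<iota>)

lemma inj_\<iota>: "\<iota> u = \<iota> v \<longleftrightarrow> u = v"
  using gelfand by (auto simp: gelfand_embedding_def inj_def)

lemma to_dual[simp]: "blinfun_apply (to_dual \<iota> x) v = x \<bullet> \<iota> v"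
  by (rule to_dual_apply[OF bounded_linear_\<iota>])

lemma A_bilinear: "bounded_bilinear (\<lambda>u v. A u v)"
  using bounded_bilinear.comp1[OF bounded_bilinear_blinfun_apply blinfun.bounded_linear_right[of A]] .

lemma A_sym: "A u v = A v u"
  using operator by (simp add: admissible_operator_def)

lemma A_coercive: "\<exists>\<alpha>>0. \<forall>v. A v v \<ge> \<alpha> * (norm v)\<^sup>2"
  using operator by (simp add: admissible_operator_def)

lemma A_nonneg: "0 \<le> A v v"
proof -
  obtain \<alpha> where "\<alpha> > 0" "A v v \<ge> \<alpha> * (norm v)\<^sup>2" using A_coercive by blast
  moreover from this have "0 \<le> \<alpha> * (norm v)\<^sup>2" by simp
  ultimately show ?thesis by linarith
qed

lemma A_T_monotone: "\<iota> p = pos_part K (\<iota> v) \<Longrightarrow> \<iota> m = neg_part K (\<iota> v) \<Longrightarrow> A p m \<le> 0"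
  using operator unfolding admissible_operator_def by blast

text \<open>The form of one implicit Euler step of size \<open>h\<close>. The previous iterate
  \<open>x\<close> enters through the data, as \<open>g + (1 / h) *\<^sub>R \<iota> x\<close>, so
  that the form is the same in all steps.\<close>

definition implicit_form :: "real \<Rightarrow> 'v \<Rightarrow> 'v \<Rightarrow> real" where
  "implicit_form h u v = (1 / h) * (\<iota> u \<bullet> \<iota> v) + A u v"

lemma implicit_form_diff:
  "implicit_form h (u - w) v = implicit_form h u v - implicit_form h w v"
  "implicit_form h v (u - w) = implicit_form h v u - implicit_form h v w"
  by (simp_all add: implicit_form_def \<iota>.diff blinfun.diff_left blinfun.diff_right
      inner_diff_left inner_diff_right algebra_simps)

lemma bounded_bilinear_implicit_form: "bounded_bilinear (implicit_form h)"
proof -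
  have "bounded_bilinear (\<lambda>u v. (1 / h) * (\<iota> u \<bullet> \<iota> v))"
  proof -
    have "bounded_bilinear (\<lambda>u v. \<iota> u \<bullet> \<iota> v)"
      by (rule bounded_bilinear.comp[OF bounded_bilinear_inner bounded_linear_\<iota> bounded_linear_\<iota>])
    from bounded_bilinear.comp1[OF this bounded_linear_scaleR_right[of "1 / h"]]
    show ?thesis by (simp add: \<iota>.scaleR)
  qed
  from bounded_bilinear_plus[OF this A_bilinear] show ?thesis
    by (simp add: implicit_form_def[abs_def])
qed

lemma implicit_form_solvable:
  assumes h: "h > 0" and C: "closed C" "convex C" "C \<noteq> {}"
  shows "\<exists>z\<in>C. \<forall>v\<in>C. implicit_form h z (z - v) \<le> g \<bullet> \<iota> (z - v)"
proof -
  obtain \<alpha> where \<alpha>: "\<alpha> > 0" "\<And>v. A v v \<ge> \<alpha> * (norm v)\<^sup>2" using A_coercive by auto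
  have coer: "implicit_form h v v \<ge> \<alpha> * (norm v)\<^sup>2" for v
    using \<alpha>(2)[of v] h by (simp add: implicit_form_def add_increasing)
  have lin: "bounded_linear (\<lambda>v. g \<bullet> \<iota> v)"
    using bounded_linear_compose[OF bounded_linear_inner_right bounded_linear_\<iota>] .
  show ?thesis
    by (rule variational_inequality_solvable[OF bounded_bilinear_implicit_form _ \<alpha>(1) coer lin C])
      (simp add: implicit_form_def A_sym inner_commute)
qed

definition obstacle_solution :: "real \<Rightarrow> 'h \<Rightarrow> 'v \<Rightarrow> 'v \<Rightarrow> bool" where
  "obstacle_solution h g \<psi> z \<longleftrightarrow> ord_le K (\<iota> z) (\<iota> \<psi>) \<and>
     (\<forall>v. ord_le K (\<iota> v) (\<iota> \<psi>) \<longrightarrow> implicit_form h z (z - v) \<le> g \<bullet> \<iota> (z - v))"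

lemma obstacle_solution_exists:
  assumes "h > 0" shows "\<exists>z. obstacle_solution h g \<psi> z"
proof -
  let ?C = "{v. ord_le K (\<iota> v) (\<iota> \<psi>)}"
  have "?C = (\<lambda>v. \<iota> \<psi> - \<iota> v) -` K" by (auto simp: ord_le_def)
  moreover have "isCont (\<lambda>v. \<iota> \<psi> - \<iota> v) x" for x
    by (intro continuous_diff continuous_const linear_continuous_at bounded_linear_\<iota>)
  ultimately have "closed ?C"
    using continuous_closed_vimage[OF closed_self_dual_cone[OF cone]] by metis
  moreover have "convex ?C"
  proof (rule convexI)
    fix x y and a b :: real
    assume "x \<in> ?C" "y \<in> ?C" and ab: "0 \<le> a" "0 \<le> b" "a + b = 1"
    then have "a *\<^sub>R (\<iota> \<psi> - \<iota> x) + b *\<^sub>R (\<iota> \<psi> - \<iota> y) \<in> K"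
      by (auto simp: ord_le_def intro!: self_dual_cone_add[OF cone] self_dual_cone_scale[OF cone])
    moreover have "a *\<^sub>R \<iota> \<psi> + b *\<^sub>R \<iota> \<psi> = \<iota> \<psi>" using ab(3) by (simp flip: scaleR_left.add)
    then have "a *\<^sub>R (\<iota> \<psi> - \<iota> x) + b *\<^sub>R (\<iota> \<psi> - \<iota> y) = \<iota> \<psi> - \<iota> (a *\<^sub>R x + b *\<^sub>R y)"
      by (simp add: \<iota>.add \<iota>.scaleR algebra_simps)
    ultimately show "a *\<^sub>R x + b *\<^sub>R y \<in> ?C" by (simp add: ord_le_def)
  qed
  moreover have "\<psi> \<in> ?C" using ord_le_refl[OF cone] by simp
  ultimately obtain z where "z \<in> ?C" "\<forall>v\<in>?C. implicit_form h z (z - v) \<le> g \<bullet> \<iota> (z - v)"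
    using implicit_form_solvable[OF assms, of ?C g] by blast
  then show ?thesis unfolding obstacle_solution_def by auto
qed

text \<open>The test function \<open>z - w\<close> lies below \<open>z\<close> and hence below the
  obstacle: a constraint from above leaves all downward variations free.\<close>

lemma obstacle_solution_subsolution:
  assumes z: "obstacle_solution h g \<psi> z" and w: "ord_le K 0 (\<iota> w)"
  shows "implicit_form h z w \<le> g \<bullet> \<iota> w"
proof -
  have "ord_le K (\<iota> (z - w)) (\<iota> z)" using w by (simp add: ord_le_def \<iota>.diff)
  then have "ord_le K (\<iota> (z - w)) (\<iota> \<psi>)"
    using z ord_le_trans[OF cone] by (auto simp: obstacle_solution_def)
  then have "implicit_form h z (z - (z - w)) \<le> g \<bullet> \<iota> (z - (z - w))"
    using z unfolding obstacle_solution_def by blast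
  then show ?thesis by simp
qed

lemma V_decomposition:
  obtains p m where "\<iota> p = pos_part K (\<iota> v)" "\<iota> m = neg_part K (\<iota> v)" "v = p - m"
proof -
  obtain p where p: "\<iota> p = pos_part K (\<iota> v)" using pos_part_V by (auto simp: pos_part_bounded_on_V_def)
  have "\<iota> (p - v) = neg_part K (\<iota> v)" using p by (simp add: \<iota>.diff neg_part_def)
  then show ?thesis using that[of p "p - v"] p by simp
qed

text \<open>A weak maximum principle. Writing \<open>d = p - m\<close>, the terms with
  \<open>m\<close> vanish or have the good sign: \<open>p\<close> and \<open>m\<close> are
  orthogonal in H, and T-monotonicity gives \<open>A p m \<le> 0\<close>. What remains forces the
  H-norm of \<open>p\<close> to be 0.\<close>

lemma nonpos_if_implicit_form_nonpos:
  assumes h: "h > 0" and p: "\<iota> p = pos_part K (\<iota> d)" and le: "implicit_form h d p \<le> 0"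
  shows "ord_le K (\<iota> d) 0"
proof -
  note dec = pos_part_decomposition[OF cone, of "\<iota> d"]
  obtain p' m where p': "\<iota> p' = pos_part K (\<iota> d)" and m: "\<iota> m = neg_part K (\<iota> d)" and d: "d = p' - m"
    by (rule V_decomposition)
  have pp: "p' = p" using p p' inj_\<iota>[of p' p] by simp
  have "implicit_form h d p = (1 / h) * (\<iota> p \<bullet> \<iota> p) - (1 / h) * (\<iota> m \<bullet> \<iota> p) + A p p - A p m"
    unfolding d pp by (simp add: implicit_form_def \<iota>.diff inner_diff_left blinfun.diff_left blinfun.diff_right A_sym[of m p] algebra_simps)
  moreover have "\<iota> m \<bullet> \<iota> p = 0" using dec(3) p m by (simp add: inner_commute)
  moreover have "A p m \<le> 0" by (rule A_T_monotone[OF p m])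
  ultimately have "(1 / h) * (\<iota> p \<bullet> \<iota> p) \<le> 0" using A_nonneg[of p] le by simp
  then have "\<iota> p \<bullet> \<iota> p \<le> 0" using h by (simp add: divide_le_0_iff)
  then have "\<iota> p = 0" by (metis inner_gt_zero_iff not_le)
  then have "0 - \<iota> d = \<iota> m" unfolding d pp by (simp add: \<iota>.diff)
  then show ?thesis unfolding ord_le_def using dec(2) m by (simp only:)
qed

text \<open>The subsolution \<open>u\<close> and the solution \<open>z\<close> are both tested in
  the direction \<open>p\<close>, the positive part of \<open>u - z\<close>. The competitor
  \<open>z + p\<close> is admissible because \<open>pos_part_sup\<close> bounds \<open>p\<close> by
  \<open>\<psi> - z\<close>; this is where the positive part has to be a supremum and not just a
  projection.\<close>

lemma comparison:
  assumes h: "h > 0" and sub: "\<And>w. ord_le K 0 (\<iota> w) \<Longrightarrow> implicit_form h u w \<le> g1 \<bullet> \<iota> w"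
    and u: "ord_le K (\<iota> u) (\<iota> \<psi>)" and z: "obstacle_solution h g2 \<psi> z" and g: "ord_le K g1 g2"
  shows "ord_le K (\<iota> u) (\<iota> z)"
proof -
  obtain p m where p: "\<iota> p = pos_part K (\<iota> (u - z))" by (rule V_decomposition)
  have pK: "ord_le K 0 (\<iota> p)" using pos_part_decomposition(1)[OF cone] p by (simp add: ord_le_def)
  have "ord_le K (\<iota> p) (\<iota> \<psi> - \<iota> z)"
    unfolding p by (rule pos_part_sup) (use u z in \<open>auto simp: ord_le_def obstacle_solution_def \<iota>.diff\<close>)
  then have "ord_le K (\<iota> (z + p)) (\<iota> \<psi>)" by (simp add: ord_le_def \<iota>.add algebra_simps)
  then have "implicit_form h z (z - (z + p)) \<le> g2 \<bullet> \<iota> (z - (z + p))"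
    using z unfolding obstacle_solution_def by blast
  then have "- implicit_form h z p \<le> - (g2 \<bullet> \<iota> p)"
    by (simp add: implicit_form_def \<iota>.neg blinfun.minus_right)
  moreover have "implicit_form h u p \<le> g1 \<bullet> \<iota> p" by (rule sub[OF pK])
  moreover have "0 \<le> (g2 - g1) \<bullet> \<iota> p"
    using self_dual_cone_inner[OF cone] g pK by (auto simp: ord_le_def)
  ultimately have "implicit_form h (u - z) p \<le> 0" by (simp add: implicit_form_diff inner_diff_left)
  from nonpos_if_implicit_form_nonpos[OF h p this]
  show ?thesis by (simp add: ord_le_def \<iota>.diff)
qed

lemma comparison_unconstrained:
  assumes h: "h > 0" and sub: "\<And>w. ord_le K 0 (\<iota> w) \<Longrightarrow> implicit_form h u w \<le> g \<bullet> \<iota> w"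
    and z: "\<And>w. implicit_form h z w = g \<bullet> \<iota> w"
  shows "ord_le K (\<iota> u) (\<iota> z)"
proof -
  obtain p m where p: "\<iota> p = pos_part K (\<iota> (u - z))" by (rule V_decomposition)
  have pK: "ord_le K 0 (\<iota> p)" using pos_part_decomposition(1)[OF cone] p by (simp add: ord_le_def)
  have "implicit_form h (u - z) p \<le> 0" using sub[OF pK] z[of p] by (simp add: implicit_form_diff)
  from nonpos_if_implicit_form_nonpos[OF h p this]
  show ?thesis by (simp add: ord_le_def \<iota>.diff)
qed

lemma unconstrained_solution_exists:
  assumes "h > 0" shows "\<exists>z. \<forall>w. implicit_form h z w = g \<bullet> \<iota> w"
proof -
  obtain z where z: "\<And>v. implicit_form h z (z - v) \<le> g \<bullet> \<iota> (z - v)"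
    using implicit_form_solvable[OF assms, of UNIV g] by auto
  have le: "implicit_form h z w \<le> g \<bullet> \<iota> w" for w using z[of "z - w"] by simp
  have "implicit_form h z w = g \<bullet> \<iota> w" for w
    using le[of w] le[of "- w"] by (simp add: implicit_form_def \<iota>.neg blinfun.minus_right)
  then show ?thesis by blast
qed

text \<open>The argument of the fixed-point map ranges over H, where chains have suprema; its values
  are obstacle solutions in V, so the fixed point lies in V. Comparison provides the lower barrier
  \<open>x\<close>, the upper barrier \<open>zb\<close>, and monotonicity in the obstacle.\<close>

lemma qvi_step_exists:
  assumes h: "h > 0"
    and mono: "\<And>y1 y2. ord_le K y1 y2 \<Longrightarrow> ord_le K (\<iota> (\<Psi> y1)) (\<iota> (\<Psi> y2))"
    and x: "ord_le K (\<iota> x) (\<iota> (\<Psi> (\<iota> x)))"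
    and sub: "\<And>w. ord_le K 0 (\<iota> w) \<Longrightarrow> A x w \<le> g \<bullet> \<iota> w"
  shows "\<exists>zb z. (\<forall>w. implicit_form h zb w = (g + (1 / h) *\<^sub>R \<iota> x) \<bullet> \<iota> w) \<and>
    ord_le K (\<iota> x) (\<iota> z) \<and> ord_le K (\<iota> z) (\<iota> zb) \<and>
    obstacle_solution h (g + (1 / h) *\<^sub>R \<iota> x) (\<Psi> (\<iota> z)) z"
proof -
  define g' where "g' = g + (1 / h) *\<^sub>R \<iota> x"
  obtain zb where zb: "\<And>w. implicit_form h zb w = g' \<bullet> \<iota> w"
    using unconstrained_solution_exists[OF h] by blast
  define S where "S y = (SOME z. obstacle_solution h g' (\<Psi> y) z)" for y
  have S: "obstacle_solution h g' (\<Psi> y) (S y)" for y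
    unfolding S_def using obstacle_solution_exists[OF h] by (rule someI_ex)
  \<comment> \<open>The terms with \<open>1 / h\<close> agree on both sides, so the stationary
    inequality for \<open>x\<close> makes it a subsolution of the step that starts from it.\<close>
  have subx: "implicit_form h x w \<le> g' \<bullet> \<iota> w" if "ord_le K 0 (\<iota> w)" for w
    using sub[OF that] by (simp add: implicit_form_def g'_def inner_add_left)
  have "\<exists>y. ord_le K (\<iota> x) y \<and> ord_le K y (\<iota> zb) \<and> \<iota> (S y) = y"
  proof (rule monotone_fixed_point[OF cone])
    show "ord_le K (\<iota> x) (\<iota> zb)" by (rule comparison_unconstrained[OF h subx zb])
    show "ord_le K (\<iota> x) (\<iota> (S (\<iota> x)))" by (rule comparison[OF h subx x S ord_le_refl[OF cone]])
    show "ord_le K (\<iota> (S y)) (\<iota> zb)" for y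
      by (rule comparison_unconstrained[OF h obstacle_solution_subsolution[OF S] zb])
    fix y1 y2 assume "ord_le K y1 y2"
    then have "ord_le K (\<iota> (S y1)) (\<iota> (\<Psi> y2))"
      using ord_le_trans[OF cone _ mono] S[of y1] by (auto simp: obstacle_solution_def)
    from comparison[OF h obstacle_solution_subsolution[OF S] this S ord_le_refl[OF cone]]
    show "ord_le K (\<iota> (S y1)) (\<iota> (S y2))" .
  qed
  then obtain y where y: "ord_le K (\<iota> x) y" "ord_le K y (\<iota> zb)" "\<iota> (S y) = y" by blast
  show ?thesis
    by (intro exI[of _ zb] exI[of _ "S y"]) (use y zb S[of y] in \<open>simp add: g'_def\<close>)
qed

end

section \<open>From almost every time to every time\<close>

lemma AE_timeM_interval:
  assumes "AE t in timeM T. P t" "0 \<le> a" "a < b" "b \<le> T"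
  shows "\<exists>t\<in>{a<..<b}. P t"
proof (rule ccontr)
  assume "\<not> ?thesis"
  then have "AE t in timeM T. t \<notin> {a<..<b}" using assms(1) by (auto elim: eventually_mono)
  moreover have m: "{a<..<b} \<in> sets (timeM T)"
    using assms by (auto simp: sets_restrict_space intro!: image_eqI[of _ _ "{a<..<b}"])
  moreover have eq: "{t \<in> space (timeM T). \<not> t \<notin> {a<..<b}} = {a<..<b}" using assms by auto
  ultimately have "emeasure (timeM T) {a<..<b} = 0"
    using AE_iff_measurable[OF m, of "\<lambda>t. t \<notin> {a<..<b}"] eq by simp
  moreover have "emeasure (timeM T) {a<..<b} = emeasure lebesgue {a<..<b}"
    using assms by (intro emeasure_restrict_space) auto
  ultimately show False using assms by simp
qed

text \<open>Every relative neighbourhood of \<open>t\<close> in \<open>{a..b}\<close> contains an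
  interval of positive length, hence a time at which membership holds; continuity and closedness
  carry it to \<open>t\<close>. This turns almost everywhere orderings of \<Phi> into orderings at
  grid points.\<close>

lemma closed_AE_imp_all:
  fixes u :: "real \<Rightarrow> 'a::metric_space"
  assumes C: "closed C" and u: "continuous_on {a..b} u" and ab: "0 \<le> a" "a < b" "b \<le> T"
    and AE: "AE t in timeM T. t \<in> {a..b} \<longrightarrow> u t \<in> C" and t: "t \<in> {a..b}"
  shows "u t \<in> C"
proof (rule ccontr)
  assume "u t \<notin> C"
  then obtain e where "e > 0" "ball (u t) e \<subseteq> - C"
    using openE[OF open_Compl[OF C]] by blast
  then have e: "e > 0" "ball (u t) e \<inter> C = {}" by auto
  obtain d where d: "d > 0" "\<And>s. s \<in> {a..b} \<Longrightarrow> dist s t < d \<Longrightarrow> dist (u s) (u t) < e"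
    using u t e(1) unfolding continuous_on_iff by metis
  have "\<exists>s\<in>{max a (t - d) <..< min b (t + d)}. s \<in> {a..b} \<longrightarrow> u s \<in> C"
    by (rule AE_timeM_interval[OF AE]) (use ab t d(1) in auto)
  then obtain s where s0: "s \<in> {max a (t - d) <..< min b (t + d)}" "s \<in> {a..b} \<longrightarrow> u s \<in> C" by blast
  then have s: "s \<in> {a..b}" "dist s t < d" "u s \<in> C" by (auto simp: dist_real_def abs_less_iff)
  then show False using d(2)[OF s(1,2)] e(2) by (auto simp: dist_commute)
qed

section \<open>The time grid and averages over its cells\<close>

lemma grid_simps: "N \<ge> 1 \<Longrightarrow> grid T N 0 = 0" "N \<ge> 1 \<Longrightarrow> grid T N N = T"
  "grid T N (Suc n) = grid T N n + T / real N"
  by (auto simp: grid_def field_simps add_divide_distrib)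

lemma grid_mono: "T > 0 \<Longrightarrow> m \<le> n \<Longrightarrow> grid T N m \<le> grid T N n"
  unfolding grid_def by (rule mult_right_mono) auto

lemma grid_bounds:
  assumes "T > 0" "N \<ge> 1" "n \<le> N" shows "0 \<le> grid T N n" "grid T N n \<le> T"
  using grid_mono[OF assms(1), of 0 n N] grid_mono[OF assms(1) assms(3), of N] grid_simps(1,2)[OF assms(2)] by auto

text \<open>\<open>cell_mean\<close> integrates over closed intervals of the whole line, which may
  contain the times 0 and \<open>T\<close>, whereas all other integrals are taken over half-open
  cells inside the open time interval. Only end points differ.\<close>

lemma set_integral_closed_cell:
  fixes g :: "real \<Rightarrow> 'a::{banach,second_countable_topology}"
  assumes T: "T > 0" and N: "N \<ge> 1" and n: "n \<in> {1..N}" and g: "integrable (timeM T) g"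
  shows "(LINT t:{grid T N (n - 1)..grid T N n}|lebesgue. g t) =
    (\<integral>t. indicat_real (cell T N (n - 1)) t *\<^sub>R g t \<partial>timeM T)"
proof -
  define a b where "a = grid T N (n - 1)" and "b = grid T N n"
  have ab: "0 \<le> a" "a < b" "b \<le> T"
    using grid_bounds[OF T N, of "n - 1"] grid_bounds[OF T N, of n] n grid_simps(3)[of T N "n - 1"] T N
    by (auto simp: a_def b_def)
  have cell: "cell T N (n - 1) = {a..<b}" using n by (simp add: cell_def a_def b_def)
  define G where "G t = indicat_real {0<..<T} t *\<^sub>R (indicat_real {a..<b} t *\<^sub>R g t)" for t
  define L where "L t = indicat_real {a..b} t *\<^sub>R g t" for t
  have "{a..<b} \<inter> {0<..<T} \<in> sets (timeM T)" by (auto simp: sets_restrict_space)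
  from integrable_mult_indicator[OF this g]
  have "integrable (timeM T) (\<lambda>t. indicat_real {a..<b} t *\<^sub>R g t)"
    by (subst Bochner_Integration.integrable_cong[OF refl, of "timeM T" _ "\<lambda>t. indicat_real ({a..<b} \<inter> {0<..<T}) t *\<^sub>R g t"])
      (auto simp: indicator_def)
  then have G: "integrable lebesgue G"
    unfolding G_def by (subst (asm) integrable_restrict_space) auto
  have Gint: "(\<integral>t. indicat_real {a..<b} t *\<^sub>R g t \<partial>timeM T) = integral\<^sup>L lebesgue G"
    unfolding G_def by (subst integral_restrict_space) auto
  have point: "integrable lebesgue (\<lambda>t. indicat_real {c} t *\<^sub>R x)" "(\<integral>t. indicat_real {c} t *\<^sub>R x \<partial>lebesgue) = 0"
    for c :: real and x :: 'a
  proof -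
    have "{c} \<in> null_sets lebesgue" by (simp add: null_sets_def)
    then have "AE t in lebesgue. t \<noteq> c" using AE_not_in by fastforce
    then show "(\<integral>t. indicat_real {c} t *\<^sub>R x \<partial>lebesgue) = 0"
      by (intro integral_eq_zero_AE) (auto elim: eventually_mono)
  qed auto
  \<comment> \<open>The integrands differ at most at \<open>a\<close> and \<open>b\<close>. Writing
    the difference with indicators of points makes \<open>L\<close> a sum of integrable
    functions.\<close>
  have "L t = G t + (indicat_real {a} t *\<^sub>R (L a - G a) + indicat_real {b} t *\<^sub>R (L b - G b))" for t
    using ab by (cases "t = a"; cases "t = b"; cases "t \<in> {a<..<b}") (auto simp: L_def G_def indicator_def)
  then have "L = (\<lambda>t. G t + (indicat_real {a} t *\<^sub>R (L a - G a) + indicat_real {b} t *\<^sub>R (L b - G b)))" by blast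
  then have "integral\<^sup>L lebesgue L
      = integral\<^sup>L lebesgue (\<lambda>t. G t + (indicat_real {a} t *\<^sub>R (L a - G a) + indicat_real {b} t *\<^sub>R (L b - G b)))"
    by (rule arg_cong)
  also have "\<dots> = integral\<^sup>L lebesgue G" using G point by simp
  finally show ?thesis unfolding cell Gint set_lebesgue_integral_def a_def[symmetric] b_def[symmetric] L_def[abs_def] .
qed

lemma cell_indicator_measurable: "indicat_real (cell T N n) \<in> borel_measurable (timeM T)"
  unfolding cell_def by (intro measurable_restrict_space1 measurable_completion) auto

lemma cell_integrable:
  fixes g :: "real \<Rightarrow> 'a::{banach,second_countable_topology}"
  assumes "integrable (timeM T) g"
  shows "integrable (timeM T) (\<lambda>t. indicat_real (cell T N n) t *\<^sub>R g t)"
  by (rule bounded_scaleR_integrable[OF assms cell_indicator_measurable, of _ _ 1]) (auto simp: indicator_def)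

lemma cell_mean_eq:
  assumes "T > 0" "N \<ge> 1" "n \<in> {1..N}" "integrable (timeM T) g"
  shows "cell_mean T N g n = (real N / T) *\<^sub>R (\<integral>t. indicat_real (cell T N (n - 1)) t *\<^sub>R g t \<partial>timeM T)"
  unfolding cell_mean_def set_integral_closed_cell[OF assms] by simp

lemma measure_cell:
  assumes T: "T > 0" and N: "N \<ge> 1" and n: "n \<in> {1..N}"
  shows "(\<integral>t. indicat_real (cell T N (n - 1)) t \<partial>timeM T) = T / N"
proof -
  interpret finite_measure "timeM T" by (rule finite_measure_timeM)
  have "(\<integral>t. indicat_real (cell T N (n - 1)) t *\<^sub>R (1::real) \<partial>timeM T)
      = (LINT t:{grid T N (n - 1)..grid T N n}|lebesgue. (1::real))"
    by (rule set_integral_closed_cell[OF T N n, symmetric]) simp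
  also have "\<dots> = grid T N n - grid T N (n - 1)"
    using grid_mono[OF T, of "n - 1" n N] by (simp add: set_lebesgue_integral_def)
  also have "\<dots> = T / N" using grid_simps(3)[of T N "n - 1"] n by simp
  finally show ?thesis by simp
qed

lemma cell_average_mono:
  assumes T: "T > 0" and N: "N \<ge> 1" and n: "n \<in> {1..N}"
    and int: "integrable (timeM T) \<phi>" "integrable (timeM T) \<psi>"
    and le: "AE t in timeM T. t \<in> cell T N (n - 1) \<longrightarrow> \<phi> t \<le> (\<psi> t :: real)"
  shows "(real N / T) * (\<integral>t. indicat_real (cell T N (n - 1)) t * \<phi> t \<partial>timeM T)
    \<le> (real N / T) * (\<integral>t. indicat_real (cell T N (n - 1)) t * \<psi> t \<partial>timeM T)"
proof (rule mult_left_mono)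
  show "(\<integral>t. indicat_real (cell T N (n - 1)) t * \<phi> t \<partial>timeM T)
      \<le> (\<integral>t. indicat_real (cell T N (n - 1)) t * \<psi> t \<partial>timeM T)"
  proof (rule integral_mono_AE)
    show "integrable (timeM T) (\<lambda>t. indicat_real (cell T N (n - 1)) t * \<phi> t)"
      "integrable (timeM T) (\<lambda>t. indicat_real (cell T N (n - 1)) t * \<psi> t)"
      using cell_integrable[OF int(1)] cell_integrable[OF int(2)] by simp_all
    show "AE t in timeM T. indicat_real (cell T N (n - 1)) t * \<phi> t \<le> indicat_real (cell T N (n - 1)) t * \<psi> t"
      using le by eventually_elim (auto simp: indicator_def)
  qed
qed (use T in auto)

lemma cell_average_const:
  assumes T: "T > 0" and N: "N \<ge> 1" and n: "n \<in> {1..N}"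
  shows "(real N / T) * (\<integral>t. indicat_real (cell T N (n - 1)) t * c \<partial>timeM T) = c"
  using measure_cell[OF T N n] T N by simp

lemma cell_mean_inner:
  fixes g :: "real \<Rightarrow> 'a::{real_inner,banach,second_countable_topology}"
  assumes "T > 0" "N \<ge> 1" "n \<in> {1..N}" "integrable (timeM T) g"
  shows "cell_mean T N g n \<bullet> k = (real N / T) * (\<integral>t. indicat_real (cell T N (n - 1)) t * (g t \<bullet> k) \<partial>timeM T)"
proof -
  have "(\<integral>t. (indicat_real (cell T N (n - 1)) t *\<^sub>R g t) \<bullet> k \<partial>timeM T)
      = (\<integral>t. indicat_real (cell T N (n - 1)) t *\<^sub>R g t \<partial>timeM T) \<bullet> k"
    by (rule integral_inner_left) (rule cell_integrable[OF assms(4)])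
  then show ?thesis unfolding cell_mean_eq[OF assms] inner_scaleR_left by simp
qed

text \<open>By self-duality the order can be tested against each \<open>k \<in> K\<close>, where it
  is a scalar inequality: for almost every fixed \<open>s\<close> it is averaged over the times of
  the next cell, and then over \<open>s\<close>.\<close>

lemma cell_mean_increasing:
  fixes g :: "real \<Rightarrow> 'a::{real_inner,banach,second_countable_topology}"
  assumes T: "T > 0" and n: "n \<ge> 1" "Suc n \<le> N" and K: "self_dual_cone K"
    and g: "integrable (timeM T) g" and incr: "increasing_in_time T K g"
  shows "ord_le K (cell_mean T N g n) (cell_mean T N g (Suc n))"
proof -
  interpret finite_measure "timeM T" by (rule finite_measure_timeM)
  have N: "N \<ge> 1" and n1: "n \<in> {1..N}" and n2: "Suc n \<in> {1..N}" using n by auto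
  have "cell_mean T N g n \<bullet> k \<le> cell_mean T N g (Suc n) \<bullet> k" if k: "k \<in> K" for k
  proof -
    have gk: "integrable (timeM T) (\<lambda>t. g t \<bullet> k)" using g by simp
    have *: "AE s in timeM T. s \<in> cell T N (n - 1) \<longrightarrow> g s \<bullet> k \<le> cell_mean T N g (Suc n) \<bullet> k"
      using incr unfolding increasing_in_time_def
    proof eventually_elim
      case (elim s)
      show ?case
      proof
        assume s: "s \<in> cell T N (n - 1)"
        have "AE t in timeM T. t \<in> cell T N (Suc n - 1) \<longrightarrow> g s \<bullet> k \<le> g t \<bullet> k"
          using elim
        proof eventually_elim
          case (elim t)
          show ?case
          proof
            assume "t \<in> cell T N (Suc n - 1)"
            then have "s \<le> t" using s n by (auto simp: cell_def)
            then have "0 \<le> (g t - g s) \<bullet> k"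
              using elim self_dual_cone_inner[OF K _ k] by (simp add: ord_le_def)
            then show "g s \<bullet> k \<le> g t \<bullet> k" by (simp add: inner_diff_left)
          qed
        qed
        from cell_average_mono[OF T N n2 _ gk this]
        show "g s \<bullet> k \<le> cell_mean T N g (Suc n) \<bullet> k"
          using cell_average_const[OF T N n2] by (simp add: cell_mean_inner[OF T N n2 g])
      qed
    qed
    from cell_average_mono[OF T N n1 gk _ this] show ?thesis
      using cell_average_const[OF T N n1] by (simp add: cell_mean_inner[OF T N n1 g])
  qed
  then show ?thesis unfolding ord_le_def
    by (subst self_dual_coneD[OF K]) (auto simp: inner_diff_left)
qed

section \<open>Existence of the iterates\<close>

locale qvi_scheme = gelfand_order \<iota> K A
  for \<iota> :: "'v::{real_inner,banach,second_countable_topology}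
      \<Rightarrow> 'h::{real_inner,banach,second_countable_topology}" and K A +
  fixes T :: real and \<Phi> :: "(real \<Rightarrow> 'h) \<Rightarrow> real \<Rightarrow> 'v" and f :: "real \<Rightarrow> 'h" and z\<^sub>0 :: 'v
  assumes T_pos: "T > 0"
    and \<Phi>_map: "increasing_map T \<iota> K \<Phi>"
    and f_L2: "f \<in> L2 T"
    and \<Phi>_cont: "\<And>x. continuous_on {0..T} (\<Phi> (\<lambda>_. x))"
    and f_incr: "increasing_in_time T K f"
    and z0_nonneg: "ord_le K 0 (\<iota> z\<^sub>0)"
    and z0_obstacle: "ord_le K (\<iota> z\<^sub>0) (\<iota> (\<Phi> (\<lambda>_. \<iota> z\<^sub>0) 0))"
    and z0_sub: "\<And>v. ord_le K 0 (\<iota> v) \<Longrightarrow> AE t in timeM T. (A z\<^sub>0 - to_dual \<iota> (f t)) v \<le> 0"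
    and \<Phi>_incr: "\<And>v. ord_le K 0 (\<iota> v) \<Longrightarrow> increasing_in_time T K (\<iota> \<circ> \<Phi> (\<lambda>_. \<iota> v))"
begin

lemma \<iota>_\<Phi>_cont: "continuous_on {0..T} (\<lambda>t. \<iota> (\<Phi> (\<lambda>_. x) t))"
  by (rule bounded_linear.continuous_on[OF bounded_linear_\<iota> \<Phi>_cont])

lemma \<Phi>_const_mono:
  assumes "ord_le K x y" "t \<in> {0..T}"
  shows "ord_le K (\<iota> (\<Phi> (\<lambda>_. x) t)) (\<iota> (\<Phi> (\<lambda>_. y) t))"
proof -
  have "AE t in timeM T. ord_le K (\<iota> (\<Phi> (\<lambda>_. x) t)) (\<iota> (\<Phi> (\<lambda>_. y) t))"
    using \<Phi>_map L2_const[of x T] L2_const[of y T] assms(1) unfolding increasing_map_def by auto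
  then have "AE t in timeM T. t \<in> {0..T} \<longrightarrow> \<iota> (\<Phi> (\<lambda>_. y) t) - \<iota> (\<Phi> (\<lambda>_. x) t) \<in> K"
    by eventually_elim (simp add: ord_le_def)
  from closed_AE_imp_all[OF closed_self_dual_cone[OF cone] _ order_refl T_pos order_refl this assms(2)]
  show ?thesis using continuous_on_diff[OF \<iota>_\<Phi>_cont \<iota>_\<Phi>_cont] by (simp add: ord_le_def)
qed

lemma \<Phi>_const_incr:
  assumes v: "ord_le K 0 (\<iota> v)" and st: "0 \<le> s" "s \<le> t" "t \<le> T"
  shows "ord_le K (\<iota> (\<Phi> (\<lambda>_. \<iota> v) s)) (\<iota> (\<Phi> (\<lambda>_. \<iota> v) t))"
proof (cases "s < t")
  case False then show ?thesis using st ord_le_refl[OF cone] by (simp add: order.antisym)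
next
  case True
  let ?u = "\<lambda>t. \<iota> (\<Phi> (\<lambda>_. \<iota> v) t)"
  have cont: "continuous_on {a..b} ?u" if "0 \<le> a" "b \<le> T" for a b
    by (rule continuous_on_subset[OF \<iota>_\<Phi>_cont]) (use that in auto)
  \<comment> \<open>The exceptional null set of the later time depends on the earlier time.
    Closedness is therefore used twice: in the later time for almost every \<open>s\<close>, and
    then in the earlier time with \<open>t\<close> fixed.\<close>
  have *: "AE s in timeM T. s \<in> {0..t} \<longrightarrow> ?u t - ?u s \<in> K"
    using \<Phi>_incr[OF v] AE_space[of "timeM T"] unfolding increasing_in_time_def
  proof eventually_elim
    case (elim s)
    show ?case
    proof
      assume st': "s \<in> {0..t}"
      have s: "0 < s" "s < T" using elim(2) by auto
      have AE: "AE r in timeM T. r \<in> {s..T} \<longrightarrow> ?u r - ?u s \<in> K"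
        using elim(1) by eventually_elim (auto simp: ord_le_def)
      show "?u t - ?u s \<in> K"
        by (rule closed_AE_imp_all[OF closed_self_dual_cone[OF cone] _ _ s(2) order_refl AE])
          (use s st st' in \<open>auto intro!: continuous_on_diff cont\<close>)
    qed
  qed
  have "continuous_on {0..t} (\<lambda>s. ?u t - ?u s)"
    by (intro continuous_on_diff continuous_on_const cont) (use st in auto)
  from closed_AE_imp_all[OF closed_self_dual_cone[OF cone] this order_refl _ st(3) *, of s]
  show ?thesis using st True by (simp add: ord_le_def)
qed

lemma f_integrable: "integrable (timeM T) f" by (rule L2_integrable[OF f_L2])

text \<open>The hypothesis on \<open>z\<^sub>0\<close> is averaged over the first cell; its
  exceptional null set may depend on \<open>w\<close>, which is fixed before integrating.\<close>

lemma z0_subsolution: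
  assumes N: "N \<ge> 1" and w: "ord_le K 0 (\<iota> w)"
  shows "A z\<^sub>0 w \<le> cell_mean T N f 1 \<bullet> \<iota> w"
proof -
  interpret finite_measure "timeM T" by (rule finite_measure_timeM)
  have n: "1 \<in> {1..N}" using N by simp
  have fw: "integrable (timeM T) (\<lambda>t. f t \<bullet> \<iota> w)" using f_integrable by simp
  have "AE t in timeM T. t \<in> cell T N (1 - 1) \<longrightarrow> A z\<^sub>0 w \<le> f t \<bullet> \<iota> w"
    using z0_sub[OF w] by eventually_elim (simp add: blinfun.diff_left)
  from cell_average_mono[OF T_pos N n _ fw this]
  show ?thesis
    unfolding cell_average_const[OF T_pos N n] cell_mean_inner[OF T_pos N n f_integrable, symmetric] by simp
qed

text \<open>Brings both relations of the scheme, the first after division by \<open>h\<close>, to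
  \<open>implicit_form\<close> with the data \<open>g + (1 / h) *\<^sub>R \<iota> x\<close>.\<close>

lemma discrete_step_iff:
  assumes h: "h > 0"
  shows "to_dual \<iota> (\<iota> zb) + h *\<^sub>R A zb = h *\<^sub>R to_dual \<iota> g + to_dual \<iota> (\<iota> x) \<longleftrightarrow>
      (\<forall>w. implicit_form h zb w = (g + (1 / h) *\<^sub>R \<iota> x) \<bullet> \<iota> w)"
    and "(to_dual \<iota> ((1 / h) *\<^sub>R \<iota> (z - x)) + A z - to_dual \<iota> g) (z - v) \<le> 0 \<longleftrightarrow>
      implicit_form h z (z - v) \<le> (g + (1 / h) *\<^sub>R \<iota> x) \<bullet> \<iota> (z - v)"
proof -
  have "to_dual \<iota> (\<iota> zb) + h *\<^sub>R A zb = h *\<^sub>R to_dual \<iota> g + to_dual \<iota> (\<iota> x) \<longleftrightarrow>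
      (\<forall>w. \<iota> zb \<bullet> \<iota> w + h * A zb w = h * (g \<bullet> \<iota> w) + \<iota> x \<bullet> \<iota> w)"
    by (auto intro!: blinfun_eqI simp: blinfun.add_left blinfun.scaleR_left dest: arg_cong[where f="\<lambda>b. blinfun_apply b _"])
  also have "\<dots> \<longleftrightarrow> (\<forall>w. implicit_form h zb w = (g + (1 / h) *\<^sub>R \<iota> x) \<bullet> \<iota> w)"
    using h by (simp add: implicit_form_def inner_add_left field_simps)
  finally show "to_dual \<iota> (\<iota> zb) + h *\<^sub>R A zb = h *\<^sub>R to_dual \<iota> g + to_dual \<iota> (\<iota> x) \<longleftrightarrow>
      (\<forall>w. implicit_form h zb w = (g + (1 / h) *\<^sub>R \<iota> x) \<bullet> \<iota> w)" .
  show "(to_dual \<iota> ((1 / h) *\<^sub>R \<iota> (z - x)) + A z - to_dual \<iota> g) (z - v) \<le> 0 \<longleftrightarrow>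
      implicit_form h z (z - v) \<le> (g + (1 / h) *\<^sub>R \<iota> x) \<bullet> \<iota> (z - v)"
    by (simp add: implicit_form_def blinfun.add_left blinfun.diff_left \<iota>.diff inner_add_left
        inner_diff_left inner_diff_right algebra_simps)
qed

lemma discrete_solution_exists:
  assumes N: "N \<ge> 1"
  shows "\<exists>zb zs. discrete_solution T \<iota> K A \<Phi> f z\<^sub>0 N zb zs"
proof -
  define h where "h = T / N"
  have h: "h > 0" using T_pos N by (simp add: h_def)
  define \<Psi> where "\<Psi> n y = \<Phi> (\<lambda>_. y) (grid T N n)" for n y
  define g where "g n = cell_mean T N f n" for n
  \<comment> \<open>\<open>P n x\<close> collects what step \<open>n\<close> requires of its
    starting point, together with nonnegativity. The guard \<open>n < N\<close> lets the choice of a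
    sequence over all natural numbers continue after the last step.\<close>
  define P where "P n x \<longleftrightarrow> (n < N \<longrightarrow> ord_le K 0 (\<iota> x) \<and> ord_le K (\<iota> x) (\<iota> (\<Psi> n (\<iota> x))) \<and>
      (\<forall>w. ord_le K 0 (\<iota> w) \<longrightarrow> A x w \<le> g (Suc n) \<bullet> \<iota> w))" for n x
  define R where "R n x z zb \<longleftrightarrow> (\<forall>w. implicit_form h zb w = (g (Suc n) + (1 / h) *\<^sub>R \<iota> x) \<bullet> \<iota> w) \<and>
      ord_le K (\<iota> x) (\<iota> z) \<and> ord_le K (\<iota> z) (\<iota> zb) \<and>
      obstacle_solution h (g (Suc n) + (1 / h) *\<^sub>R \<iota> x) (\<Psi> n (\<iota> z)) z" for n x z zb
  have grid01: "grid T N n \<in> {0..T}" if "n \<le> N" for n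
    using grid_bounds[OF T_pos N that] by simp
  have "\<exists>zs. \<forall>n. (P n (zs n) \<and> (n = 0 \<longrightarrow> zs n = z\<^sub>0)) \<and> (n < N \<longrightarrow> (\<exists>zb. R n (zs n) (zs (Suc n)) zb))"
  proof (rule dependent_nat_choice)
    have "P 0 z\<^sub>0"
      using z0_nonneg z0_obstacle z0_subsolution[OF N] grid_simps(1)[OF N] by (auto simp: P_def \<Psi>_def g_def)
    then show "\<exists>x. P 0 x \<and> (0 = (0::nat) \<longrightarrow> x = z\<^sub>0)" by blast
  next
    fix x n assume x: "P n x \<and> (n = 0 \<longrightarrow> x = z\<^sub>0)"
    show "\<exists>z. (P (Suc n) z \<and> (Suc n = 0 \<longrightarrow> z = z\<^sub>0)) \<and> (n < N \<longrightarrow> (\<exists>zb. R n x z zb))"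
    proof (cases "n < N")
      case False then show ?thesis by (auto simp: P_def)
    next
      case True
      then have x: "ord_le K 0 (\<iota> x)" "ord_le K (\<iota> x) (\<iota> (\<Psi> n (\<iota> x)))"
        "\<And>w. ord_le K 0 (\<iota> w) \<Longrightarrow> A x w \<le> g (Suc n) \<bullet> \<iota> w" using x by (auto simp: P_def)
      have mono: "ord_le K (\<iota> (\<Psi> n y1)) (\<iota> (\<Psi> n y2))" if "ord_le K y1 y2" for y1 y2
        unfolding \<Psi>_def by (rule \<Phi>_const_mono[OF that grid01]) (use True in simp)
      obtain zb z where R: "R n x z zb"
        using qvi_step_exists[where h=h and \<Psi>="\<Psi> n" and x=x and g="g (Suc n)", OF h mono x(2,3)]
        unfolding R_def by blast
      have "P (Suc n) z"
        unfolding P_def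
      proof (intro impI conjI allI)
        assume n: "Suc n < N"
        show z0: "ord_le K 0 (\<iota> z)" using R x(1) ord_le_trans[OF cone] unfolding R_def by blast
        \<comment> \<open>The obstacle increases in time, so the iterate stays below its own
          obstacle at the next grid point.\<close>
        have "ord_le K (\<iota> (\<Psi> n (\<iota> z))) (\<iota> (\<Psi> (Suc n) (\<iota> z)))"
          unfolding \<Psi>_def
          by (rule \<Phi>_const_incr[OF z0]) (use grid_bounds[OF T_pos N] n grid_mono[OF T_pos] in auto)
        then show "ord_le K (\<iota> z) (\<iota> (\<Psi> (Suc n) (\<iota> z)))"
          using R ord_le_trans[OF cone] unfolding R_def obstacle_solution_def by blast
        fix w assume w: "ord_le K 0 (\<iota> w)"
        \<comment> \<open>Dropping the difference quotient is allowed because \<open>z\<close> lies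
          above \<open>x\<close>, and the mean of \<open>f\<close> over the next cell is larger; so
          \<open>z\<close> inherits the stationary inequality with the next data.\<close>
        have "implicit_form h z w \<le> (g (Suc n) + (1 / h) *\<^sub>R \<iota> x) \<bullet> \<iota> w"
          using obstacle_solution_subsolution[OF _ w] R unfolding R_def by blast
        moreover have "0 \<le> (1 / h) * ((\<iota> z - \<iota> x) \<bullet> \<iota> w)"
          using R w h self_dual_cone_inner[OF cone] by (auto simp: R_def ord_le_def)
        moreover have "0 \<le> (g (Suc (Suc n)) - g (Suc n)) \<bullet> \<iota> w"
          using cell_mean_increasing[OF T_pos _ _ cone f_integrable f_incr, of "Suc n" N] n w
            self_dual_cone_inner[OF cone] by (auto simp: g_def ord_le_def)
        ultimately show "A z w \<le> g (Suc (Suc n)) \<bullet> \<iota> w"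
          by (simp add: implicit_form_def inner_add_left inner_diff_left algebra_simps)
      qed
      then show ?thesis using R by blast
    qed
  qed
  then obtain zs where zs0: "zs 0 = z\<^sub>0" and zs: "\<And>n. n < N \<Longrightarrow> \<exists>zb. R n (zs n) (zs (Suc n)) zb" by blast
  then obtain zb where R: "\<And>n. n < N \<Longrightarrow> R n (zs n) (zs (Suc n)) (zb n)" by metis
  \<comment> \<open>The choice indexes \<open>zb\<close> by the grid point where a step starts, the
    scheme by the one where it ends; hence the shift.\<close>
  have "discrete_solution T \<iota> K A \<Phi> f z\<^sub>0 N (\<lambda>n. zb (n - 1)) zs"
    unfolding discrete_solution_def Let_def h_def[symmetric] discrete_step_iff[OF h]
  proof (intro conjI ballI zs0)
    fix n assume n: "n \<in> {1..N}"
    then have "n - 1 < N" "Suc (n - 1) = n" by auto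
    then have "R (n - 1) (zs (n - 1)) (zs n) (zb (n - 1))" using R[of "n - 1"] by simp
    then show "\<forall>w. implicit_form h (zb (n - 1)) w = (cell_mean T N f n + (1 / h) *\<^sub>R \<iota> (zs (n - 1))) \<bullet> \<iota> w"
      "ord_le K (\<iota> (zs (n - 1))) (\<iota> (zs n))" "ord_le K (\<iota> (zs n)) (\<iota> (zb (n - 1)))"
      "ord_le K (\<iota> (zs n)) (\<iota> (\<Phi> (\<lambda>_. \<iota> (zs n)) (grid T N (n - 1))))"
      "\<forall>v. ord_le K (\<iota> v) (\<iota> (\<Phi> (\<lambda>_. \<iota> (zs n)) (grid T N (n - 1)))) \<longrightarrow>
         implicit_form h (zs n) (zs n - v) \<le> (cell_mean T N f n + (1 / h) *\<^sub>R \<iota> (zs (n - 1))) \<bullet> \<iota> (zs n - v)"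
      using n by (auto simp: R_def g_def \<Psi>_def obstacle_solution_def)
  qed
  then show ?thesis by blast
qed

end

section \<open>Interpolants\<close>

text \<open>The number of the cell containing \<open>t\<close>, counted from 0. On this cell the
  step interpolant takes the value at the right end, which is why
  \<open>Suc (cell_index T N t)\<close> appears later.\<close>

definition cell_index :: "real \<Rightarrow> nat \<Rightarrow> real \<Rightarrow> nat" where
  "cell_index T N t = nat \<lfloor>t * real N / T\<rfloor>"

lemma mem_cell_iff:
  assumes T: "T > 0" and N: "N \<ge> 1" and t: "0 \<le> t"
  shows "t \<in> cell T N j \<longleftrightarrow> j = cell_index T N t"
proof -
  have "t \<in> cell T N j \<longleftrightarrow> real j \<le> t * N / T \<and> t * N / T < real j + 1"
    using T N by (auto simp: cell_def grid_def field_simps)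
  also have "\<dots> \<longleftrightarrow> \<lfloor>t * real N / T\<rfloor> = int j" by (simp add: floor_eq_iff)
  also have "\<dots> \<longleftrightarrow> j = cell_index T N t"
    using T t by (auto simp: cell_index_def)
  finally show ?thesis .
qed

lemma cell_index_bounds:
  assumes T: "T > 0" and N: "N \<ge> 1" and t: "0 \<le> t"
  shows "grid T N (cell_index T N t) \<le> t" "t < grid T N (Suc (cell_index T N t))"
    "t < T \<Longrightarrow> cell_index T N t < N" "t \<le> T \<Longrightarrow> cell_index T N t \<le> N"
proof -
  have "t \<in> cell T N (cell_index T N t)" using mem_cell_iff[OF assms] by simp
  then show *: "grid T N (cell_index T N t) \<le> t" "t < grid T N (Suc (cell_index T N t))"
    by (auto simp: cell_def)
  show "t < T \<Longrightarrow> cell_index T N t < N"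
    using *(1) grid_mono[OF T, of N "cell_index T N t" N] grid_simps(2)[OF N, of T] by (cases "cell_index T N t < N") auto
  show "cell_index T N t \<le> N" if "t \<le> T"
  proof (rule ccontr)
    assume "\<not> cell_index T N t \<le> N"
    then have "grid T N (Suc N) \<le> grid T N (cell_index T N t)" by (intro grid_mono[OF T]) simp
    moreover have "0 < T / real N" using T N by simp
    ultimately show False using that *(1) grid_simps(2)[OF N, of T] grid_simps(3)[of T N N] by linarith
  qed
qed

lemma cell_index_0: "cell_index T N 0 = 0"
  by (simp add: cell_index_def)

lemma cell_index_mono: "T > 0 \<Longrightarrow> s \<le> t \<Longrightarrow> cell_index T N s \<le> cell_index T N t"
  unfolding cell_index_def by (intro nat_mono floor_mono divide_right_mono mult_right_mono) auto

lemma sum_cell_indicator: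
  fixes w :: "nat \<Rightarrow> 'a::real_vector"
  assumes T: "T > 0" and N: "N \<ge> 1" and t: "0 \<le> t" "t < T"
  shows "(\<Sum>n=1..N. indicat_real (cell T N (n - 1)) t *\<^sub>R w n) = w (Suc (cell_index T N t))"
proof -
  have "(\<Sum>n=1..N. indicat_real (cell T N (n - 1)) t *\<^sub>R w n)
      = (\<Sum>n=1..N. if n = Suc (cell_index T N t) then w n else 0)"
    by (intro sum.cong) (auto simp: indicator_def mem_cell_iff[OF T N t(1)])
  also have "\<dots> = w (Suc (cell_index T N t))" using cell_index_bounds(3)[OF T N t] by simp
  finally show ?thesis .
qed

lemma step_interpolant_eq:
  assumes "T > 0" "N \<ge> 1" "0 \<le> t" "t < T"
  shows "step_interpolant T N w t = w (Suc (cell_index T N t))"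
  unfolding step_interpolant_def by (rule sum_cell_indicator[OF assms])

lemma affine_interpolant_eq:
  assumes "T > 0" "N \<ge> 1" "0 \<le> t" "t < T"
  defines "i \<equiv> cell_index T N t"
  shows "affine_interpolant T N w t = w i + ((t - grid T N i) / (T / real N)) *\<^sub>R (w (Suc i) - w i)"
    "0 \<le> (t - grid T N i) / (T / real N)" "(t - grid T N i) / (T / real N) \<le> 1"
proof -
  show "affine_interpolant T N w t = w i + ((t - grid T N i) / (T / real N)) *\<^sub>R (w (Suc i) - w i)"
    unfolding affine_interpolant_def i_def by (subst sum_cell_indicator[OF assms(1-4)]) simp
  have h: "0 < T / real N" using assms(1,2) by simp
  have "0 \<le> t - grid T N i" "t - grid T N i \<le> T / real N"
    using cell_index_bounds(1,2)[OF assms(1-3)] grid_simps(3)[of T N i] unfolding i_def by auto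
  then show "0 \<le> (t - grid T N i) / (T / real N)" and "(t - grid T N i) / (T / real N) \<le> 1"
    by (simp_all only: divide_nonneg_pos[OF _ h] pos_divide_le_eq[OF h] mult_1)
qed

lemma step_interpolant_measurable:
  fixes w :: "nat \<Rightarrow> 'a::{banach,second_countable_topology}"
  shows "step_interpolant T N w \<in> borel_measurable (timeM T)"
  unfolding step_interpolant_def[abs_def] using cell_indicator_measurable by measurable

lemma step_interpolant_L2:
  fixes w :: "nat \<Rightarrow> 'a::{banach,second_countable_topology}"
  shows "step_interpolant T N w \<in> L2 T"
proof (rule L2_bounded[OF step_interpolant_measurable])
  have "norm (step_interpolant T N w t) \<le> (\<Sum>n=1..N. norm (w n))" for t
    unfolding step_interpolant_def
    by (rule order_trans[OF norm_sum sum_mono]) (auto simp: indicator_def)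
  then show "AE t in timeM T. norm (step_interpolant T N w t) \<le> (\<Sum>n=1..N. norm (w n))" by simp
qed

lemma affine_interpolant_L2:
  fixes w :: "nat \<Rightarrow> 'a::{banach,second_countable_topology}"
  assumes T: "T > 0" and N: "N \<ge> 1" and w: "\<And>n. n \<le> N \<Longrightarrow> norm (w n) \<le> C"
  shows "affine_interpolant T N w \<in> L2 T" "AE t in timeM T. norm (affine_interpolant T N w t) \<le> 3 * C"
proof -
  show b: "AE t in timeM T. norm (affine_interpolant T N w t) \<le> 3 * C"
  proof (rule AE_timeM_I)
    fix t assume t: "0 < t" "t < T"
    let ?i = "cell_index T N t" and ?\<theta> = "(t - grid T N (cell_index T N t)) / (T / real N)"
    note eq = affine_interpolant_eq[OF T N less_imp_le[OF t(1)] t(2)]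
    have i: "?i < N" using cell_index_bounds(3)[OF T N] t by simp
    have "norm (affine_interpolant T N w t) \<le> norm (w ?i) + \<bar>?\<theta>\<bar> * norm (w (Suc ?i) - w ?i)"
      unfolding eq(1) by (metis norm_scaleR norm_triangle_ineq)
    \<comment> \<open>A crude bound of the increment by two norms; this is the origin of the factor
      3.\<close>
    also have "\<dots> \<le> norm (w ?i) + 1 * (norm (w (Suc ?i)) + norm (w ?i))"
      using eq(2,3) by (intro add_left_mono mult_mono norm_triangle_ineq4) auto
    also have "\<dots> \<le> 3 * C" using w[of ?i] w[of "Suc ?i"] i by simp
    finally show "norm (affine_interpolant T N w t) \<le> 3 * C" .
  qed
  have "(\<lambda>t::real. (t - c) / d) \<in> borel_measurable (timeM T)" for c d :: real
    unfolding divide_inverse by (intro continuous_measurable_timeM continuous_intros)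
  then have "affine_interpolant T N w \<in> borel_measurable (timeM T)"
    unfolding affine_interpolant_def[abs_def] using cell_indicator_measurable by measurable
  then show "affine_interpolant T N w \<in> L2 T" using b by (rule L2_bounded)
qed

lemma integral_cell_decomposition:
  fixes g :: "real \<Rightarrow> 'a::{banach,second_countable_topology}"
  assumes T: "T > 0" and N: "N \<ge> 1" and g: "integrable (timeM T) g"
  shows "(\<integral>t. g t \<partial>timeM T) = (\<Sum>n=1..N. \<integral>t. indicat_real (cell T N (n - 1)) t *\<^sub>R g t \<partial>timeM T)"
proof -
  have "(\<integral>t. g t \<partial>timeM T) = (\<integral>t. (\<Sum>n=1..N. indicat_real (cell T N (n - 1)) t *\<^sub>R g t) \<partial>timeM T)"
    by (rule Bochner_Integration.integral_cong[OF refl])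
      (use sum_cell_indicator[OF T N, of _ "\<lambda>_. g _"] in auto)
  also have "\<dots> = (\<Sum>n=1..N. \<integral>t. indicat_real (cell T N (n - 1)) t *\<^sub>R g t \<partial>timeM T)"
    by (rule Bochner_Integration.integral_sum) (rule cell_integrable[OF g])
  finally show ?thesis .
qed

lemma step_interpolant_cell:
  assumes T: "T > 0" and N: "N \<ge> 1" and n: "n \<in> {1..N}" and t: "0 \<le> t" "t < T" "t \<in> cell T N (n - 1)"
  shows "step_interpolant T N w t = w n"
proof -
  have "cell_index T N t = n - 1" using mem_cell_iff[OF T N t(1)] t(3) by simp
  then show ?thesis using step_interpolant_eq[OF T N t(1,2), of w] n by simp
qed

lemma step_interpolant_integral:
  fixes w :: "nat \<Rightarrow> 'a::{banach,second_countable_topology}" and G :: "real \<Rightarrow> 'a \<Rightarrow> 'b::{banach,second_countable_topology}"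
  assumes T: "T > 0" and N: "N \<ge> 1" and int: "integrable (timeM T) (\<lambda>t. G t (step_interpolant T N w t))"
  shows "(\<integral>t. G t (step_interpolant T N w t) \<partial>timeM T)
    = (\<Sum>n=1..N. \<integral>t. indicat_real (cell T N (n - 1)) t *\<^sub>R G t (w n) \<partial>timeM T)"
  unfolding integral_cell_decomposition[OF T N int]
proof (intro sum.cong refl Bochner_Integration.integral_cong)
  fix n t assume n: "n \<in> {1..N}" and t: "t \<in> space (timeM T)"
  then have t: "0 \<le> t" "t < T" by auto
  show "indicat_real (cell T N (n - 1)) t *\<^sub>R G t (step_interpolant T N w t)
      = indicat_real (cell T N (n - 1)) t *\<^sub>R G t (w n)"
    using step_interpolant_cell[OF T N n t, of w] by (cases "t \<in> cell T N (n - 1)") auto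
qed

lemma L2_norm_step_interpolant:
  fixes w :: "nat \<Rightarrow> 'a::{banach,second_countable_topology}"
  assumes T: "T > 0" and N: "N \<ge> 1"
  shows "(L2_norm T (step_interpolant T N w))\<^sup>2 = (T / N) * (\<Sum>n=1..N. (norm (w n))\<^sup>2)"
proof -
  have "(L2_norm T (step_interpolant T N w))\<^sup>2
      = (\<Sum>n=1..N. \<integral>t. indicat_real (cell T N (n - 1)) t *\<^sub>R (norm (w n))\<^sup>2 \<partial>timeM T)"
    unfolding L2_norm_sq
    by (rule step_interpolant_integral[OF T N]) (rule L2_integrable_sq[OF step_interpolant_L2])
  also have "\<dots> = (\<Sum>n=1..N. (T / N) * (norm (w n))\<^sup>2)"
    using measure_cell[OF T N] by (intro sum.cong) auto
  finally show ?thesis by (simp add: sum_distrib_left)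
qed

text \<open>Jensen's inequality on each cell, obtained by expanding the integral of
  \<open>(norm (g t - m))\<^sup>2\<close> around the mean \<open>m\<close>.\<close>

lemma cell_mean_sq_le:
  fixes g :: "real \<Rightarrow> 'a::{real_inner,banach,second_countable_topology}"
  assumes T: "T > 0" and N: "N \<ge> 1" and g: "g \<in> L2 T"
  shows "(T / N) * (\<Sum>n=1..N. (norm (cell_mean T N g n))\<^sup>2) \<le> (L2_norm T g)\<^sup>2"
proof -
  interpret finite_measure "timeM T" by (rule finite_measure_timeM)
  have "(T / N) * (norm (cell_mean T N g n))\<^sup>2
      \<le> (\<integral>t. indicat_real (cell T N (n - 1)) t *\<^sub>R (norm (g t))\<^sup>2 \<partial>timeM T)" if n: "n \<in> {1..N}" for n
  proof -
    define m where "m = cell_mean T N g n"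
    have i1: "integrable (timeM T) (\<lambda>t. indicat_real (cell T N (n - 1)) t *\<^sub>R (norm (g t))\<^sup>2)"
      by (rule cell_integrable[OF L2_integrable_sq[OF g]])
    have i2: "integrable (timeM T) (\<lambda>t. indicat_real (cell T N (n - 1)) t * (g t \<bullet> m))"
      using cell_integrable[of T "\<lambda>t. g t \<bullet> m" N "n - 1"] L2_integrable[OF g] by simp
    have i3: "integrable (timeM T) (\<lambda>t. indicat_real (cell T N (n - 1)) t)"
      using cell_integrable[of T "\<lambda>t. 1::real" N "n - 1"] by simp
    have "0 \<le> (\<integral>t. indicat_real (cell T N (n - 1)) t * (norm (g t - m))\<^sup>2 \<partial>timeM T)"
      by (intro integral_nonneg_AE) auto
    also have "\<dots> = (\<integral>t. indicat_real (cell T N (n - 1)) t *\<^sub>R (norm (g t))\<^sup>2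
        - 2 * (indicat_real (cell T N (n - 1)) t * (g t \<bullet> m)) + indicat_real (cell T N (n - 1)) t * (m \<bullet> m) \<partial>timeM T)"
      by (intro Bochner_Integration.integral_cong refl)
        (simp add: power2_norm_eq_inner inner_diff_left inner_diff_right inner_commute algebra_simps)
    also have "\<dots> = (\<integral>t. indicat_real (cell T N (n - 1)) t *\<^sub>R (norm (g t))\<^sup>2 \<partial>timeM T)
        - 2 * (\<integral>t. indicat_real (cell T N (n - 1)) t * (g t \<bullet> m) \<partial>timeM T) + (T / N) * (m \<bullet> m)"
      using i1 i2 i3 measure_cell[OF T N n] by simp
    also have "(\<integral>t. indicat_real (cell T N (n - 1)) t * (g t \<bullet> m) \<partial>timeM T) = (T / N) * (m \<bullet> m)"
      using cell_mean_inner[OF T N n L2_integrable[OF g], of m] T N unfolding m_def[symmetric] by (simp add: field_simps)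
    finally show ?thesis by (simp add: m_def power2_norm_eq_inner)
  qed
  then have "(\<Sum>n=1..N. (T / N) * (norm (cell_mean T N g n))\<^sup>2)
      \<le> (\<Sum>n=1..N. \<integral>t. indicat_real (cell T N (n - 1)) t *\<^sub>R (norm (g t))\<^sup>2 \<partial>timeM T)"
    by (rule sum_mono)
  also have "\<dots> = (L2_norm T g)\<^sup>2"
    unfolding L2_norm_sq by (rule integral_cell_decomposition[OF T N L2_integrable_sq[OF g], symmetric])
  finally show ?thesis by (simp add: sum_distrib_left)
qed

lemma cell_integral_FTC:
  fixes F F' :: "real \<Rightarrow> real"
  assumes T: "T > 0" and N: "N \<ge> 1" and n: "n \<in> {1..N}"
    and F: "\<And>t. (F has_real_derivative F' t) (at t)" and cont: "continuous_on UNIV F'"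
  shows "(\<integral>t. indicat_real (cell T N (n - 1)) t * F' t \<partial>timeM T) = F (grid T N n) - F (grid T N (n - 1))"
proof -
  have "\<exists>B. \<forall>x\<in>F' ` {0..T}. norm x \<le> B"
    using compact_imp_bounded[OF compact_continuous_image[OF continuous_on_subset[OF cont] compact_Icc], of 0 T]
    unfolding bounded_iff by simp
  then obtain B where B: "\<And>t. t \<in> {0..T} \<Longrightarrow> norm (F' t) \<le> B" by blast
  have int: "integrable (timeM T) F'"
    by (rule integrable_timeM_bounded[OF continuous_measurable_timeM[OF cont], where C=B]) (auto intro!: AE_I2 B simp del: real_norm_def)
  have ab: "grid T N (n - 1) \<le> grid T N n" by (rule grid_mono[OF T]) simp
  have "(\<integral>t. indicat_real (cell T N (n - 1)) t * F' t \<partial>timeM T)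
      = (LINT t:{grid T N (n - 1)..grid T N n}|lebesgue. F' t)"
    using set_integral_closed_cell[OF T N n int] by simp
  also have "\<dots> = integral {grid T N (n - 1)..grid T N n} F'"
    by (rule set_lebesgue_integral_eq_integral(2))
      (intro absolutely_integrable_continuous_real continuous_on_subset[OF cont]; simp)
  also have "\<dots> = F (grid T N n) - F (grid T N (n - 1))"
    by (intro integral_unique fundamental_theorem_of_calculus ab)
      (auto intro!: has_field_derivative_at_within[OF F] simp flip: has_real_derivative_iff_has_vector_derivative)
  finally show ?thesis .
qed

text \<open>Integration by parts on each cell. The boundary terms telescope, because neighbouring
  affine pieces share their value at the common grid point, and the outer ones vanish with the test
  function.\<close>

lemma affine_interpolant_weak_derivative:
  fixes w :: "nat \<Rightarrow> 'a::{real_inner,banach,second_countable_topology}"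
  assumes T: "T > 0" and N: "N \<ge> 1"
  shows "has_weak_derivative T (affine_interpolant T N w)
    (step_interpolant T N (\<lambda>n. (real N / T) *\<^sub>R (w n - w (n - 1))))"
  unfolding has_weak_derivative_def
proof (intro allI impI)
  fix \<phi> assume \<phi>: "test_function T \<phi>"
  define u where "u = affine_interpolant T N w"
  define d where "d = step_interpolant T N (\<lambda>n. (real N / T) *\<^sub>R (w n - w (n - 1)))"
  have "\<exists>C. \<forall>n\<in>{..N}. norm (w n) \<le> C"
    using finite_imp_bounded[of "w ` {..N}"] by (auto simp: bounded_iff)
  then obtain C where C: "\<And>n. n \<le> N \<Longrightarrow> norm (w n) \<le> C" by auto
  have u: "integrable (timeM T) u"
    unfolding u_def by (rule L2_integrable[OF affine_interpolant_L2(1)[OF T N C]])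
  have d: "integrable (timeM T) d" unfolding d_def by (rule L2_integrable[OF step_interpolant_L2])
  have iu: "integrable (timeM T) (\<lambda>t. deriv \<phi> t *\<^sub>R u t)"
    by (rule test_function_integrable[OF test_function_deriv[OF \<phi>] u])
  have id: "integrable (timeM T) (\<lambda>t. \<phi> t *\<^sub>R d t)" by (rule test_function_integrable[OF \<phi> d])
  have zero: "\<phi> 0 = 0" "\<phi> T = 0" using \<phi> by (auto simp: test_function_def)
  \<comment> \<open>Inner products with a vector \<open>k\<close> reduce the identity to the real
    fundamental theorem of calculus; in the end \<open>k\<close> is taken to be the vector that
    should vanish.\<close>
  have "((\<integral>t. deriv \<phi> t *\<^sub>R u t \<partial>timeM T) + (\<integral>t. \<phi> t *\<^sub>R d t \<partial>timeM T)) \<bullet> k = 0" for k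
  proof -
    define a where "a n = grid T N n" for n
    define L where "L n t = (w (n - 1) + ((t - a (n - 1)) / (T / real N)) *\<^sub>R (w n - w (n - 1))) \<bullet> k" for n t
    define G where "G n t = \<phi> t * L n t" for n t
    define G' where "G' n t = deriv \<phi> t * L n t + \<phi> t * (((real N / T) *\<^sub>R (w n - w (n - 1))) \<bullet> k)" for n t
    have L_deriv: "(L n has_real_derivative ((real N / T) *\<^sub>R (w n - w (n - 1))) \<bullet> k) (at t)" for n t
      unfolding L_def inner_add_left inner_scaleR_left using T N
      by (auto intro!: derivative_eq_intros simp: field_simps)
    have G_deriv: "(G n has_real_derivative G' n t) (at t)" for n t
      unfolding G_def G'_def using smooth_DERIV[OF test_function_smooth[OF \<phi>]]
      by (auto intro!: derivative_eq_intros L_deriv)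
    have G_cont: "continuous_on UNIV (G' n)" for n
      unfolding G'_def L_def
      by (intro continuous_intros test_function_continuous[OF \<phi>] test_function_continuous[OF test_function_deriv[OF \<phi>]])
        (use T N in auto)
    have iuk: "integrable (timeM T) (\<lambda>t. (deriv \<phi> t *\<^sub>R u t + \<phi> t *\<^sub>R d t) \<bullet> k)" using iu id by simp
    have "((\<integral>t. deriv \<phi> t *\<^sub>R u t \<partial>timeM T) + (\<integral>t. \<phi> t *\<^sub>R d t \<partial>timeM T)) \<bullet> k
        = (\<integral>t. (deriv \<phi> t *\<^sub>R u t + \<phi> t *\<^sub>R d t) \<bullet> k \<partial>timeM T)"
      using iu id by simp
    also have "\<dots> = (\<Sum>n=1..N. \<integral>t. indicat_real (cell T N (n - 1)) t *\<^sub>R ((deriv \<phi> t *\<^sub>R u t + \<phi> t *\<^sub>R d t) \<bullet> k) \<partial>timeM T)"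
      by (rule integral_cell_decomposition[OF T N iuk])
    also have "\<dots> = (\<Sum>n=1..N. \<integral>t. indicat_real (cell T N (n - 1)) t * G' n t \<partial>timeM T)"
    proof (intro sum.cong refl Bochner_Integration.integral_cong)
      fix n t assume n: "n \<in> {1..N}" and "t \<in> space (timeM T)"
      then have t: "0 \<le> t" "t < T" by auto
      show "indicat_real (cell T N (n - 1)) t *\<^sub>R ((deriv \<phi> t *\<^sub>R u t + \<phi> t *\<^sub>R d t) \<bullet> k)
          = indicat_real (cell T N (n - 1)) t * G' n t"
      proof (cases "t \<in> cell T N (n - 1)")
        case True
        then have i: "cell_index T N t = n - 1" using mem_cell_iff[OF T N t(1)] by simp
        have "u t \<bullet> k = L n t"
          unfolding u_def affine_interpolant_eq(1)[OF T N t] i L_def a_def using n by simp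
        moreover have "d t = (real N / T) *\<^sub>R (w n - w (n - 1))"
          unfolding d_def by (rule step_interpolant_cell[OF T N n t True])
        ultimately show ?thesis by (simp add: inner_add_left G'_def)
      qed simp
    qed
    also have "\<dots> = (\<Sum>n=1..N. G n (grid T N n) - G n (grid T N (n - 1)))"
      by (intro sum.cong refl cell_integral_FTC[OF T N _ G_deriv G_cont])
    also have "\<dots> = (\<Sum>n=1..N. \<phi> (a n) * (w n \<bullet> k) - \<phi> (a (n - 1)) * (w (n - 1) \<bullet> k))"
    proof (intro sum.cong refl)
      fix n assume n: "n \<in> {1..N}"
      have "(a n - a (n - 1)) / (T / real N) = 1"
        using grid_simps(3)[of T N "n - 1"] n T N by (simp add: a_def)
      then show "G n (grid T N n) - G n (grid T N (n - 1)) = \<phi> (a n) * (w n \<bullet> k) - \<phi> (a (n - 1)) * (w (n - 1) \<bullet> k)"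
        by (simp add: G_def L_def a_def)
    qed
    also have "\<dots> = \<phi> (a N) * (w N \<bullet> k) - \<phi> (a 0) * (w 0 \<bullet> k)"
      using sum_telescope''[of 0 N "\<lambda>n. \<phi> (a n) * (w n \<bullet> k)"] by simp
    also have "\<dots> = 0" using zero grid_simps(1,2)[OF N, of T] by (simp add: a_def)
    finally show ?thesis .
  qed
  from this[of "(\<integral>t. deriv \<phi> t *\<^sub>R u t \<partial>timeM T) + (\<integral>t. \<phi> t *\<^sub>R d t \<partial>timeM T)"]
  show "(\<integral>t. deriv \<phi> t *\<^sub>R affine_interpolant T N w t \<partial>timeM T)
      = - (\<integral>t. \<phi> t *\<^sub>R step_interpolant T N (\<lambda>n. (real N / T) *\<^sub>R (w n - w (n - 1))) t \<partial>timeM T)"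
    unfolding inner_eq_zero_iff u_def d_def by (simp add: eq_neg_iff_add_eq_0)
qed

lemma linear_interpolants:
  assumes "linear g"
  shows "g (step_interpolant T N w t) = step_interpolant T N (\<lambda>n. g (w n)) t"
    "g (affine_interpolant T N w t) = affine_interpolant T N (\<lambda>n. g (w n)) t"
  unfolding step_interpolant_def affine_interpolant_def using assms
  by (simp_all add: linear_sum linear_scale linear_add linear_diff)

text \<open>The step function \<open>\<psi>\<close> that samples \<open>\<phi>\<close> at the right
  grid points integrates to 0 against \<open>gN - g\<close>, as both have the same integral over
  each cell. The rest is controlled by uniform continuity of \<open>\<phi>\<close> and an L1 bound
  on \<open>gN - g\<close>.\<close>

lemma step_cell_mean_test_limit:
  fixes g :: "real \<Rightarrow> 'a::{real_inner,banach,second_countable_topology}"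
  assumes T: "T > 0" and g: "g \<in> L2 T" and \<phi>: "test_function T \<phi>"
    and r: "strict_mono r" "\<And>k. r k \<ge> 1"
  shows "(\<lambda>k. \<integral>t. \<phi> t *\<^sub>R step_interpolant T (r k) (cell_mean T (r k) g) t \<partial>timeM T)
    \<longlonglongrightarrow> (\<integral>t. \<phi> t *\<^sub>R g t \<partial>timeM T)"
proof (rule LIMSEQ_I)
  fix e :: real assume e: "e > 0"
  \<comment> \<open>\<open>M - 1\<close> bounds the L1 norm of \<open>gN - g\<close>; the added 1
    makes \<open>M\<close> positive and the final estimate strict.\<close>
  define M where "M = sqrt T * (2 * L2_norm T g) + 1"
  have M: "M > 0" using T L2_norm_nonneg[of T g] by (simp add: M_def add_nonneg_pos)
  have "uniformly_continuous_on {0..T} \<phi>"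
    by (rule compact_uniformly_continuous[OF continuous_on_subset[OF test_function_continuous[OF \<phi>]]]) auto
  then obtain d where d: "d > 0" "\<And>s t. s \<in> {0..T} \<Longrightarrow> t \<in> {0..T} \<Longrightarrow> dist s t < d \<Longrightarrow> dist (\<phi> s) (\<phi> t) < e / M"
    using e M unfolding uniformly_continuous_on_def by (metis divide_pos_pos)
  obtain N0 :: nat where N0: "T / d < N0" using reals_Archimedean2 by blast
  have "norm ((\<integral>t. \<phi> t *\<^sub>R step_interpolant T N (cell_mean T N g) t \<partial>timeM T) - (\<integral>t. \<phi> t *\<^sub>R g t \<partial>timeM T)) < e"
    if N: "N \<ge> 1" "N \<ge> N0" for N
  proof -
    define gN where "gN = step_interpolant T N (cell_mean T N g)"
    define \<psi> where "\<psi> = step_interpolant T N (\<lambda>n. \<phi> (grid T N n))"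
    have "T / d < N" using N0 N(2) by linarith
    then have h: "T / N < d" using T d(1) N(1) by (simp add: field_simps)
    have gN: "gN \<in> L2 T" unfolding gN_def by (rule step_interpolant_L2)
    have diff: "(\<lambda>t. gN t - g t) \<in> L2 T" by (rule L2_diff[OF gN g])
    have "(L2_norm T gN)\<^sup>2 \<le> (L2_norm T g)\<^sup>2"
      using cell_mean_sq_le[OF T N(1) g] by (simp add: gN_def L2_norm_step_interpolant[OF T N(1)])
    then have "L2_norm T gN \<le> L2_norm T g" by (rule power2_le_imp_le) (rule L2_norm_nonneg)
    then have "L2_norm T (\<lambda>t. gN t - g t) \<le> 2 * L2_norm T g"
      using L2_norm_triangle[OF gN L2_scaleR[OF g, of "-1"]] L2_norm_scaleR[of T "-1" g] by simp
    then have L1: "(\<integral>t. norm (gN t - g t) \<partial>timeM T) \<le> M - 1"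
      using L1_norm_le_L2_norm[OF diff T] T unfolding M_def
      by (smt (verit) mult_left_mono real_sqrt_ge_0_iff)
    have i\<phi>: "integrable (timeM T) (\<lambda>t. \<phi> t *\<^sub>R (gN t - g t))"
      by (rule test_function_integrable[OF \<phi> L2_integrable[OF diff]])
    have i\<psi>: "integrable (timeM T) (\<lambda>t. \<psi> t *\<^sub>R (gN t - g t))"
      unfolding \<psi>_def by (rule L2_bilinear_integrable[OF bounded_bilinear_scaleR step_interpolant_L2 diff])
    have "(\<integral>t. \<psi> t *\<^sub>R (gN t - g t) \<partial>timeM T) = (\<Sum>n=1..N. \<integral>t. indicat_real (cell T N (n - 1)) t *\<^sub>R
        (\<phi> (grid T N n) *\<^sub>R (gN t - g t)) \<partial>timeM T)"
      unfolding \<psi>_def by (rule step_interpolant_integral[OF T N(1), where G="\<lambda>t x. x *\<^sub>R (gN t - g t)"])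
        (use i\<psi> in \<open>simp add: \<psi>_def\<close>)
    also have "\<dots> = (\<Sum>n=1..N. 0)"
    proof (intro sum.cong refl)
      fix n assume n: "n \<in> {1..N}"
      have "(\<integral>t. indicat_real (cell T N (n - 1)) t *\<^sub>R gN t \<partial>timeM T)
          = (\<integral>t. indicat_real (cell T N (n - 1)) t *\<^sub>R cell_mean T N g n \<partial>timeM T)"
      proof (intro Bochner_Integration.integral_cong refl)
        fix t assume "t \<in> space (timeM T)"
        then have t: "0 \<le> t" "t < T" by auto
        show "indicat_real (cell T N (n - 1)) t *\<^sub>R gN t = indicat_real (cell T N (n - 1)) t *\<^sub>R cell_mean T N g n"
          unfolding gN_def using step_interpolant_cell[OF T N(1) n t] by (cases "t \<in> cell T N (n - 1)") auto
      qed
      also have "\<dots> = (T / N) *\<^sub>R cell_mean T N g n"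
        using measure_cell[OF T N(1) n] cell_integrable[of T "\<lambda>_. 1::real" N "n - 1"]
        by (subst integral_scaleR_left) (auto simp: integrable_timeM_bounded[of "\<lambda>_. 1::real" T 1])
      also have "\<dots> = (\<integral>t. indicat_real (cell T N (n - 1)) t *\<^sub>R g t \<partial>timeM T)"
        unfolding cell_mean_eq[OF T N(1) n L2_integrable[OF g]] using T N by simp
      finally have "(\<integral>t. indicat_real (cell T N (n - 1)) t *\<^sub>R (gN t - g t) \<partial>timeM T) = 0"
        using cell_integrable[OF L2_integrable[OF gN]] cell_integrable[OF L2_integrable[OF g]]
        by (simp add: scaleR_diff_right)
      then show "(\<integral>t. indicat_real (cell T N (n - 1)) t *\<^sub>R (\<phi> (grid T N n) *\<^sub>R (gN t - g t)) \<partial>timeM T) = 0"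
        by (simp only: scaleR_left_commute[of "indicat_real _ _"] integral_scaleR_right scaleR_zero_right)
    qed
    finally have \<psi>0: "(\<integral>t. \<psi> t *\<^sub>R (gN t - g t) \<partial>timeM T) = 0" by simp
    have "(\<integral>t. \<phi> t *\<^sub>R gN t \<partial>timeM T) - (\<integral>t. \<phi> t *\<^sub>R g t \<partial>timeM T) = (\<integral>t. \<phi> t *\<^sub>R (gN t - g t) \<partial>timeM T)"
      using test_function_integrable[OF \<phi> L2_integrable[OF gN]] test_function_integrable[OF \<phi> L2_integrable[OF g]]
      by (simp add: scaleR_diff_right)
    also have "\<dots> = (\<integral>t. (\<phi> t - \<psi> t) *\<^sub>R (gN t - g t) \<partial>timeM T)"
      using i\<phi> i\<psi> \<psi>0 by (simp add: scaleR_diff_left)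
    also have "norm \<dots> \<le> (\<integral>t. norm ((\<phi> t - \<psi> t) *\<^sub>R (gN t - g t)) \<partial>timeM T)" by (rule integral_norm_bound)
    also have "\<dots> \<le> (\<integral>t. (e / M) * norm (gN t - g t) \<partial>timeM T)"
    proof (rule integral_mono)
      show "integrable (timeM T) (\<lambda>t. norm ((\<phi> t - \<psi> t) *\<^sub>R (gN t - g t)))"
        using Bochner_Integration.integrable_diff[OF i\<phi> i\<psi>] by (intro integrable_norm) (simp add: scaleR_diff_left)
      show "integrable (timeM T) (\<lambda>t. (e / M) * norm (gN t - g t))" using integrable_norm[OF L2_integrable[OF diff]] by simp
      fix t assume "t \<in> space (timeM T)"
      then have t: "0 \<le> t" "t < T" by auto
      let ?i = "cell_index T N t"
      have i: "?i < N" by (rule cell_index_bounds(3)[OF T N(1) t])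
      have "dist t (grid T N (Suc ?i)) < d"
        using cell_index_bounds(1,2)[OF T N(1) t(1)] grid_simps(3)[of T N ?i] h by (auto simp: dist_real_def)
      then have "dist (\<phi> t) (\<phi> (grid T N (Suc ?i))) < e / M"
        using t grid_bounds[OF T N(1), of "Suc ?i"] i by (intro d(2)) auto
      then have "\<bar>\<phi> t - \<psi> t\<bar> \<le> e / M"
        unfolding \<psi>_def step_interpolant_eq[OF T N(1) t] by (simp add: dist_real_def)
      then show "norm ((\<phi> t - \<psi> t) *\<^sub>R (gN t - g t)) \<le> (e / M) * norm (gN t - g t)"
        using mult_right_mono[OF _ norm_ge_zero] by (simp only: norm_scaleR)
    qed
    also have "\<dots> \<le> (e / M) * (M - 1)"
      using mult_left_mono[OF L1, of "e / M"] e M by simp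
    also have "\<dots> < e" using e M by (simp add: field_simps)
    finally show ?thesis unfolding gN_def .
  qed
  moreover have "r k \<ge> N0" if "k \<ge> N0" for k using seq_suble[OF r(1), of k] that by simp
  ultimately show "\<exists>no. \<forall>n\<ge>no. norm ((\<integral>t. \<phi> t *\<^sub>R step_interpolant T (r n) (cell_mean T (r n) g) t \<partial>timeM T)
      - (\<integral>t. \<phi> t *\<^sub>R g t \<partial>timeM T)) < e" using r(2) by blast
qed

section \<open>Compactness\<close>

text \<open>Arzela-Ascoli, with an error \<open>e n\<close> in the modulus of continuity that allows for step functions.\<close>

lemma pointwise_convergent_subsequence:
  fixes g :: "nat \<Rightarrow> real \<Rightarrow> 'h::{real_normed_vector,banach}"
  assumes T: "T > 0" and S: "compact S" and gS: "\<And>n t. t \<in> {0..T} \<Longrightarrow> g n t \<in> S"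
    and C: "C \<ge> 0" and e: "e \<longlonglongrightarrow> 0" "\<And>n. 0 \<le> e n"
    and modulus: "\<And>n s t. s \<in> {0..T} \<Longrightarrow> t \<in> {0..T} \<Longrightarrow> norm (g n s - g n t) \<le> C * sqrt (\<bar>s - t\<bar> + e n)"
  obtains r c where "strict_mono (r :: nat \<Rightarrow> nat)" "\<And>t. t \<in> {0..T} \<Longrightarrow> (\<lambda>k. g (r k) t) \<longlonglongrightarrow> c t"
    "continuous_on {0..T} c"
proof -
  \<comment> \<open>Rational times are countable and dense: a diagonal subsequence converges at all
    of them, and the common modulus extends convergence to every time.\<close>
  define D where "D = \<rat> \<inter> {0..T}"
  have D: "countable D" "D \<noteq> {}" unfolding D_def using T by (auto intro: countable_rat)
  define q where "q = from_nat_into D"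
  have q: "range q = D" unfolding q_def by (rule range_from_nat_into[OF D(2,1)])
  interpret subseqs "\<lambda>n s. convergent (\<lambda>k. g (s k) (q n))"
  proof
    fix n and s :: "nat \<Rightarrow> nat"
    have "q n \<in> {0..T}" using q by (auto simp: D_def)
    then obtain l r where "strict_mono (r :: nat \<Rightarrow> nat)" "((\<lambda>k. g (s k) (q n)) \<circ> r) \<longlonglongrightarrow> l"
      using S gS unfolding compact_def by metis
    then show "\<exists>r'. strict_mono r' \<and> convergent (\<lambda>k. g ((s \<circ> r') k) (q n))"
      by (auto simp: convergent_def o_def)
  qed
  define r where "r = diagseq"
  have r: "strict_mono r" unfolding r_def by (rule subseq_diagseq)
  have conv_D: "convergent (\<lambda>k. g (r k) x)" if "x \<in> D" for x
  proof -
    obtain n where n: "x = q n" using q \<open>x \<in> D\<close> by auto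
    have "convergent (\<lambda>k. g ((diagseq \<circ> (+) (Suc n)) k) (q n))"
    proof (rule diagseq_holds)
      fix r' s :: "nat \<Rightarrow> nat" and m
      assume "strict_mono r'" "convergent (\<lambda>k. g (s k) (q m))"
      then show "convergent (\<lambda>k. g ((s \<circ> r') k) (q m))"
        using convergent_subseq_convergent[of "\<lambda>k. g (s k) (q m)" r'] by (simp add: o_def)
    qed
    then have "convergent (\<lambda>k. g (r (k + Suc n)) x)" by (simp add: r_def n o_def add.commute)
    then show ?thesis using convergent_ignore_initial_segment[of "\<lambda>k. g (r k) x" "Suc n"] by simp
  qed
  have er: "(\<lambda>k. e (r k)) \<longlonglongrightarrow> 0" using LIMSEQ_subseq_LIMSEQ[OF e(1) r] by (simp add: o_def)
  have conv: "convergent (\<lambda>k. g (r k) t)" if t: "t \<in> {0..T}" for t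
  proof -
    have "Cauchy (\<lambda>k. g (r k) t)"
    proof (rule CauchyI)
      fix \<epsilon> :: real assume \<epsilon>: "\<epsilon> > 0"
      \<comment> \<open>Makes \<open>C * sqrt (2 * \<delta>)\<close> less than
        \<open>\<epsilon> / 3\<close>, with one \<open>\<delta>\<close> for the distance to a
        rational time and one for the error \<open>e\<close>. Using \<open>C + 1\<close> avoids a
        division by 0.\<close>
      define \<delta> where "\<delta> = (\<epsilon> / (3 * (C + 1)))\<^sup>2 / 2"
      have \<delta>: "\<delta> > 0" using \<epsilon> C by (simp add: \<delta>_def)
      have small: "C * sqrt (2 * \<delta>) < \<epsilon> / 3"
      proof -
        have "sqrt (2 * \<delta>) = \<epsilon> / (3 * (C + 1))" using \<epsilon> C by (simp add: \<delta>_def)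
        moreover have "C * (\<epsilon> / (3 * (C + 1))) < \<epsilon> / 3" using \<epsilon> C by (simp add: field_simps)
        ultimately show ?thesis by simp
      qed
      obtain x where x: "x \<in> \<rat>" "max 0 (t - \<delta>) < x" "x < min T (t + \<delta>)"
        using Rats_dense_in_real[of "max 0 (t - \<delta>)" "min T (t + \<delta>)"] t T \<delta> by auto
      have xD: "x \<in> D" "x \<in> {0..T}" using x by (auto simp: D_def)
      have xt: "\<bar>t - x\<bar> \<le> \<delta>" using x by auto
      obtain k1 where k1: "\<And>j k. j \<ge> k1 \<Longrightarrow> k \<ge> k1 \<Longrightarrow> norm (g (r j) x - g (r k) x) < \<epsilon> / 3"
        using convergent_Cauchy[OF conv_D[OF xD(1)]] \<epsilon> unfolding Cauchy_iff by (metis zero_less_divide_iff zero_less_numeral)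
      obtain k2 where k2: "\<And>k. k \<ge> k2 \<Longrightarrow> e (r k) < \<delta>"
        using order_tendstoD(2)[OF er \<delta>] by (auto simp: eventually_sequentially)
      have near: "norm (g (r k) t - g (r k) x) < \<epsilon> / 3" if "k \<ge> k2" for k
      proof -
        have "norm (g (r k) t - g (r k) x) \<le> C * sqrt (\<bar>t - x\<bar> + e (r k))" by (rule modulus[OF t xD(2)])
        also have "\<dots> \<le> C * sqrt (2 * \<delta>)"
          using xt k2[OF that] C by (intro mult_left_mono) auto
        finally show ?thesis using small by simp
      qed
      have "norm (g (r j) t - g (r k) t) < \<epsilon>" if "j \<ge> max k1 k2" "k \<ge> max k1 k2" for j k
      proof -
        have "norm (g (r j) t - g (r k) t)
            \<le> norm (g (r j) t - g (r j) x) + norm (g (r j) x - g (r k) x) + norm (g (r k) x - g (r k) t)"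
          by norm
        then show ?thesis using near[of j] near[of k] k1[of j k] that by (simp add: norm_minus_commute)
      qed
      then show "\<exists>M. \<forall>m\<ge>M. \<forall>n\<ge>M. norm (g (r m) t - g (r n) t) < \<epsilon>" by blast
    qed
    then show ?thesis by (rule Cauchy_convergent)
  qed
  define c where "c t = lim (\<lambda>k. g (r k) t)" for t
  have lim: "(\<lambda>k. g (r k) t) \<longlonglongrightarrow> c t" if "t \<in> {0..T}" for t
    using conv[OF that] by (simp add: c_def convergent_LIMSEQ_iff)
  have c_mod: "norm (c s - c t) \<le> C * sqrt \<bar>s - t\<bar>" if st: "s \<in> {0..T}" "t \<in> {0..T}" for s t
  proof (rule LIMSEQ_le)
    show "(\<lambda>k. norm (g (r k) s - g (r k) t)) \<longlonglongrightarrow> norm (c s - c t)" by (intro tendsto_intros lim st)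
    have "(\<lambda>k. C * sqrt (\<bar>s - t\<bar> + e (r k))) \<longlonglongrightarrow> C * sqrt (\<bar>s - t\<bar> + 0)" by (intro tendsto_intros er)
    then show "(\<lambda>k. C * sqrt (\<bar>s - t\<bar> + e (r k))) \<longlonglongrightarrow> C * sqrt \<bar>s - t\<bar>" by simp
  qed (use modulus[OF st] in auto)
  have "continuous_on {0..T} c"
    unfolding continuous_on_def
  proof
    fix t assume t: "t \<in> {0..T}"
    have "((\<lambda>s. C * sqrt \<bar>s - t\<bar>) \<longlongrightarrow> C * sqrt \<bar>t - t\<bar>) (at t within {0..T})" by (intro tendsto_intros)
    then have z: "((\<lambda>s. C * sqrt \<bar>s - t\<bar>) \<longlongrightarrow> 0) (at t within {0..T})" by simp
    have "((\<lambda>s. c s - c t) \<longlongrightarrow> 0) (at t within {0..T})"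
      by (rule Lim_null_comparison[OF _ z]) (use c_mod[OF _ t] in \<open>auto simp: eventually_at_filter\<close>)
    then show "(c \<longlongrightarrow> c t) (at t within {0..T})" by (simp add: LIM_zero_iff)
  qed
  then show ?thesis using that r lim by blast
qed

section \<open>Limits of midpoint sequences\<close>

lemma midpoint_hull_pointwise_bound:
  fixes g :: "'a::real_vector \<Rightarrow> 'b::real_normed_vector"
  assumes "linear g" "\<And>u. u \<in> U \<Longrightarrow> norm (g (u t) - y) \<le> e" "w \<in> midpoint_hull pointwise_mid U"
  shows "norm (g (w t) - y) \<le> e"
  using assms(3)
proof induction
  case (mid u w)
  have "g (pointwise_mid u w t) - y = (1/2) *\<^sub>R ((g (u t) - y) + (g (w t) - y))"
    using assms(1) by (simp add: pointwise_mid_def linear_add linear_scale algebra_simps flip: scaleR_add_left)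
  then have "norm (g (pointwise_mid u w t) - y) \<le> (1/2) * (norm (g (u t) - y) + norm (g (w t) - y))"
    using norm_triangle_ineq[of "g (u t) - y" "g (w t) - y"] by simp
  then show ?case using mid by simp
qed (use assms(2) in auto)

text \<open>Balls are stable under midpoints, and \<open>w k\<close> is built from members of index
  at least \<open>k\<close>; so pointwise limits are inherited by every Mazur sequence.\<close>

lemma midpoint_hull_tendsto:
  fixes g :: "'a::real_vector \<Rightarrow> 'b::real_normed_vector"
  assumes g: "linear g" and u: "(\<lambda>k. g (u k t)) \<longlonglongrightarrow> y"
    and w: "\<And>k. w k \<in> midpoint_hull pointwise_mid (u ` {k..})"
  shows "(\<lambda>k. g (w k t)) \<longlonglongrightarrow> y"
proof (rule LIMSEQ_I)
  fix e :: real assume "e > 0"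
  then obtain k0 where k0: "\<And>k. k \<ge> k0 \<Longrightarrow> norm (g (u k t) - y) < e / 2"
    using LIMSEQ_D[OF u, of "e / 2"] by auto
  have "norm (g (w k t) - y) < e" if "k \<ge> k0" for k
  proof -
    have "norm (g (w k t) - y) \<le> e / 2"
      by (rule midpoint_hull_pointwise_bound[OF g _ w[of k]]) (use k0 that in \<open>force intro: less_imp_le\<close>)
    then show ?thesis using \<open>e > 0\<close> by simp
  qed
  then show "\<exists>no. \<forall>n\<ge>no. norm (g (w n t) - y) < e" by blast
qed

lemma midpoint_hull_subset:
  assumes "\<And>u. u \<in> U \<Longrightarrow> u \<in> S" "\<And>u w. u \<in> S \<Longrightarrow> w \<in> S \<Longrightarrow> mid u w \<in> S" "w \<in> midpoint_hull mid U"
  shows "w \<in> S"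
  using assms(3) by induction (use assms(1,2) in auto)

lemma L2_pointwise_mid: "u \<in> L2 T \<Longrightarrow> w \<in> L2 T \<Longrightarrow> pointwise_mid u w \<in> L2 T"
  unfolding pointwise_mid_def[abs_def] by (intro L2_scaleR L2_add)

lemma less_of_sq_less: "x\<^sup>2 < e\<^sup>2 \<Longrightarrow> 0 < e \<Longrightarrow> x < (e::real)"
  using power2_less_imp_less[of x e] by simp

lemma L2_norm_diff_AE_eq:
  assumes "w \<in> L2 T" "u \<in> L2 T" "z \<in> L2 T" "AE t in timeM T. u t = z t"
  shows "L2_norm T (\<lambda>t. w t - u t) = L2_norm T (\<lambda>t. w t - z t)"
  by (rule L2_norm_cong_AE)
    (use L2_diff[OF assms(1,2)] L2_diff[OF assms(1,3)] assms(4) in \<open>auto intro: L2_measurable elim: eventually_mono\<close>)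

text \<open>For the squared L2 norm the defect supplied by \<open>Mazur_midpoints\<close> is exactly
  the squared distance.\<close>

lemma L2_mid_Cauchy:
  fixes w :: "nat \<Rightarrow> real \<Rightarrow> 'a::{real_inner,banach,second_countable_topology}"
  assumes w: "\<And>k. w k \<in> L2 T"
    and mid: "\<And>e. e > 0 \<Longrightarrow> \<exists>k0. \<forall>j\<ge>k0. \<forall>k\<ge>k0. 2 * (L2_norm T (w j))\<^sup>2 + 2 * (L2_norm T (w k))\<^sup>2
      - 4 * (L2_norm T (pointwise_mid (w j) (w k)))\<^sup>2 < e"
    and e: "e > 0"
  shows "\<exists>n0. \<forall>j\<ge>n0. \<forall>k\<ge>n0. L2_norm T (\<lambda>t. w j t - w k t) < e"
proof -
  obtain k0 where k0: "\<And>j k. j \<ge> k0 \<Longrightarrow> k \<ge> k0 \<Longrightarrow> 2 * (L2_norm T (w j))\<^sup>2 + 2 * (L2_norm T (w k))\<^sup>2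
      - 4 * (L2_norm T (pointwise_mid (w j) (w k)))\<^sup>2 < e\<^sup>2"
    using mid[of "e\<^sup>2"] e by auto
  have "L2_norm T (\<lambda>t. w j t - w k t) < e" if "j \<ge> k0" "k \<ge> k0" for j k
    by (rule less_of_sq_less[OF _ e])
      (use k0[OF that] L2_parallelogram[OF w[of j] w[of k]] in \<open>simp add: pointwise_mid_def[abs_def]\<close>)
  then show ?thesis by blast
qed

lemma L2_parallelogram_nonneg:
  fixes u w :: "real \<Rightarrow> 'a::{real_inner,banach,second_countable_topology}"
  assumes "u \<in> L2 T" "w \<in> L2 T"
  shows "0 \<le> 2 * (L2_norm T u)\<^sup>2 + 2 * (L2_norm T w)\<^sup>2 - 4 * (L2_norm T (pointwise_mid u w))\<^sup>2"
  using L2_parallelogram[OF assms] by (simp add: pointwise_mid_def[abs_def])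

context gelfand_order
begin

lemma L2_\<iota>: "u \<in> L2 T \<Longrightarrow> \<iota> \<circ> u \<in> L2 T"
  using L2_linear[OF bounded_linear_\<iota>, of u T] by (simp add: o_def)

lemma L2_norm_\<iota>:
  assumes y: "y \<in> L2 T" and B: "B \<ge> 0" "\<And>x. norm (\<iota> x) \<le> norm x * B"
  shows "L2_norm T (\<iota> \<circ> y) \<le> B * L2_norm T y"
proof (rule power2_le_imp_le)
  have "(\<integral>t. (norm ((\<iota> \<circ> y) t))\<^sup>2 \<partial>timeM T) \<le> (\<integral>t. B\<^sup>2 * (norm (y t))\<^sup>2 \<partial>timeM T)"
  proof (rule integral_mono)
    show "integrable (timeM T) (\<lambda>t. (norm ((\<iota> \<circ> y) t))\<^sup>2)" by (rule L2_integrable_sq[OF L2_\<iota>[OF y]])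
    show "integrable (timeM T) (\<lambda>t. B\<^sup>2 * (norm (y t))\<^sup>2)" using L2_integrable_sq[OF y] by simp
    show "(norm ((\<iota> \<circ> y) t))\<^sup>2 \<le> B\<^sup>2 * (norm (y t))\<^sup>2" for t
      using power_mono[OF B(2) norm_ge_zero, of "y t" 2] by (simp add: power_mult_distrib mult.commute)
  qed
  then show "(L2_norm T (\<iota> \<circ> y))\<^sup>2 \<le> (B * L2_norm T y)\<^sup>2" by (simp add: L2_norm_sq power_mult_distrib)
qed (simp add: B(1) L2_norm_nonneg)

text \<open>The limit is identified through its image in \<open>H\<close>, which suffices because \<open>\<iota>\<close> is injective.\<close>

lemma L2_V_Cauchy_limit:
  assumes T: "T > 0" and w: "\<And>k. w k \<in> L2 T"
    and Cauchy: "\<And>e. e > 0 \<Longrightarrow> \<exists>n0. \<forall>j\<ge>n0. \<forall>k\<ge>n0. L2_norm T (\<lambda>t. w j t - w k t) < e"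
    and lim: "\<And>t. 0 < t \<Longrightarrow> t < T \<Longrightarrow> (\<lambda>k. \<iota> (w k t)) \<longlonglongrightarrow> c t"
  obtains u where "u \<in> L2 T" "AE t in timeM T. \<iota> (u t) = c t" "(\<lambda>k. L2_norm T (\<lambda>t. w k t - u t)) \<longlonglongrightarrow> 0"
proof -
  obtain u s where u: "u \<in> L2 T" "(\<lambda>k. L2_norm T (\<lambda>t. w k t - u t)) \<longlonglongrightarrow> 0"
    and s: "strict_mono s" "AE t in timeM T. (\<lambda>k. w (s k) t) \<longlonglongrightarrow> u t"
    using L2_complete[OF T w Cauchy] by blast
  have "AE t in timeM T. \<iota> (u t) = c t"
    using s(2) AE_space[of "timeM T"]
  proof eventually_elim
    case (elim t)
    have "(\<lambda>k. \<iota> (w (s k) t)) \<longlonglongrightarrow> c t"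
      using LIMSEQ_subseq_LIMSEQ[OF lim s(1), of t] elim(2) by (simp add: o_def)
    moreover have "(\<lambda>k. \<iota> (w (s k) t)) \<longlonglongrightarrow> \<iota> (u t)" by (rule \<iota>.tendsto[OF elim(1)])
    ultimately show ?case using LIMSEQ_unique by blast
  qed
  then show ?thesis using that u by blast
qed

lemma AE_eq_of_\<iota>_AE_eq:
  assumes "AE t in timeM T. \<iota> (u t) = c t" "AE t in timeM T. \<iota> (z t) = c t"
  shows "AE t in timeM T. u t = z t"
  using assms by eventually_elim (simp flip: inj_\<iota>)

text \<open>One Mazur sequence produces \<open>z\<close>. Every other one has the same pointwise
  limit \<open>c\<close> in H and therefore the same limit in L2(0,T;V), which yields weak
  convergence of all of \<open>u\<close> without a further subsequence.\<close>

lemma L2_V_limit_exists: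
  assumes T: "T > 0" and u: "\<And>k. u k \<in> L2 T" and bound: "\<And>k. L2_norm T (u k) \<le> B"
    and lim: "\<And>t. 0 < t \<Longrightarrow> t < T \<Longrightarrow> (\<lambda>k. \<iota> (u k t)) \<longlonglongrightarrow> c t"
  obtains z where "z \<in> L2 T" "AE t in timeM T. \<iota> (z t) = c t"
    "converges_weakly (L2 T) (L2_norm T) u z"
proof -
  define Q where "Q u = (L2_norm T u)\<^sup>2" for u :: "real \<Rightarrow> 'v"
  have Q: "\<And>x. 0 \<le> Q x" "\<And>n. Q (u n) \<le> B\<^sup>2"
    unfolding Q_def using bound L2_norm_nonneg by (auto intro: power_mono)
  have limit: "\<exists>v. v \<in> L2 T \<and> (AE t in timeM T. \<iota> (v t) = c t) \<and> (\<forall>k. w k \<in> L2 T) \<and>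
      (\<lambda>k. L2_norm T (\<lambda>t. w k t - v t)) \<longlonglongrightarrow> 0"
    if hull: "\<And>k. w k \<in> midpoint_hull pointwise_mid (u ` {k..})"
      and mid: "\<And>e. e > 0 \<Longrightarrow> \<exists>k0. \<forall>j\<ge>k0. \<forall>k\<ge>k0. 2 * Q (w j) + 2 * Q (w k) - 4 * Q (pointwise_mid (w j) (w k)) < e"
    for w
  proof -
    have w: "w k \<in> L2 T" for k
      by (rule midpoint_hull_subset[OF _ L2_pointwise_mid hull]) (use u in auto)
    have "(\<lambda>k. \<iota> (w k t)) \<longlonglongrightarrow> c t" if "0 < t" "t < T" for t
      by (rule midpoint_hull_tendsto[OF \<iota>.linear lim[OF that] hull])
    from L2_V_Cauchy_limit[OF T w L2_mid_Cauchy[OF w mid[unfolded Q_def]] this]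
    show ?thesis using w by blast
  qed
  obtain w where "\<And>k. w k \<in> midpoint_hull pointwise_mid (u ` {k..})"
    "\<And>e. e > 0 \<Longrightarrow> \<exists>k0. \<forall>j\<ge>k0. \<forall>k\<ge>k0. 2 * Q (w j) + 2 * Q (w k) - 4 * Q (pointwise_mid (w j) (w k)) < e"
    using Mazur_midpoints[where u=u and Q=Q and mid=pointwise_mid, OF Q] by blast
  from limit[OF this] obtain z where z: "z \<in> L2 T" "AE t in timeM T. \<iota> (z t) = c t" by blast
  have "converges_weakly (L2 T) (L2_norm T) u z"
  proof (rule converges_weaklyI_Mazur[where Q=Q and B="B\<^sup>2"])
    fix w assume "\<And>k. w k \<in> midpoint_hull pointwise_mid (u ` {k..})"
      "\<And>e. e > 0 \<Longrightarrow> \<exists>k0. \<forall>j\<ge>k0. \<forall>k\<ge>k0. 2 * Q (w j) + 2 * Q (w k) - 4 * Q (pointwise_mid (w j) (w k)) < e"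
    from limit[OF this] obtain v where v: "v \<in> L2 T" "AE t in timeM T. \<iota> (v t) = c t" "\<And>k. w k \<in> L2 T"
      "(\<lambda>k. L2_norm T (\<lambda>t. w k t - v t)) \<longlonglongrightarrow> 0" by blast
    have "L2_norm T (\<lambda>t. w k t - v t) = L2_norm T (\<lambda>t. w k t - z t)" for k
      by (rule L2_norm_diff_AE_eq[OF v(3,1) z(1) AE_eq_of_\<iota>_AE_eq[OF v(2) z(2)]])
    then show "(\<lambda>k. L2_norm T (\<lambda>t. w k t - z t)) \<longlonglongrightarrow> 0" using v(4) by simp
  qed (use Q u z(1) in \<open>auto intro: L2_add L2_scaleR\<close>)
  then show ?thesis using that z by blast
qed

section \<open>Functions with values in V and weak derivative in H\<close>

lemma WsI:
  assumes "u \<in> L2 T" "u' \<in> L2 T" "has_weak_derivative T (\<iota> \<circ> u) u'"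
  shows "u \<in> Ws T \<iota>"
  using assms L2_\<iota> by (auto simp: Ws_def H1_def)

lemma Ws_L2: "u \<in> Ws T \<iota> \<Longrightarrow> u \<in> L2 T"
  by (simp add: Ws_def)

abbreviation wder :: "real \<Rightarrow> (real \<Rightarrow> 'v) \<Rightarrow> real \<Rightarrow> 'h" where
  "wder T u \<equiv> weak_derivative T (\<iota> \<circ> u)"

lemma Ws_wder:
  assumes "u \<in> Ws T \<iota>"
  shows "wder T u \<in> L2 T" "has_weak_derivative T (\<iota> \<circ> u) (wder T u)"
  using weak_derivative[of "\<iota> \<circ> u" T] assms by (auto simp: Ws_def)

text \<open>As \<open>wder\<close> is a chosen representative, its linearity holds only almost
  everywhere.\<close>

lemma Ws_lincomb:
  assumes "u \<in> Ws T \<iota>" "w \<in> Ws T \<iota>"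
  shows "(\<lambda>t. a *\<^sub>R u t + b *\<^sub>R w t) \<in> Ws T \<iota>"
    "AE t in timeM T. wder T (\<lambda>t. a *\<^sub>R u t + b *\<^sub>R w t) t = a *\<^sub>R wder T u t + b *\<^sub>R wder T w t"
proof -
  have "has_weak_derivative T (\<lambda>t. a *\<^sub>R (\<iota> \<circ> u) t + b *\<^sub>R (\<iota> \<circ> w) t) (\<lambda>t. a *\<^sub>R wder T u t + b *\<^sub>R wder T w t)"
    by (intro has_weak_derivative_lincomb Ws_wder L2_\<iota> Ws_L2 assms)
  then have wd: "has_weak_derivative T (\<iota> \<circ> (\<lambda>t. a *\<^sub>R u t + b *\<^sub>R w t)) (\<lambda>t. a *\<^sub>R wder T u t + b *\<^sub>R wder T w t)"
    by (simp add: o_def \<iota>.add \<iota>.scaleR)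
  have L: "(\<lambda>t. a *\<^sub>R u t + b *\<^sub>R w t) \<in> L2 T" "(\<lambda>t. a *\<^sub>R wder T u t + b *\<^sub>R wder T w t) \<in> L2 T"
    by (intro L2_add L2_scaleR Ws_L2 Ws_wder assms)+
  show "(\<lambda>t. a *\<^sub>R u t + b *\<^sub>R w t) \<in> Ws T \<iota>" by (rule WsI[OF L wd])
  show "AE t in timeM T. wder T (\<lambda>t. a *\<^sub>R u t + b *\<^sub>R w t) t = a *\<^sub>R wder T u t + b *\<^sub>R wder T w t"
    by (rule weak_derivative_AE[OF L2_\<iota>[OF L(1)] L(2) wd])
qed

lemma Ws_pointwise_mid:
  assumes "u \<in> Ws T \<iota>" "w \<in> Ws T \<iota>"
  shows "pointwise_mid u w \<in> Ws T \<iota>" "AE t in timeM T. wder T (pointwise_mid u w) t = pointwise_mid (wder T u) (wder T w) t"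
  using Ws_lincomb[OF assms, of "1/2" "1/2"] by (auto simp: pointwise_mid_def[abs_def] scaleR_add_right)

text \<open>Squared Hilbert norm equivalent to \<open>Ws_norm\<close>; unlike \<open>Ws_norm\<close>, it satisfies the parallelogram identity.\<close>

definition Ws_sq :: "real \<Rightarrow> (real \<Rightarrow> 'v) \<Rightarrow> real" where
  "Ws_sq T u = (L2_norm T u)\<^sup>2 + (L2_norm T (wder T u))\<^sup>2"

lemma Ws_sq_nonneg: "0 \<le> Ws_sq T u" by (simp add: Ws_sq_def)

lemma Ws_sq_parallelogram:
  assumes "u \<in> Ws T \<iota>" "w \<in> Ws T \<iota>"
  shows "2 * Ws_sq T u + 2 * Ws_sq T w - 4 * Ws_sq T (pointwise_mid u w) =
    (2 * (L2_norm T u)\<^sup>2 + 2 * (L2_norm T w)\<^sup>2 - 4 * (L2_norm T (pointwise_mid u w))\<^sup>2) +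
    (2 * (L2_norm T (wder T u))\<^sup>2 + 2 * (L2_norm T (wder T w))\<^sup>2
      - 4 * (L2_norm T (pointwise_mid (wder T u) (wder T w)))\<^sup>2)"
proof -
  have "L2_norm T (wder T (pointwise_mid u w)) = L2_norm T (pointwise_mid (wder T u) (wder T w))"
    by (rule L2_norm_cong_AE)
      (use Ws_wder[OF Ws_pointwise_mid(1)[OF assms]] Ws_pointwise_mid(2)[OF assms]
        L2_pointwise_mid[OF Ws_wder(1)[OF assms(1)] Ws_wder(1)[OF assms(2)]] in \<open>auto intro: L2_measurable\<close>)
  then show ?thesis by (simp add: Ws_sq_def)
qed

text \<open>The functions and their weak derivatives converge separately. Pointwise limits in H
  identify the first limit with \<open>z\<close>, and closedness of the weak derivative identifies
  the second with the derivative of \<open>z\<close>.\<close>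

lemma Ws_Cauchy_limit:
  assumes T: "T > 0" and w: "\<And>k. w k \<in> Ws T \<iota>"
    and mid: "\<And>e. e > 0 \<Longrightarrow> \<exists>k0. \<forall>j\<ge>k0. \<forall>k\<ge>k0. 2 * Ws_sq T (w j) + 2 * Ws_sq T (w k) - 4 * Ws_sq T (pointwise_mid (w j) (w k)) < e"
    and lim: "\<And>t. 0 < t \<Longrightarrow> t < T \<Longrightarrow> (\<lambda>k. \<iota> (w k t)) \<longlonglongrightarrow> c t"
    and z: "z \<in> L2 T" "AE t in timeM T. \<iota> (z t) = c t"
  shows "z \<in> Ws T \<iota>" "(\<lambda>k. Ws_norm T \<iota> (\<lambda>t. w k t - z t)) \<longlonglongrightarrow> 0"
proof -
  have wL: "w k \<in> L2 T" and wdL: "wder T (w k) \<in> L2 T" for k using Ws_L2 Ws_wder w by blast+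
  define D where "D u v = 2 * (L2_norm T u)\<^sup>2 + 2 * (L2_norm T v)\<^sup>2 - 4 * (L2_norm T (pointwise_mid u v))\<^sup>2"
    for u v :: "real \<Rightarrow> 'v"
  define D' where "D' u v = 2 * (L2_norm T u)\<^sup>2 + 2 * (L2_norm T v)\<^sup>2 - 4 * (L2_norm T (pointwise_mid u v))\<^sup>2"
    for u v :: "real \<Rightarrow> 'h"
  \<comment> \<open>The defect of \<open>Ws_sq\<close> is the sum of the defects of the function and
    of its weak derivative. Both are nonnegative, so each is small by itself.\<close>
  have both: "\<exists>k0. \<forall>j\<ge>k0. \<forall>k\<ge>k0. D (w j) (w k) < e \<and> D' (wder T (w j)) (wder T (w k)) < e" if "e > 0" for e
  proof -
    obtain k0 where k0: "\<And>j k. j \<ge> k0 \<Longrightarrow> k \<ge> k0 \<Longrightarrow>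
        2 * Ws_sq T (w j) + 2 * Ws_sq T (w k) - 4 * Ws_sq T (pointwise_mid (w j) (w k)) < e"
      using mid[OF \<open>e > 0\<close>] by auto
    have "D (w j) (w k) < e \<and> D' (wder T (w j)) (wder T (w k)) < e" if jk: "k0 \<le> j" "k0 \<le> k" for j k
      using k0[OF jk] Ws_sq_parallelogram[OF w[of j] w[of k]] L2_parallelogram_nonneg[OF wdL[of j] wdL[of k]]
        L2_parallelogram_nonneg[OF wL[of j] wL[of k]] unfolding D_def D'_def by linarith
    then show ?thesis by blast
  qed
  have mid1: "\<exists>k0. \<forall>j\<ge>k0. \<forall>k\<ge>k0. D (w j) (w k) < e"
    and mid2: "\<exists>k0. \<forall>j\<ge>k0. \<forall>k\<ge>k0. D' (wder T (w j)) (wder T (w k)) < e" if "e > 0" for e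
    using both[OF that] by blast+
  obtain u where u: "u \<in> L2 T" "AE t in timeM T. \<iota> (u t) = c t" "(\<lambda>k. L2_norm T (\<lambda>t. w k t - u t)) \<longlonglongrightarrow> 0"
    using L2_V_Cauchy_limit[OF T wL L2_mid_Cauchy[OF wL mid1[unfolded D_def]] lim] by blast
  have uz: "AE t in timeM T. u t = z t" by (rule AE_eq_of_\<iota>_AE_eq[OF u(2) z(2)])
  have wz: "(\<lambda>k. L2_norm T (\<lambda>t. w k t - z t)) \<longlonglongrightarrow> 0"
    using u(3) L2_norm_diff_AE_eq[OF wL u(1) z(1) uz] by simp
  obtain v where v: "v \<in> L2 T" "(\<lambda>k. L2_norm T (\<lambda>t. wder T (w k) t - v t)) \<longlonglongrightarrow> 0"
    using L2_complete[OF T wdL L2_mid_Cauchy[OF wdL mid2[unfolded D'_def]]] by blast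
  obtain B where B: "B \<ge> 0" "\<And>x. norm (\<iota> x) \<le> norm x * B" using \<iota>.nonneg_bounded by auto
  have H_le: "L2_norm T (\<lambda>t. (\<iota> \<circ> w k) t - (\<iota> \<circ> z) t) \<le> B * L2_norm T (\<lambda>t. w k t - z t)" for k
    using L2_norm_\<iota>[OF L2_diff[OF wL z(1)] B, of k] by (simp add: o_def \<iota>.diff)
  have H_lim: "(\<lambda>k. L2_norm T (\<lambda>t. (\<iota> \<circ> w k) t - (\<iota> \<circ> z) t)) \<longlonglongrightarrow> 0"
  proof (rule Lim_null_comparison)
    show "\<forall>\<^sub>F k in sequentially. norm (L2_norm T (\<lambda>t. (\<iota> \<circ> w k) t - (\<iota> \<circ> z) t)) \<le> B * L2_norm T (\<lambda>t. w k t - z t)"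
      using H_le by (simp add: L2_norm_nonneg)
    show "(\<lambda>k. B * L2_norm T (\<lambda>t. w k t - z t)) \<longlonglongrightarrow> 0" using tendsto_mult_left[OF wz, of B] by simp
  qed
  have wd: "has_weak_derivative T (\<iota> \<circ> z) v"
    by (rule has_weak_derivative_limit[OF T L2_\<iota>[OF wL] wdL L2_\<iota>[OF z(1)] v(1) Ws_wder(2)[OF w] H_lim v(2)])
  show zWs: "z \<in> Ws T \<iota>" by (rule WsI[OF z(1) v(1) wd])
  have zv: "AE t in timeM T. wder T z t = v t" by (rule weak_derivative_AE[OF L2_\<iota>[OF z(1)] v(1) wd])
  have wder_diff: "L2_norm T (wder T (\<lambda>t. w k t - z t)) = L2_norm T (\<lambda>t. wder T (w k) t - v t)" for k
  proof (rule L2_norm_cong_AE)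
    have eq: "(\<lambda>t. w k t - z t) = (\<lambda>t. 1 *\<^sub>R w k t + (-1) *\<^sub>R z t)" by simp
    note lc = Ws_lincomb[OF w[of k] zWs, of 1 "-1", folded eq]
    show "wder T (\<lambda>t. w k t - z t) \<in> borel_measurable (timeM T)" by (rule L2_measurable[OF Ws_wder(1)[OF lc(1)]])
    show "(\<lambda>t. wder T (w k) t - v t) \<in> borel_measurable (timeM T)" by (rule L2_measurable[OF L2_diff[OF wdL v(1)]])
    show "AE t in timeM T. wder T (\<lambda>t. w k t - z t) t = wder T (w k) t - v t"
      using lc(2) zv by eventually_elim simp
  qed
  have "(\<lambda>k. L2_norm T (\<lambda>t. w k t - z t) + sqrt ((L2_norm T (\<lambda>t. (\<iota> \<circ> w k) t - (\<iota> \<circ> z) t))\<^sup>2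
      + (L2_norm T (\<lambda>t. wder T (w k) t - v t))\<^sup>2)) \<longlonglongrightarrow> 0 + sqrt (0\<^sup>2 + 0\<^sup>2)"
    by (intro tendsto_intros wz H_lim v(2))
  moreover have "Ws_norm T \<iota> (\<lambda>t. w k t - z t) = L2_norm T (\<lambda>t. w k t - z t)
      + sqrt ((L2_norm T (\<lambda>t. (\<iota> \<circ> w k) t - (\<iota> \<circ> z) t))\<^sup>2 + (L2_norm T (\<lambda>t. wder T (w k) t - v t))\<^sup>2)" for k
    unfolding Ws_norm_def H1_norm_def wder_diff by (simp add: o_def \<iota>.diff)
  ultimately show "(\<lambda>k. Ws_norm T \<iota> (\<lambda>t. w k t - z t)) \<longlonglongrightarrow> 0" by simp
qed

text \<open>Here \<open>z\<close> is known beforehand only as an element of L2(0,T;V); being the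
  limit of a Mazur sequence bounded through \<open>Ws_sq\<close> gives it a weak derivative.\<close>

lemma Ws_weak_convergence:
  assumes T: "T > 0" and u: "\<And>k. u k \<in> Ws T \<iota>"
    and bound: "\<And>k. Ws_sq T (u k) \<le> B"
    and lim: "\<And>t. 0 < t \<Longrightarrow> t < T \<Longrightarrow> (\<lambda>k. \<iota> (u k t)) \<longlonglongrightarrow> c t"
    and z: "z \<in> L2 T" "AE t in timeM T. \<iota> (z t) = c t"
  shows "z \<in> Ws T \<iota>" "converges_weakly (Ws T \<iota>) (Ws_norm T \<iota>) u z"
proof -
  have limit: "z \<in> Ws T \<iota> \<and> (\<lambda>k. Ws_norm T \<iota> (\<lambda>t. w k t - z t)) \<longlonglongrightarrow> 0"
    if hull: "\<And>k. w k \<in> midpoint_hull pointwise_mid (u ` {k..})"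
      and mid: "\<And>e. e > 0 \<Longrightarrow> \<exists>k0. \<forall>j\<ge>k0. \<forall>k\<ge>k0. 2 * Ws_sq T (w j) + 2 * Ws_sq T (w k) - 4 * Ws_sq T (pointwise_mid (w j) (w k)) < e"
    for w
  proof -
    have w: "w k \<in> Ws T \<iota>" for k
      by (rule midpoint_hull_subset[OF _ Ws_pointwise_mid(1) hull]) (use u in auto)
    have "(\<lambda>k. \<iota> (w k t)) \<longlonglongrightarrow> c t" if "0 < t" "t < T" for t
      by (rule midpoint_hull_tendsto[OF \<iota>.linear lim[OF that] hull])
    from Ws_Cauchy_limit[OF T w mid this z] show ?thesis by blast
  qed
  obtain w where "\<And>k. w k \<in> midpoint_hull pointwise_mid (u ` {k..})"
    "\<And>e. e > 0 \<Longrightarrow> \<exists>k0. \<forall>j\<ge>k0. \<forall>k\<ge>k0. 2 * Ws_sq T (w j) + 2 * Ws_sq T (w k) - 4 * Ws_sq T (pointwise_mid (w j) (w k)) < e"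
    using Mazur_midpoints[where u=u and Q="Ws_sq T" and mid=pointwise_mid, OF Ws_sq_nonneg bound] by blast
  from limit[OF this] show zWs: "z \<in> Ws T \<iota>" by blast
  show "converges_weakly (Ws T \<iota>) (Ws_norm T \<iota>) u z"
  proof (rule converges_weaklyI_Mazur[where Q="Ws_sq T" and B=B])
    show "(\<lambda>t. u t + w t) \<in> Ws T \<iota>" if "u \<in> Ws T \<iota>" "w \<in> Ws T \<iota>" for u w
      using Ws_lincomb(1)[OF that, of 1 1] by simp
    show "(\<lambda>t. c *\<^sub>R u t) \<in> Ws T \<iota>" if "u \<in> Ws T \<iota>" for u c
      using Ws_lincomb(1)[OF that that, of c 0] by simp
  qed (use limit u zWs bound Ws_sq_nonneg in auto)
qed

text \<open>Pairing the weak derivative with \<open>g\<close> is a bounded functional for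
  \<open>Ws_norm\<close>; in this form weak convergence is applied to the difference
  quotients.\<close>

lemma wder_weak_convergence:
  assumes conv: "converges_weakly (Ws T \<iota>) (Ws_norm T \<iota>) u z" and g: "g \<in> L2 T"
  shows "(\<lambda>k. \<integral>t. wder T (u k) t \<bullet> g t \<partial>timeM T) \<longlonglongrightarrow> (\<integral>t. wder T z t \<bullet> g t \<partial>timeM T)"
proof -
  define F where "F u = (\<integral>t. wder T u t \<bullet> g t \<partial>timeM T)" for u
  have int: "integrable (timeM T) (\<lambda>t. wder T u t \<bullet> g t)" if "u \<in> Ws T \<iota>" for u
    by (rule L2_bilinear_integrable[OF bounded_bilinear_inner Ws_wder(1)[OF that] g])
  have lin: "F (\<lambda>t. a *\<^sub>R u t + b *\<^sub>R w t) = a * F u + b * F w" if "u \<in> Ws T \<iota>" "w \<in> Ws T \<iota>" for u w a b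
  proof -
    note lc = Ws_lincomb[OF that, of a b]
    have "F (\<lambda>t. a *\<^sub>R u t + b *\<^sub>R w t) = (\<integral>t. a * (wder T u t \<bullet> g t) + b * (wder T w t \<bullet> g t) \<partial>timeM T)"
      unfolding F_def
    proof (rule integral_cong_AE)
      show "(\<lambda>t. wder T (\<lambda>t. a *\<^sub>R u t + b *\<^sub>R w t) t \<bullet> g t) \<in> borel_measurable (timeM T)"
        using int[OF lc(1)] by auto
      show "(\<lambda>t. a * (wder T u t \<bullet> g t) + b * (wder T w t \<bullet> g t)) \<in> borel_measurable (timeM T)"
        using int[OF that(1)] int[OF that(2)] by auto
      show "AE t in timeM T. wder T (\<lambda>t. a *\<^sub>R u t + b *\<^sub>R w t) t \<bullet> g t = a * (wder T u t \<bullet> g t) + b * (wder T w t \<bullet> g t)"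
        using lc(2) by eventually_elim (simp add: inner_add_left)
    qed
    then show ?thesis using int[OF that(1)] int[OF that(2)] by (simp add: F_def)
  qed
  obtain C where C: "C \<ge> 0" "\<And>u w. u \<in> L2 T \<Longrightarrow> w \<in> L2 T \<Longrightarrow> \<bar>\<integral>t. u t \<bullet> w t \<partial>timeM T\<bar> \<le> C * L2_norm T u * L2_norm T (w :: real \<Rightarrow> 'h)"
    using L2_bilinear_bound[OF bounded_bilinear_inner] by blast
  have "\<bar>F u\<bar> \<le> (C * L2_norm T g) * Ws_norm T \<iota> u" if u: "u \<in> Ws T \<iota>" for u
  proof -
    have "\<bar>F u\<bar> \<le> C * L2_norm T (wder T u) * L2_norm T g"
      unfolding F_def by (rule C(2)[OF Ws_wder(1)[OF u] g])
    moreover have "L2_norm T (wder T u) \<le> sqrt ((L2_norm T (\<iota> \<circ> u))\<^sup>2 + (L2_norm T (wder T u))\<^sup>2)"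
      by (rule real_sqrt_sum_squares_ge2)
    then have "L2_norm T (wder T u) \<le> Ws_norm T \<iota> u"
      using L2_norm_nonneg[of T u] unfolding Ws_norm_def H1_norm_def by linarith
    then have "C * L2_norm T g * L2_norm T (wder T u) \<le> C * L2_norm T g * Ws_norm T \<iota> u"
      using C(1) L2_norm_nonneg[of T g] by (intro mult_left_mono) auto
    ultimately show ?thesis by (simp add: mult_ac)
  qed
  then have "bounded_functional (Ws T \<iota>) (Ws_norm T \<iota>) F"
    unfolding bounded_functional_def using lin[of _ _ 1 1] lin[of _ _ _ 0] by auto
  then show ?thesis using conv unfolding converges_weakly_def F_def by blast
qed

end

text \<open>No pointwise limit is at hand for these averages, so a Mazur limit \<open>v\<close> is
  identified with \<open>g\<close> by integrals against test functions, whose limits survive taking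
  midpoints.\<close>

lemma step_cell_mean_weak_convergence:
  fixes g :: "real \<Rightarrow> 'a::{real_inner,banach,second_countable_topology}"
  assumes T: "T > 0" and g: "g \<in> L2 T" and r: "strict_mono r" "\<And>k. r k \<ge> 1"
  shows "converges_weakly (L2 T) (L2_norm T) (\<lambda>k. step_interpolant T (r k) (cell_mean T (r k) g)) g"
proof -
  define u where "u k = step_interpolant T (r k) (cell_mean T (r k) g)" for k
  define Q where "Q u = (L2_norm T u)\<^sup>2" for u :: "real \<Rightarrow> 'a"
  have u: "u k \<in> L2 T" for k unfolding u_def by (rule step_interpolant_L2)
  have Q: "\<And>x. 0 \<le> Q x" "\<And>k. Q (u k) \<le> (L2_norm T g)\<^sup>2"
    using cell_mean_sq_le[OF T r(2) g] by (auto simp: Q_def u_def L2_norm_step_interpolant[OF T r(2)])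
  have "converges_weakly (L2 T) (L2_norm T) u g"
  proof (rule converges_weaklyI_Mazur[where Q=Q and B="(L2_norm T g)\<^sup>2"])
    fix w assume hull: "\<And>k. w k \<in> midpoint_hull pointwise_mid (u ` {k..})"
      and mid: "\<And>e. e > 0 \<Longrightarrow> \<exists>k0. \<forall>j\<ge>k0. \<forall>k\<ge>k0. 2 * Q (w j) + 2 * Q (w k) - 4 * Q (pointwise_mid (w j) (w k)) < e"
    have w: "w k \<in> L2 T" for k
      by (rule midpoint_hull_subset[OF _ L2_pointwise_mid hull]) (use u in auto)
    obtain v where v: "v \<in> L2 T" "(\<lambda>k. L2_norm T (\<lambda>t. w k t - v t)) \<longlonglongrightarrow> 0"
      using L2_complete[OF T w L2_mid_Cauchy[OF w mid[unfolded Q_def]]] by blast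
    have "AE t in timeM T. v t - g t = 0"
    proof (rule fundamental_lemma_calculus_of_variations)
      show "integrable (timeM T) (\<lambda>t. v t - g t)" by (rule L2_integrable[OF L2_diff[OF v(1) g]])
      fix \<phi> assume \<phi>: "test_function T \<phi>"
      let ?I = "\<lambda>u. \<integral>t. \<phi> t *\<^sub>R u t \<partial>timeM T"
      have add: "?I (pointwise_mid x y) = (1/2) *\<^sub>R (?I x + ?I y)" if "x \<in> L2 T" "y \<in> L2 T" for x y
      proof -
        have "?I (pointwise_mid x y) = (\<integral>t. (1/2) *\<^sub>R (\<phi> t *\<^sub>R x t + \<phi> t *\<^sub>R y t) \<partial>timeM T)"
          by (simp add: pointwise_mid_def scaleR_add_right mult.commute)
        also have "\<dots> = (1/2) *\<^sub>R (\<integral>t. \<phi> t *\<^sub>R x t + \<phi> t *\<^sub>R y t \<partial>timeM T)" by (rule integral_scaleR_right)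
        also have "\<dots> = (1/2) *\<^sub>R (?I x + ?I y)"
          using Bochner_Integration.integral_add[OF test_function_integrable[OF \<phi> L2_integrable[OF that(1)]]
              test_function_integrable[OF \<phi> L2_integrable[OF that(2)]]] by simp
        finally show ?thesis .
      qed
      have lim: "(\<lambda>k. ?I (u k)) \<longlonglongrightarrow> ?I g"
        unfolding u_def by (rule step_cell_mean_test_limit[OF T g \<phi> r])
      have "(\<lambda>k. ?I (w k)) \<longlonglongrightarrow> ?I g"
      proof (rule LIMSEQ_I)
        fix e :: real assume "e > 0"
        then obtain k0 where k0: "\<And>k. k \<ge> k0 \<Longrightarrow> norm (?I (u k) - ?I g) < e / 2"
          using LIMSEQ_D[OF lim, of "e / 2"] by auto
        have hull_bound: "x \<in> L2 T \<and> norm (?I x - ?I g) \<le> e / 2"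
          if "x \<in> midpoint_hull pointwise_mid (u ` {k..})" "k \<ge> k0" for x k
          using that(1)
        proof induction
          case (base x) then show ?case using u k0 that(2) by (force intro: less_imp_le)
        next
          case (mid x y)
          have "?I (pointwise_mid x y) - ?I g = (1/2) *\<^sub>R ((?I x - ?I g) + (?I y - ?I g))"
            using mid by (simp add: add algebra_simps flip: scaleR_add_left)
          then have "norm (?I (pointwise_mid x y) - ?I g) \<le> (1/2) * (norm (?I x - ?I g) + norm (?I y - ?I g))"
            using norm_triangle_ineq[of "?I x - ?I g" "?I y - ?I g"] by simp
          then show ?case using mid L2_pointwise_mid by auto
        qed
        have "norm (?I (w k) - ?I g) < e" if "k \<ge> k0" for k
          using hull_bound[OF hull that] \<open>e > 0\<close> by auto
        then show "\<exists>no. \<forall>n\<ge>no. norm (?I (w n) - ?I g) < e" by blast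
      qed
      moreover have "(\<lambda>k. ?I (w k)) \<longlonglongrightarrow> ?I v" by (rule L2_limit_integral[OF T w v \<phi>])
      ultimately have "?I v = ?I g" using LIMSEQ_unique by blast
      then show "(\<integral>t. \<phi> t *\<^sub>R (v t - g t) \<partial>timeM T) = 0"
        using test_function_integrable[OF \<phi> L2_integrable[OF v(1)]] test_function_integrable[OF \<phi> L2_integrable[OF g]]
        by (simp add: scaleR_diff_right)
    qed
    then have "AE t in timeM T. v t = g t" by simp
    then have "L2_norm T (\<lambda>t. w k t - v t) = L2_norm T (\<lambda>t. w k t - g t)" for k
      by (rule L2_norm_diff_AE_eq[OF w v(1) g])
    then show "(\<lambda>k. L2_norm T (\<lambda>t. w k t - g t)) \<longlonglongrightarrow> 0" using v(2) by simp
  qed (use Q u g in \<open>auto intro: L2_add L2_scaleR\<close>)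
  then show ?thesis unfolding u_def .
qed

text \<open>Splits \<open>y k\<close> into \<open>y'\<close> and a remainder: the pairing with
  \<open>y'\<close> converges by assumption, and the remainder is small in norm while
  \<open>x k\<close> stays bounded.\<close>

lemma weak_strong_convergence:
  fixes \<beta> :: "'a::{banach,second_countable_topology} \<Rightarrow> 'b::{banach,second_countable_topology} \<Rightarrow> real"
  assumes \<beta>: "bounded_bilinear \<beta>" and x: "\<And>k. x k \<in> L2 T" and y: "\<And>k. y k \<in> L2 T" "y' \<in> L2 T"
    and bound: "\<And>k. L2_norm T (x k) \<le> B"
    and weak: "(\<lambda>k. \<integral>t. \<beta> (x k t) (y' t) \<partial>timeM T) \<longlonglongrightarrow> l"
    and strong: "(\<lambda>k. L2_norm T (\<lambda>t. y k t - y' t)) \<longlonglongrightarrow> 0"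
  shows "(\<lambda>k. \<integral>t. \<beta> (x k t) (y k t) \<partial>timeM T) \<longlonglongrightarrow> l"
proof -
  interpret \<beta>: bounded_bilinear \<beta> by fact
  obtain C where C: "C \<ge> 0" "\<And>u w. u \<in> L2 T \<Longrightarrow> w \<in> L2 T \<Longrightarrow> \<bar>\<integral>t. \<beta> (u t) (w t) \<partial>timeM T\<bar> \<le> C * L2_norm T u * L2_norm T w"
    using L2_bilinear_bound[OF \<beta>] by blast
  have d: "(\<lambda>t. y k t - y' t) \<in> L2 T" for k by (rule L2_diff[OF y])
  have "(\<lambda>k. \<integral>t. \<beta> (x k t) (y k t - y' t) \<partial>timeM T) \<longlonglongrightarrow> 0"
  proof (rule Lim_null_comparison)
    show "\<forall>\<^sub>F k in sequentially. norm (\<integral>t. \<beta> (x k t) (y k t - y' t) \<partial>timeM T) \<le> (C * B) * L2_norm T (\<lambda>t. y k t - y' t)"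
    proof (rule always_eventually, rule allI)
      fix k
      have "norm (\<integral>t. \<beta> (x k t) (y k t - y' t) \<partial>timeM T) \<le> C * L2_norm T (x k) * L2_norm T (\<lambda>t. y k t - y' t)"
        using C(2)[OF x d] by simp
      also have "\<dots> \<le> (C * B) * L2_norm T (\<lambda>t. y k t - y' t)"
        using bound[of k] C(1) by (intro mult_right_mono mult_left_mono L2_norm_nonneg)
      finally show "norm (\<integral>t. \<beta> (x k t) (y k t - y' t) \<partial>timeM T) \<le> (C * B) * L2_norm T (\<lambda>t. y k t - y' t)" .
    qed
    show "(\<lambda>k. (C * B) * L2_norm T (\<lambda>t. y k t - y' t)) \<longlonglongrightarrow> 0" using tendsto_mult_left[OF strong, of "C * B"] by simp
  qed
  from tendsto_add[OF weak this]
  have "(\<lambda>k. (\<integral>t. \<beta> (x k t) (y' t) \<partial>timeM T) + (\<integral>t. \<beta> (x k t) (y k t - y' t) \<partial>timeM T)) \<longlonglongrightarrow> l" by simp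
  moreover have "(\<integral>t. \<beta> (x k t) (y' t) \<partial>timeM T) + (\<integral>t. \<beta> (x k t) (y k t - y' t) \<partial>timeM T) = (\<integral>t. \<beta> (x k t) (y k t) \<partial>timeM T)" for k
    using L2_bilinear_integrable[OF \<beta> x y(2), of k] L2_bilinear_integrable[OF \<beta> x y(1), of k k]
    by (simp add: \<beta>.diff_right)
  ultimately show ?thesis by simp
qed

section \<open>Convergence of the scheme\<close>

lemma L2_bilinear_functional:
  fixes \<beta> :: "'a::{banach,second_countable_topology} \<Rightarrow> 'b::{banach,second_countable_topology} \<Rightarrow> real"
  assumes \<beta>: "bounded_bilinear \<beta>" and w: "w \<in> L2 T"
  shows "bounded_functional (L2 T) (L2_norm T) (\<lambda>u. \<integral>t. \<beta> (u t) (w t) \<partial>timeM T)"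
proof -
  interpret \<beta>: bounded_bilinear \<beta> by fact
  obtain C where C: "C \<ge> 0" "\<And>u w. u \<in> L2 T \<Longrightarrow> w \<in> L2 T \<Longrightarrow> \<bar>\<integral>t. \<beta> (u t) (w t) \<partial>timeM T\<bar> \<le> C * L2_norm T u * L2_norm T w"
    using L2_bilinear_bound[OF \<beta>] by blast
  have "\<bar>\<integral>t. \<beta> (u t) (w t) \<partial>timeM T\<bar> \<le> (C * L2_norm T w) * L2_norm T u" if "u \<in> L2 T" for u
    using C(2)[OF that w] by (simp add: mult_ac)
  then show ?thesis
    unfolding bounded_functional_def
    using L2_bilinear_integrable[OF \<beta> _ w] by (auto simp: \<beta>.add_left \<beta>.scaleR_left)
qed

lemma L2_bounded_pointwise_limit:
  fixes u :: "nat \<Rightarrow> real \<Rightarrow> 'a::{banach,second_countable_topology}"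
  assumes u: "\<And>k. u k \<in> L2 T" and x: "x \<in> L2 T"
    and bound: "\<And>k. AE t in timeM T. norm (u k t) \<le> B" and lim: "AE t in timeM T. (\<lambda>k. u k t) \<longlonglongrightarrow> x t"
  shows "(\<lambda>k. L2_norm T (\<lambda>t. u k t - x t)) \<longlonglongrightarrow> 0"
proof -
  interpret finite_measure "timeM T" by (rule finite_measure_timeM)
  have "(\<lambda>k. \<integral>t. (norm (u k t - x t))\<^sup>2 \<partial>timeM T) \<longlonglongrightarrow> (\<integral>t. 0 \<partial>timeM T)"
  proof (rule integral_dominated_convergence[where w="\<lambda>t. 2 * B\<^sup>2 + 2 * (norm (x t))\<^sup>2"])
    show "(\<lambda>t. (norm (u k t - x t))\<^sup>2) \<in> borel_measurable (timeM T)" for k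
      using L2_integrable_sq[OF L2_diff[OF u x]] by auto
    show "integrable (timeM T) (\<lambda>t. 2 * B\<^sup>2 + 2 * (norm (x t))\<^sup>2)" using L2_integrable_sq[OF x] by simp
    show "AE t in timeM T. (\<lambda>k. (norm (u k t - x t))\<^sup>2) \<longlonglongrightarrow> 0"
      using lim
    proof eventually_elim
      case (elim t)
      have "(\<lambda>k. (norm (u k t - x t))\<^sup>2) \<longlonglongrightarrow> (norm (x t - x t))\<^sup>2" by (intro tendsto_intros elim)
      then show ?case by simp
    qed
    show "AE t in timeM T. norm ((norm (u k t - x t))\<^sup>2) \<le> 2 * B\<^sup>2 + 2 * (norm (x t))\<^sup>2" for k
      using bound[of k]
    proof eventually_elim
      case (elim t)
      have "(norm (u k t))\<^sup>2 \<le> B\<^sup>2" using elim by (intro power_mono) auto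
      then show ?case using norm_add_sq_le[of "u k t" "- x t"] by simp
    qed
  qed simp
  from tendsto_real_sqrt[OF this] show ?thesis by (simp add: L2_norm_def)
qed

text \<open>The iterates are fixed but arbitrary, since the limit is claimed for every family of
  solutions of the scheme and not only for the constructed one.\<close>

locale qvi_discrete = qvi_scheme \<iota> K A T \<Phi> f z\<^sub>0
  for \<iota> :: "'v::{real_inner,banach,second_countable_topology}
      \<Rightarrow> 'h::{real_inner,banach,second_countable_topology}" and K A T \<Phi> f z\<^sub>0 +
  fixes zb zs :: "nat \<Rightarrow> nat \<Rightarrow> 'v"
  assumes discrete: "\<And>N. N \<ge> 1 \<Longrightarrow> discrete_solution T \<iota> K A \<Phi> f z\<^sub>0 N (zb N) (zs N)"
    and \<Phi>_step: "\<And>N (vs :: nat \<Rightarrow> 'v). N \<ge> 1 \<Longrightarrow> (\<And>n. ord_le K 0 (\<iota> (vs n))) \<Longrightarrow>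
        AE t in timeM T. ord_le K
          (\<iota> (\<Sum>n=1..N. indicat_real (cell T N (n - 1)) t *\<^sub>R \<Phi> (\<lambda>_. \<iota> (vs n)) t))
          (\<iota> (\<Phi> (\<iota> \<circ> step_interpolant T N vs) t))"
    and \<Phi>_closed: "\<And>(vn :: nat \<Rightarrow> real \<Rightarrow> 'v) w.
        converges_weakly (L2 T) (L2_norm T) vn w \<Longrightarrow>
        converges_weak_star_Linf T (\<lambda>n. \<iota> \<circ> vn n) (\<iota> \<circ> w) \<Longrightarrow>
        (\<And>n. AE t in timeM T. ord_le K (\<iota> (vn n t)) (\<iota> (\<Phi> (\<iota> \<circ> vn n) t))) \<Longrightarrow>
        AE t in timeM T. ord_le K (\<iota> (w t)) (\<iota> (\<Phi> (\<iota> \<circ> w) t))"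
    and \<Phi>_approx: "\<And>\<epsilon> (wN :: nat \<Rightarrow> real \<Rightarrow> 'v) w. \<epsilon> > 0 \<Longrightarrow>
        converges_weakly (L2 T) (L2_norm T) wN w \<Longrightarrow>
        converges_weak_star_Linf T (\<lambda>n. \<iota> \<circ> wN n) (\<iota> \<circ> w) \<Longrightarrow>
        \<exists>N\<^sub>0. \<forall>N\<ge>N\<^sub>0.
          (\<Sum>n=1..N. \<integral>\<^sup>+t\<in>cell T N (n - 1).
             ennreal ((norm (\<Phi> (\<lambda>_. \<iota> (wN N t)) (grid T N (n - 1)) - \<Phi> (\<iota> \<circ> w) t))\<^sup>2)
             \<partial>timeM T) \<le> ennreal \<epsilon>"
begin

lemma zs_0: "N \<ge> 1 \<Longrightarrow> zs N 0 = z\<^sub>0"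
  using discrete[of N] by (simp add: discrete_solution_def Let_def)

lemma zs_step:
  assumes n: "n < N"
  shows "ord_le K (\<iota> (zs N n)) (\<iota> (zs N (Suc n)))"
    "ord_le K (\<iota> (zs N (Suc n))) (\<iota> (\<Phi> (\<lambda>_. \<iota> (zs N (Suc n))) (grid T N n)))"
    "ord_le K (\<iota> v) (\<iota> (\<Phi> (\<lambda>_. \<iota> (zs N (Suc n))) (grid T N n))) \<Longrightarrow>
      ((real N / T) *\<^sub>R (\<iota> (zs N (Suc n)) - \<iota> (zs N n)) - cell_mean T N f (Suc n)) \<bullet> \<iota> (zs N (Suc n) - v)
        + A (zs N (Suc n)) (zs N (Suc n) - v) \<le> 0"
proof -
  have N: "N \<ge> 1" and n1: "Suc n \<in> {1..N}" using n by auto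
  note step = bspec[OF conjunct2[OF discrete[OF N, unfolded discrete_solution_def Let_def]] n1]
  show "ord_le K (\<iota> (zs N n)) (\<iota> (zs N (Suc n)))"
    "ord_le K (\<iota> (zs N (Suc n))) (\<iota> (\<Phi> (\<lambda>_. \<iota> (zs N (Suc n))) (grid T N n)))"
    using step by simp_all
  assume "ord_le K (\<iota> v) (\<iota> (\<Phi> (\<lambda>_. \<iota> (zs N (Suc n))) (grid T N n)))"
  then have "(to_dual \<iota> ((1 / (T / real N)) *\<^sub>R \<iota> (zs N (Suc n) - zs N n)) + A (zs N (Suc n))
      - to_dual \<iota> (cell_mean T N f (Suc n))) (zs N (Suc n) - v) \<le> 0"
    using step by (metis diff_Suc_1)
  then show "((real N / T) *\<^sub>R (\<iota> (zs N (Suc n)) - \<iota> (zs N n)) - cell_mean T N f (Suc n)) \<bullet> \<iota> (zs N (Suc n) - v)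
        + A (zs N (Suc n)) (zs N (Suc n) - v) \<le> 0"
    by (simp only: blinfun.add_left blinfun.diff_left to_dual \<iota>.diff[of "zs N (Suc n)" "zs N n"]
        inner_diff_left[of "_ *\<^sub>R _"] divide_divide_eq_right mult_1)
qed

lemma zs_mono: "m \<le> n \<Longrightarrow> n \<le> N \<Longrightarrow> ord_le K (\<iota> (zs N m)) (\<iota> (zs N n))"
proof (induction n)
  case 0 then show ?case using ord_le_refl[OF cone] by simp
next
  case (Suc n)
  then show ?case
    using ord_le_refl[OF cone] ord_le_trans[OF cone _ zs_step(1)] by (cases "m = Suc n") auto
qed

lemma zs_nonneg: "N \<ge> 1 \<Longrightarrow> n \<le> N \<Longrightarrow> ord_le K 0 (\<iota> (zs N n))"
  using zs_mono[of 0 n N] zs_0[of N] z0_nonneg ord_le_trans[OF cone] by auto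

section \<open>A priori estimates\<close>

abbreviation increment :: "nat \<Rightarrow> nat \<Rightarrow> 'h" where
  "increment N n \<equiv> \<iota> (zs N (Suc n)) - \<iota> (zs N n)"

lemma energy_estimate:
  assumes N: "N \<ge> 1" and m: "m \<le> N"
  shows "(real N / T) * (\<Sum>n<m. (norm (increment N n))\<^sup>2) + A (zs N m) (zs N m)
    \<le> A z\<^sub>0 z\<^sub>0 + (T / real N) * (\<Sum>n<m. (norm (cell_mean T N f (Suc n)))\<^sup>2)"
  using m
proof (induction m)
  case 0 then show ?case using zs_0[OF N] by simp
next
  case (Suc m)
  define z z' d g where "z = zs N m" and "z' = zs N (Suc m)" and "d = increment N m" and "g = cell_mean T N f (Suc m)"
  have mN: "m < N" using Suc by simp
  have "ord_le K (\<iota> z) (\<iota> (\<Phi> (\<lambda>_. \<iota> z') (grid T N m)))"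
    using ord_le_trans[OF cone zs_step(1,2)[OF mN]] by (simp add: z_def z'_def)
  from zs_step(3)[OF mN, of z] this
  have vi: "(real N / T) * (d \<bullet> d) - g \<bullet> d + A z' (z' - z) \<le> 0"
    by (simp add: d_def g_def z_def z'_def \<iota>.diff inner_diff_left)
  \<comment> \<open>By symmetry \<open>2 * A z' (z' - z)\<close> is the difference of the energies
    of \<open>z'\<close> and \<open>z\<close> plus this nonnegative term, so the energies telescope
    over the steps.\<close>
  have "0 \<le> A (z' - z) (z' - z)" by (rule A_nonneg)
  then have A: "A z' z' - A z z \<le> 2 * A z' (z' - z)"
    by (simp add: blinfun.diff_left blinfun.diff_right A_sym[of z z'])
  \<comment> \<open>Young's inequality weighted with the step size: it uses up one of the two copies
    of \<open>(real N / T) * (d \<bullet> d)\<close> that the doubled variational inequality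
    provides.\<close>
  have "0 \<le> (norm ((T / real N) *\<^sub>R g - d))\<^sup>2 * (real N / T)" using T_pos by simp
  also have "\<dots> = (T / real N) * (g \<bullet> g) - 2 * (g \<bullet> d) + (real N / T) * (d \<bullet> d)"
    using T_pos N unfolding power2_norm_eq_inner
    by (simp add: inner_diff_left inner_diff_right inner_commute field_simps)
  finally have "2 * (g \<bullet> d) \<le> (T / real N) * (g \<bullet> g) + (real N / T) * (d \<bullet> d)" by simp
  then have "(real N / T) * (d \<bullet> d) + A z' z' \<le> A z z + (T / real N) * (g \<bullet> g)" using vi A by argo
  moreover have "(real N / T) * (\<Sum>n<m. (norm (increment N n))\<^sup>2) + A z z
      \<le> A z\<^sub>0 z\<^sub>0 + (T / real N) * (\<Sum>n<m. (norm (cell_mean T N f (Suc n)))\<^sup>2)"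
    using Suc by (simp add: z_def)
  ultimately show ?case
    unfolding sum.lessThan_Suc distrib_left
    unfolding d_def[symmetric] g_def[symmetric] power2_norm_eq_inner[of d] power2_norm_eq_inner[of g]
    unfolding z'_def[symmetric] by linarith
qed

lemma a_priori_bound:
  obtains C where "C \<ge> 0" "\<And>N n. N \<ge> 1 \<Longrightarrow> n \<le> N \<Longrightarrow> norm (zs N n) \<le> C"
    "\<And>N. N \<ge> 1 \<Longrightarrow> (real N / T) * (\<Sum>n<N. (norm (increment N n))\<^sup>2) \<le> C\<^sup>2"
proof -
  obtain \<alpha> where \<alpha>: "\<alpha> > 0" "\<And>v. A v v \<ge> \<alpha> * (norm v)\<^sup>2" using A_coercive by auto
  define E where "E = A z\<^sub>0 z\<^sub>0 + (L2_norm T f)\<^sup>2"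
  have E: "E \<ge> 0" unfolding E_def using A_nonneg by simp
  have f: "(T / real N) * (\<Sum>n<m. (norm (cell_mean T N f (Suc n)))\<^sup>2) \<le> (L2_norm T f)\<^sup>2" if N: "N \<ge> 1" and m: "m \<le> N" for N m
  proof -
    have "(\<Sum>n<m. (norm (cell_mean T N f (Suc n)))\<^sup>2) \<le> (\<Sum>n<N. (norm (cell_mean T N f (Suc n)))\<^sup>2)"
      using m by (intro sum_mono2) auto
    also have "\<dots> = (\<Sum>n=1..N. (norm (cell_mean T N f n))\<^sup>2)" by (simp add: sum.atLeast1_atMost_eq)
    finally have "(T / real N) * (\<Sum>n<m. (norm (cell_mean T N f (Suc n)))\<^sup>2) \<le> (T / real N) * (\<Sum>n=1..N. (norm (cell_mean T N f n))\<^sup>2)"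
      using T_pos by (intro mult_left_mono) auto
    then show ?thesis using cell_mean_sq_le[OF T_pos N f_L2] by linarith
  qed
  have energy: "(real N / T) * (\<Sum>n<m. (norm (increment N n))\<^sup>2) + A (zs N m) (zs N m) \<le> E" if "N \<ge> 1" "m \<le> N" for N m
    using energy_estimate[OF that] f[OF that] by (simp add: E_def)
  \<comment> \<open>A sum, so that one constant serves both the bound in V and the bound on the
    increments.\<close>
  define C where "C = sqrt (E / \<alpha>) + sqrt E"
  show ?thesis
  proof (rule that)
    show "C \<ge> 0" using E \<alpha> by (simp add: C_def)
    fix N :: nat assume N: "N \<ge> 1"
    show "norm (zs N n) \<le> C" if n: "n \<le> N" for n
    proof -
      have "0 \<le> (real N / T) * (\<Sum>n<n. (norm (increment N n))\<^sup>2)"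
        using T_pos by (intro mult_nonneg_nonneg sum_nonneg) auto
      then have "\<alpha> * (norm (zs N n))\<^sup>2 \<le> E" using energy[OF N n] \<alpha>(2)[of "zs N n"] by linarith
      then have "(norm (zs N n))\<^sup>2 \<le> E / \<alpha>" using \<alpha>(1) by (simp add: field_simps)
      then have "norm (zs N n) \<le> sqrt (E / \<alpha>)" by (rule real_le_rsqrt)
      then show ?thesis using E by (simp add: C_def add_increasing2)
    qed
    have "(real N / T) * (\<Sum>n<N. (norm (increment N n))\<^sup>2) \<le> (sqrt E)\<^sup>2"
      using energy[OF N order_refl] A_nonneg[of "zs N N"] E by simp
    also have "\<dots> \<le> C\<^sup>2" using E \<alpha> by (intro power_mono) (auto simp: C_def)
    finally show "(real N / T) * (\<Sum>n<N. (norm (increment N n))\<^sup>2) \<le> C\<^sup>2" .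
  qed
qed

text \<open>Cauchy-Schwarz over the \<open>n - m\<close> increments between the two grid points: a
  discrete Hoelder modulus of exponent 1/2 in H.\<close>

lemma increment_sum_bound:
  assumes N: "N \<ge> 1" and C: "C \<ge> 0" and bound: "(real N / T) * (\<Sum>n<N. (norm (increment N n))\<^sup>2) \<le> C\<^sup>2"
    and mn: "m \<le> n" "n \<le> N"
  shows "norm (\<iota> (zs N n) - \<iota> (zs N m)) \<le> C * sqrt (real (n - m) * (T / real N))"
proof (rule power2_le_imp_le)
  have "\<iota> (zs N n) - \<iota> (zs N m) = (\<Sum>i=m..<n. increment N i)"
    using sum_Suc_diff'[OF mn(1), of "\<lambda>i. \<iota> (zs N i)"] by simp
  then have "(norm (\<iota> (zs N n) - \<iota> (zs N m)))\<^sup>2 \<le> (\<Sum>i=m..<n. norm (increment N i))\<^sup>2"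
    by (simp add: power_mono norm_sum)
  also have "\<dots> \<le> (\<Sum>i=m..<n. (norm (increment N i))\<^sup>2) * card {m..<n}"
    by (rule sum_squared_le_sum_of_squares)
  also have "\<dots> \<le> (\<Sum>i<N. (norm (increment N i))\<^sup>2) * card {m..<n}"
    using mn by (intro mult_right_mono sum_mono2) auto
  also have "\<dots> \<le> (C\<^sup>2 * (T / real N)) * card {m..<n}"
    using bound T_pos N by (intro mult_right_mono) (auto simp: field_simps)
  also have "\<dots> = (C * sqrt (real (n - m) * (T / real N)))\<^sup>2"
    using T_pos by (simp add: power_mult_distrib)
  finally show "(norm (\<iota> (zs N n) - \<iota> (zs N m)))\<^sup>2 \<le> (C * sqrt (real (n - m) * (T / real N)))\<^sup>2" .
qed (use C T_pos in auto)

abbreviation step_rate :: "nat \<Rightarrow> real \<Rightarrow> 'h" where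
  "step_rate N \<equiv> step_interpolant T N (\<lambda>n. (real N / T) *\<^sub>R (\<iota> (zs N n) - \<iota> (zs N (n - 1))))"

lemma L2_norm_step_rate:
  assumes N: "N \<ge> 1" and C: "C \<ge> 0" and bound: "(real N / T) * (\<Sum>n<N. (norm (increment N n))\<^sup>2) \<le> C\<^sup>2"
  shows "L2_norm T (step_rate N) \<le> C"
proof (rule power2_le_imp_le[OF _ C])
  have "(L2_norm T (step_rate N))\<^sup>2 = (T / real N) * (\<Sum>n<N. (real N / T)\<^sup>2 * (norm (increment N n))\<^sup>2)"
    unfolding L2_norm_step_interpolant[OF T_pos N] using T_pos by (simp add: sum.atLeast1_atMost_eq power_mult_distrib power_divide)
  also have "\<dots> = ((T / real N) * (real N / T)\<^sup>2) * (\<Sum>n<N. (norm (increment N n))\<^sup>2)"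
    by (simp only: sum_distrib_left mult.assoc)
  also have "(T / real N) * (real N / T)\<^sup>2 = real N / T"
    using T_pos N by (simp add: power2_eq_square)
  finally show "(L2_norm T (step_rate N))\<^sup>2 \<le> C\<^sup>2" using bound by simp
qed

lemma affine_wder:
  assumes N: "N \<ge> 1"
  shows "affine_interpolant T N (zs N) \<in> Ws T \<iota>"
    "AE t in timeM T. wder T (affine_interpolant T N (zs N)) t = step_rate N t"
proof -
  have eq: "\<iota> \<circ> affine_interpolant T N (zs N) = affine_interpolant T N (\<lambda>n. \<iota> (zs N n))"
    using linear_interpolants(2)[OF \<iota>.linear] by (simp add: fun_eq_iff)
  have wd: "has_weak_derivative T (\<iota> \<circ> affine_interpolant T N (zs N)) (step_rate N)"
    unfolding eq by (rule affine_interpolant_weak_derivative[OF T_pos N])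
  have "\<exists>C. \<forall>n\<in>{..N}. norm (zs N n) \<le> C"
    using finite_imp_bounded[of "zs N ` {..N}"] by (auto simp: bounded_iff)
  then obtain C where C: "\<And>n. n \<le> N \<Longrightarrow> norm (zs N n) \<le> C" by auto
  have L: "affine_interpolant T N (zs N) \<in> L2 T" by (rule affine_interpolant_L2(1)[OF T_pos N C])
  show "affine_interpolant T N (zs N) \<in> Ws T \<iota>" by (rule WsI[OF L step_interpolant_L2 wd])
  show "AE t in timeM T. wder T (affine_interpolant T N (zs N)) t = step_rate N t"
    by (rule weak_derivative_AE[OF L2_\<iota>[OF L] step_interpolant_L2 wd])
qed

text \<open>The compactness argument uses \<open>\<iota> (zs N (cell_index T N t))\<close> instead of \<open>step_interpolant\<close> because it
  is defined at \<open>T\<close> and attains the initial value.\<close>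

lemma limit_exists:
  obtains C r c z where "strict_mono (r :: nat \<Rightarrow> nat)" "\<And>k. r k \<ge> 1"
    "\<And>N n. N \<ge> 1 \<Longrightarrow> n \<le> N \<Longrightarrow> norm (zs N n) \<le> C" "\<And>N. N \<ge> 1 \<Longrightarrow> L2_norm T (step_rate N) \<le> C"
    "continuous_on {0..T} c" "c 0 = \<iota> z\<^sub>0"
    "\<And>s t. 0 \<le> s \<Longrightarrow> s \<le> t \<Longrightarrow> t \<le> T \<Longrightarrow> ord_le K (c s) (c t)"
    "\<And>t. 0 < t \<Longrightarrow> t < T \<Longrightarrow> (\<lambda>k. \<iota> (step_interpolant T (r k) (zs (r k)) t)) \<longlonglongrightarrow> c t"
    "AE t in timeM T. \<iota> (z t) = c t" "z \<in> Ws T \<iota>"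
    "converges_weakly (L2 T) (L2_norm T) (\<lambda>k. step_interpolant T (r k) (zs (r k))) z"
    "converges_weakly (Ws T \<iota>) (Ws_norm T \<iota>) (\<lambda>k. affine_interpolant T (r k) (zs (r k))) z"
proof -
  obtain C where C: "C \<ge> 0" and zs_bound: "\<And>N n. N \<ge> 1 \<Longrightarrow> n \<le> N \<Longrightarrow> norm (zs N n) \<le> C"
    and incr: "\<And>N. N \<ge> 1 \<Longrightarrow> (real N / T) * (\<Sum>n<N. (norm (increment N n))\<^sup>2) \<le> C\<^sup>2"
    using a_priori_bound by blast
  define \<zeta> where "\<zeta> N t = \<iota> (zs N (cell_index T N t))" for N t
  \<comment> \<open>The left ends of the cells of \<open>s\<close> and \<open>t\<close> are apart by
    at most \<open>t - s\<close> plus one step size, whence the error \<open>T / N\<close>.\<close>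
  have modulus: "norm (\<zeta> N t - \<zeta> N s) \<le> C * sqrt (\<bar>t - s\<bar> + T / N)"
    if N: "N \<ge> 1" and st: "0 \<le> s" "s \<le> t" "t \<le> T" for N s t
  proof -
    let ?m = "cell_index T N s" and ?n = "cell_index T N t"
    have mn: "?m \<le> ?n" by (rule cell_index_mono[OF T_pos st(2)])
    have n: "?n \<le> N" using cell_index_bounds(4)[OF T_pos N, of t] st by simp
    have "grid T N ?n \<le> t" "s < grid T N (Suc ?m)"
      using cell_index_bounds(1)[OF T_pos N, of t] cell_index_bounds(2)[OF T_pos N, of s] st by auto
    then have "real (?n - ?m) * (T / real N) \<le> \<bar>t - s\<bar> + T / N"
      using mn by (simp add: grid_def of_nat_diff left_diff_distrib distrib_right diff_divide_distrib add_divide_distrib)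
    then have "C * sqrt (real (?n - ?m) * (T / real N)) \<le> C * sqrt (\<bar>t - s\<bar> + T / N)"
      using C by (intro mult_left_mono) auto
    then show ?thesis using increment_sum_bound[OF N C incr[OF N] mn n] by (simp add: \<zeta>_def)
  qed
  have modulus': "norm (\<zeta> (Suc n) s - \<zeta> (Suc n) t) \<le> C * sqrt (\<bar>s - t\<bar> + T / real (Suc n))"
    if "s \<in> {0..T}" "t \<in> {0..T}" for n s t
    using modulus[of "Suc n" s t] modulus[of "Suc n" t s] that
    by (cases "s \<le> t") (auto simp: norm_minus_commute abs_minus_commute)
  define S where "S = closure (\<iota> ` cball 0 C)"
  have S: "compact S" unfolding S_def using gelfand bounded_cball by (auto simp: gelfand_embedding_def)
  have \<zeta>S: "\<zeta> (Suc n) t \<in> S" if "t \<in> {0..T}" for n t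
  proof -
    have "zs (Suc n) (cell_index T (Suc n) t) \<in> cball 0 C"
      using zs_bound[of "Suc n"] cell_index_bounds(4)[OF T_pos, of "Suc n" t] that by simp
    then show ?thesis unfolding S_def \<zeta>_def by (rule subsetD[OF closure_subset imageI])
  qed
  have h0: "(\<lambda>n. T / real (Suc n)) \<longlonglongrightarrow> 0"
    using tendsto_mult_left[OF LIMSEQ_Suc[OF lim_1_over_n], of T] by simp
  obtain s c where s: "strict_mono (s :: nat \<Rightarrow> nat)" and c: "\<And>t. t \<in> {0..T} \<Longrightarrow> (\<lambda>k. \<zeta> (Suc (s k)) t) \<longlonglongrightarrow> c t"
    and c_cont: "continuous_on {0..T} c"
    by (rule pointwise_convergent_subsequence[OF T_pos S \<zeta>S C h0 _ modulus']) (use T_pos in auto)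
  \<comment> \<open>The shift keeps the number of time steps positive.\<close>
  define r where "r k = Suc (s k)" for k
  have r: "strict_mono r" "\<And>k. r k \<ge> 1" using s by (auto simp: r_def strict_mono_def)
  have lim: "(\<lambda>k. \<zeta> (r k) t) \<longlonglongrightarrow> c t" if "t \<in> {0..T}" for t using c[OF that] by (simp add: r_def)
  have c0: "c 0 = \<iota> z\<^sub>0"
  proof (rule LIMSEQ_unique)
    show "(\<lambda>k. \<zeta> (r k) 0) \<longlonglongrightarrow> c 0" using lim[of 0] T_pos by simp
    show "(\<lambda>k. \<zeta> (r k) 0) \<longlonglongrightarrow> \<iota> z\<^sub>0" using zs_0[OF r(2)] by (simp add: \<zeta>_def cell_index_0)
  qed
  have c_mono: "ord_le K (c s) (c t)" if st: "0 \<le> s" "s \<le> t" "t \<le> T" for s t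
  proof (rule ord_le_lim[OF cone sequentially_bot])
    show "(\<lambda>k. \<zeta> (r k) s) \<longlonglongrightarrow> c s" "(\<lambda>k. \<zeta> (r k) t) \<longlonglongrightarrow> c t" using lim st by auto
    show "\<forall>\<^sub>F k in sequentially. ord_le K (\<zeta> (r k) s) (\<zeta> (r k) t)"
      unfolding \<zeta>_def using st cell_index_bounds(4)[OF T_pos r(2)]
      by (intro always_eventually allI zs_mono cell_index_mono[OF T_pos]) auto
  qed
  have hr: "(\<lambda>k. C * sqrt (T / real (r k))) \<longlonglongrightarrow> 0"
  proof -
    have "(\<lambda>k. T / real (r k)) \<longlonglongrightarrow> 0" using LIMSEQ_subseq_LIMSEQ[OF h0 s] by (simp add: o_def r_def)
    from tendsto_mult_left[OF tendsto_real_sqrt[OF this], of C] show ?thesis by simp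
  qed
  have one: "norm (\<iota> (zs N (Suc i)) - \<iota> (zs N i)) \<le> C * sqrt (T / real N)" if "i < N" for N i
    using increment_sum_bound[of N C i "Suc i"] C incr[of N] that by simp
  \<comment> \<open>Both interpolants differ from \<open>\<zeta>\<close> by at most one increment,
    which vanishes like the square root of the step size; so they share its limit.\<close>
  have close: "(\<lambda>k. u k) \<longlonglongrightarrow> c t"
    if t: "0 < t" "t < T" and u: "\<And>k. norm (u k - \<zeta> (r k) t) \<le> C * sqrt (T / r k)" for u :: "nat \<Rightarrow> 'h" and t
  proof -
    have "(\<lambda>k. u k - \<zeta> (r k) t) \<longlonglongrightarrow> 0" by (rule Lim_null_comparison[OF _ hr]) (use u in simp)
    from tendsto_add[OF this lim[of t]] show ?thesis using t by simp
  qed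
  define a b where "a k = step_interpolant T (r k) (zs (r k))" and "b k = affine_interpolant T (r k) (zs (r k))" for k
  have a_lim: "(\<lambda>k. \<iota> (a k t)) \<longlonglongrightarrow> c t" if t: "0 < t" "t < T" for t
  proof (rule close[OF t])
    fix k
    have i: "cell_index T (r k) t < r k" using cell_index_bounds(3)[OF T_pos r(2)] t by simp
    show "norm (\<iota> (a k t) - \<zeta> (r k) t) \<le> C * sqrt (T / r k)"
      using one[OF i] t by (simp add: a_def step_interpolant_eq[OF T_pos r(2)] \<zeta>_def)
  qed
  have b_lim: "(\<lambda>k. \<iota> (b k t)) \<longlonglongrightarrow> c t" if t: "0 < t" "t < T" for t
  proof (rule close[OF t])
    fix k
    let ?N = "r k" and ?i = "cell_index T (r k) t"
    let ?\<theta> = "(t - grid T ?N ?i) / (T / real ?N)"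
    have i: "?i < ?N" using cell_index_bounds(3)[OF T_pos r(2)] t by simp
    note eq = affine_interpolant_eq[OF T_pos r(2)[of k] less_imp_le[OF t(1)] t(2)]
    have "\<iota> (b k t) - \<zeta> ?N t = ?\<theta> *\<^sub>R (\<iota> (zs ?N (Suc ?i)) - \<iota> (zs ?N ?i))"
      unfolding b_def eq(1) \<zeta>_def by (simp add: \<iota>.add \<iota>.scaleR \<iota>.diff)
    then have "norm (\<iota> (b k t) - \<zeta> ?N t) = \<bar>?\<theta>\<bar> * norm (\<iota> (zs ?N (Suc ?i)) - \<iota> (zs ?N ?i))" by simp
    also have "\<dots> \<le> 1 * norm (\<iota> (zs ?N (Suc ?i)) - \<iota> (zs ?N ?i))"
      using eq(2,3) by (intro mult_right_mono) auto
    finally show "norm (\<iota> (b k t) - \<zeta> ?N t) \<le> C * sqrt (T / ?N)" using one[OF i] by simp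
  qed
  have a_L2: "a k \<in> L2 T" for k unfolding a_def by (rule step_interpolant_L2)
  have a_bound: "L2_norm T (a k) \<le> C * sqrt T" for k
  proof (rule L2_norm_le[OF a_L2 _ T_pos C], rule AE_timeM_I)
    fix t assume t: "0 < t" "t < T"
    then show "norm (a k t) \<le> C"
      using zs_bound[OF r(2)] cell_index_bounds(3)[OF T_pos r(2), of t k] by (simp add: a_def step_interpolant_eq[OF T_pos r(2)])
  qed
  obtain z where z: "z \<in> L2 T" "AE t in timeM T. \<iota> (z t) = c t" "converges_weakly (L2 T) (L2_norm T) a z"
    using L2_V_limit_exists[OF T_pos a_L2 a_bound a_lim] by blast
  have b_Ws: "b k \<in> Ws T \<iota>" for k unfolding b_def by (rule affine_wder(1)[OF r(2)])
  have rate: "L2_norm T (step_rate N) \<le> C" if "N \<ge> 1" for N by (rule L2_norm_step_rate[OF that C incr[OF that]])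
  have "Ws_sq T (b k) \<le> (3 * C * sqrt T)\<^sup>2 + C\<^sup>2" for k
  proof -
    note bb = affine_interpolant_L2[OF T_pos r(2)[of k] zs_bound[OF r(2)[of k]]]
    have "L2_norm T (b k) \<le> 3 * C * sqrt T"
      unfolding b_def by (rule L2_norm_le[OF bb T_pos]) (use C in auto)
    moreover have "L2_norm T (wder T (b k)) = L2_norm T (step_rate (r k))"
      unfolding b_def
      by (rule L2_norm_cong_AE[OF L2_measurable[OF Ws_wder(1)[OF affine_wder(1)[OF r(2)]]]
            step_interpolant_measurable affine_wder(2)[OF r(2)]])
    ultimately show ?thesis unfolding Ws_sq_def
      using rate[OF r(2)] L2_norm_nonneg[of T "b k"] L2_norm_nonneg[of T "step_rate (r k)"]
      by (intro add_mono power_mono) auto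
  qed
  from Ws_weak_convergence[OF T_pos b_Ws this b_lim z(1,2)]
  show ?thesis using that[OF r zs_bound rate c_cont c0 c_mono _ z(2)] a_lim z(3) unfolding a_def b_def by blast
qed

text \<open>On a cell the iterate lies below its obstacle at the left end, this lies below its
  obstacle at \<open>t\<close> by monotonicity in time, and \<open>\<Phi>_step\<close> passes to the
  obstacle of the whole interpolant.\<close>

lemma step_below_obstacle:
  assumes N: "N \<ge> 1"
  shows "AE t in timeM T. ord_le K (\<iota> (step_interpolant T N (zs N) t)) (\<iota> (\<Phi> (\<iota> \<circ> step_interpolant T N (zs N)) t))"
proof -
  \<comment> \<open>The scheme says nothing about \<open>zs N n\<close> beyond \<open>N\<close>,
    while \<open>\<Phi>_step\<close> asks for a sequence that is nonnegative throughout.\<close>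
  define vs where "vs n = (if n \<le> N then zs N n else z\<^sub>0)" for n
  have nonneg: "ord_le K 0 (\<iota> (vs n))" for n using zs_nonneg[OF N] z0_nonneg by (simp add: vs_def)
  have eq: "step_interpolant T N vs = step_interpolant T N (zs N)"
    unfolding step_interpolant_def[abs_def] by (intro ext sum.cong) (auto simp: vs_def)
  show ?thesis
    using \<Phi>_step[OF N, of vs, OF nonneg] AE_space[of "timeM T"] unfolding eq
  proof eventually_elim
    case (elim t)
    then have t: "0 \<le> t" "t < T" by auto
    let ?i = "cell_index T N t"
    have i: "?i < N" by (rule cell_index_bounds(3)[OF T_pos N t])
    have sum: "(\<Sum>n=1..N. indicat_real (cell T N (n - 1)) t *\<^sub>R \<Phi> (\<lambda>_. \<iota> (vs n)) t) = \<Phi> (\<lambda>_. \<iota> (zs N (Suc ?i))) t"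
      using sum_cell_indicator[OF T_pos N t, of "\<lambda>n. \<Phi> (\<lambda>_. \<iota> (vs n)) t"] i by (simp add: vs_def)
    have "ord_le K (\<iota> (\<Phi> (\<lambda>_. \<iota> (zs N (Suc ?i))) (grid T N ?i))) (\<iota> (\<Phi> (\<lambda>_. \<iota> (zs N (Suc ?i))) t))"
      by (rule \<Phi>_const_incr[OF zs_nonneg[OF N]])
        (use i t grid_bounds[OF T_pos N, of ?i] cell_index_bounds(1)[OF T_pos N t(1)] in auto)
    then have "ord_le K (\<iota> (zs N (Suc ?i))) (\<iota> (\<Phi> (\<lambda>_. \<iota> (zs N (Suc ?i))) t))"
      using ord_le_trans[OF cone zs_step(2)[OF i]] by blast
    then show ?case
      using elim(1) ord_le_trans[OF cone] unfolding sum step_interpolant_eq[OF T_pos N t] by blast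
  qed
qed

abbreviation obstacle_step :: "nat \<Rightarrow> real \<Rightarrow> 'v" where
  "obstacle_step N \<equiv> step_interpolant T N (\<lambda>n. \<Phi> (\<lambda>_. \<iota> (zs N n)) (grid T N (n - 1)))"

text \<open>As the step interpolant is constant on each cell, the sum in
  \<open>\<Phi>_approx\<close> for \<open>N = r k\<close> is the squared L2 distance between the
  discrete obstacle and the limiting one.\<close>

lemma obstacle_step_limit:
  assumes r: "strict_mono r" "\<And>k. r k \<ge> 1" and \<Phi>z: "\<Phi> (\<iota> \<circ> z) \<in> L2 T"
    and weak: "converges_weakly (L2 T) (L2_norm T) (\<lambda>k. step_interpolant T (r k) (zs (r k))) z"
    and star: "converges_weak_star_Linf T (\<lambda>k. \<iota> \<circ> step_interpolant T (r k) (zs (r k))) (\<iota> \<circ> z)"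
  shows "(\<lambda>k. L2_norm T (\<lambda>t. obstacle_step (r k) t - \<Phi> (\<iota> \<circ> z) t)) \<longlonglongrightarrow> 0"
proof -
  \<comment> \<open>\<open>\<Phi>_approx\<close> takes a sequence indexed by every \<open>N\<close>.
    Filling the gaps of the subsequence with the limit \<open>z\<close> preserves both kinds of
    convergence.\<close>
  define w where "w N = (if N \<in> range r then step_interpolant T N (zs N) else z)" for N
  have w_r: "w (r k) = step_interpolant T (r k) (zs (r k))" for k by (simp add: w_def)
  have fill: "(\<lambda>N. F (w N)) \<longlonglongrightarrow> F z" if lim: "(\<lambda>k. F (step_interpolant T (r k) (zs (r k)))) \<longlonglongrightarrow> F z"
    for F :: "(real \<Rightarrow> 'v) \<Rightarrow> real"
  proof (rule tendstoI)
    fix e :: real assume e: "e > 0"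
    obtain k0 where k0: "\<And>k. k \<ge> k0 \<Longrightarrow> dist (F (step_interpolant T (r k) (zs (r k)))) (F z) < e"
      using tendstoD[OF lim e] by (auto simp: eventually_sequentially)
    have "dist (F (w N)) (F z) < e" if "N \<ge> r k0" for N
    proof (cases "N \<in> range r")
      case True
      then obtain k where k: "N = r k" by auto
      then have "k \<ge> k0" using that strict_mono_less_eq[OF r(1)] by simp
      then show ?thesis unfolding k w_r by (rule k0)
    qed (use e in \<open>simp add: w_def\<close>)
    then show "\<forall>\<^sub>F N in sequentially. dist (F (w N)) (F z) < e" by (auto simp: eventually_sequentially)
  qed
  have w_cases: "w N = z \<or> (\<exists>k. w N = step_interpolant T (r k) (zs (r k)))" for N by (auto simp: w_def)
  have weak_w: "converges_weakly (L2 T) (L2_norm T) w z"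
    unfolding converges_weakly_def
  proof (intro conjI allI impI)
    show "w N \<in> L2 T" for N using w_cases[of N] weak by (auto simp: converges_weakly_def)
    show "z \<in> L2 T" using weak by (simp add: converges_weakly_def)
    show "(\<lambda>N. F (w N)) \<longlonglongrightarrow> F z" if "bounded_functional (L2 T) (L2_norm T) F" for F
      by (rule fill) (use weak that in \<open>simp add: converges_weakly_def\<close>)
  qed
  have star_w: "converges_weak_star_Linf T (\<lambda>N. \<iota> \<circ> w N) (\<iota> \<circ> z)"
    unfolding converges_weak_star_Linf_def
  proof (intro conjI allI ballI)
    show "\<iota> \<circ> w N \<in> Linf T" for N using w_cases[of N] star by (auto simp: converges_weak_star_Linf_def)
    show "\<iota> \<circ> z \<in> Linf T" using star by (simp add: converges_weak_star_Linf_def)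
    show "(\<lambda>N. \<integral>t. (\<iota> \<circ> w N) t \<bullet> g t \<partial>timeM T) \<longlonglongrightarrow> (\<integral>t. (\<iota> \<circ> z) t \<bullet> g t \<partial>timeM T)" if "g \<in> L1 T" for g
      by (rule fill[of "\<lambda>u. \<integral>t. (\<iota> \<circ> u) t \<bullet> g t \<partial>timeM T"]) (use star that in \<open>simp add: converges_weak_star_Linf_def\<close>)
  qed
  define G where "G = \<Phi> (\<iota> \<circ> z)"
  have [measurable]: "G \<in> borel_measurable (timeM T)" unfolding G_def by (rule L2_measurable[OF \<Phi>z])
  have nn: "(\<Sum>n=1..N. \<integral>\<^sup>+t\<in>cell T N (n - 1). ennreal ((norm (\<Phi> (\<lambda>_. \<iota> (w N t)) (grid T N (n - 1)) - G t))\<^sup>2) \<partial>timeM T)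
      = ennreal ((L2_norm T (\<lambda>t. obstacle_step N t - G t))\<^sup>2)" if k: "N = r k" for N k
  proof -
    have N: "N \<ge> 1" using r(2) k by simp
    define \<psi> where "\<psi> n = \<Phi> (\<lambda>_. \<iota> (zs N n)) (grid T N (n - 1))" for n
    have [measurable]: "(\<lambda>t. ennreal ((norm (\<psi> n - G t))\<^sup>2) * indicator (cell T N (n - 1)) t) \<in> borel_measurable (timeM T)" for n
    proof -
      have [measurable]: "(indicator (cell T N (n - 1)) :: real \<Rightarrow> ennreal) \<in> borel_measurable (timeM T)"
        unfolding cell_def by (intro measurable_restrict_space1 measurable_completion) auto
      show ?thesis by measurable
    qed
    have "(\<Sum>n=1..N. \<integral>\<^sup>+t\<in>cell T N (n - 1). ennreal ((norm (\<Phi> (\<lambda>_. \<iota> (w N t)) (grid T N (n - 1)) - G t))\<^sup>2) \<partial>timeM T)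
        = (\<Sum>n=1..N. \<integral>\<^sup>+t\<in>cell T N (n - 1). ennreal ((norm (\<psi> n - G t))\<^sup>2) \<partial>timeM T)"
    proof (intro sum.cong refl nn_integral_cong)
      fix n t assume n: "n \<in> {1..N}" and "t \<in> space (timeM T)"
      then have t: "0 \<le> t" "t < T" by auto
      show "ennreal ((norm (\<Phi> (\<lambda>_. \<iota> (w N t)) (grid T N (n - 1)) - G t))\<^sup>2) * indicator (cell T N (n - 1)) t
          = ennreal ((norm (\<psi> n - G t))\<^sup>2) * indicator (cell T N (n - 1)) t"
        using step_interpolant_cell[OF T_pos N n t, of "zs N"] w_r[of k] k
        by (cases "t \<in> cell T N (n - 1)") (auto simp: \<psi>_def)
    qed
    also have "\<dots> = (\<integral>\<^sup>+t. (\<Sum>n=1..N. ennreal ((norm (\<psi> n - G t))\<^sup>2) * indicator (cell T N (n - 1)) t) \<partial>timeM T)"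
      by (rule nn_integral_sum[symmetric]) measurable
    also have "\<dots> = (\<integral>\<^sup>+t. ennreal ((norm (obstacle_step N t - G t))\<^sup>2) \<partial>timeM T)"
    proof (rule nn_integral_cong)
      fix t assume "t \<in> space (timeM T)"
      then have t: "0 \<le> t" "t < T" by auto
      have "(\<Sum>n=1..N. ennreal ((norm (\<psi> n - G t))\<^sup>2) * indicator (cell T N (n - 1)) t)
          = (\<Sum>n=1..N. ennreal (indicat_real (cell T N (n - 1)) t *\<^sub>R (norm (\<psi> n - G t))\<^sup>2))"
        by (intro sum.cong) (auto simp: indicator_def)
      also have "\<dots> = ennreal (\<Sum>n=1..N. indicat_real (cell T N (n - 1)) t *\<^sub>R (norm (\<psi> n - G t))\<^sup>2)"
        by (rule sum_ennreal) auto
      also have "(\<Sum>n=1..N. indicat_real (cell T N (n - 1)) t *\<^sub>R (norm (\<psi> n - G t))\<^sup>2)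
          = (norm (obstacle_step N t - G t))\<^sup>2"
        unfolding sum_cell_indicator[OF T_pos N t] step_interpolant_eq[OF T_pos N t] \<psi>_def by simp
      finally show "(\<Sum>n=1..N. ennreal ((norm (\<psi> n - G t))\<^sup>2) * indicator (cell T N (n - 1)) t)
          = ennreal ((norm (obstacle_step N t - G t))\<^sup>2)" .
    qed
    also have "\<dots> = ennreal ((L2_norm T (\<lambda>t. obstacle_step N t - G t))\<^sup>2)"
      unfolding L2_norm_sq
      by (rule nn_integral_eq_integral[OF L2_integrable_sq[OF L2_diff[OF step_interpolant_L2 \<Phi>z[folded G_def]]]]) simp
    finally show ?thesis .
  qed
  show ?thesis
  proof (rule LIMSEQ_I)
    fix e :: real assume e: "e > 0"
    then have "(e / 2)\<^sup>2 > 0" by simp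
    from \<Phi>_approx[OF this weak_w star_w, folded G_def]
    obtain N0 where N0: "\<And>N. N \<ge> N0 \<Longrightarrow>
      (\<Sum>n=1..N. \<integral>\<^sup>+t\<in>cell T N (n - 1). ennreal ((norm (\<Phi> (\<lambda>_. \<iota> (w N t)) (grid T N (n - 1)) - G t))\<^sup>2) \<partial>timeM T)
        \<le> ennreal ((e / 2)\<^sup>2)" by blast
    have "norm (L2_norm T (\<lambda>t. obstacle_step (r k) t - G t) - 0) < e" if k: "k \<ge> N0" for k
    proof -
      have "r k \<ge> N0" using seq_suble[OF r(1), of k] k by simp
      from N0[OF this] have "(L2_norm T (\<lambda>t. obstacle_step (r k) t - G t))\<^sup>2 \<le> (e / 2)\<^sup>2"
        unfolding nn[OF refl] by (simp add: ennreal_le_iff)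
      then have "L2_norm T (\<lambda>t. obstacle_step (r k) t - G t) \<le> e / 2"
        by (rule power2_le_imp_le) (use e in simp)
      then show ?thesis using e L2_norm_nonneg[of T "\<lambda>t. obstacle_step (r k) t - G t"] by simp
    qed
    then show "\<exists>no. \<forall>n\<ge>no. norm (L2_norm T (\<lambda>t. obstacle_step (r n) t - \<Phi> (\<iota> \<circ> z) t) - 0) < e"
      unfolding G_def by blast
  qed
qed

text \<open>The terms with \<open>z\<close> come from expanding \<open>A (a - z) (a - z)\<close> for
  the iterate \<open>a\<close>. After this, each term pairs a weakly convergent factor with a
  strongly convergent or fixed one.\<close>

lemma discrete_inequality:
  assumes N: "N \<ge> 1" and v: "ord_le K (\<iota> v) (\<iota> G)" and t: "0 \<le> t" "t < T"
  defines "y \<equiv> step_interpolant T N (zs N) t - (v - G + obstacle_step N t)"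
  shows "(step_rate N t - step_interpolant T N (cell_mean T N f) t) \<bullet> \<iota> y
    + 2 * A (step_interpolant T N (zs N) t) z - A z z
    - A (step_interpolant T N (zs N) t) (v - G + obstacle_step N t) \<le> 0"
proof -
  let ?i = "cell_index T N t"
  have i: "?i < N" by (rule cell_index_bounds(3)[OF T_pos N t])
  define a where "a = zs N (Suc ?i)"
  define p where "p = v - G + obstacle_step N t"
  have a: "step_interpolant T N (zs N) t = a" unfolding a_def by (rule step_interpolant_eq[OF T_pos N t])
  have "obstacle_step N t = \<Phi> (\<lambda>_. \<iota> (zs N (Suc ?i))) (grid T N ?i)"
    unfolding step_interpolant_eq[OF T_pos N t] by simp
  then have "ord_le K (\<iota> p) (\<iota> (\<Phi> (\<lambda>_. \<iota> (zs N (Suc ?i))) (grid T N ?i)))"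
    using v by (simp add: p_def ord_le_def \<iota>.add \<iota>.diff)
  from zs_step(3)[OF i this]
  have "(step_rate N t - step_interpolant T N (cell_mean T N f) t) \<bullet> \<iota> (a - p) + A a (a - p) \<le> 0"
    unfolding step_interpolant_eq[OF T_pos N t] a_def by simp
  moreover have "0 \<le> A (a - z) (a - z)" by (rule A_nonneg)
  then have "2 * A a z - A z z \<le> A a a"
    by (simp add: blinfun.diff_left blinfun.diff_right A_sym[of z a])
  ultimately show ?thesis unfolding y_def a p_def[symmetric] by (simp add: blinfun.diff_right)
qed

text \<open>The test functions \<open>p k\<close> converge strongly in L2(0,T;V), because the
  discrete obstacles do. The iterates converge strongly only in L2(0,T;H), which is enough because
  they meet the difference quotients in the inner product of H.\<close>

lemma limit_inequality:
  assumes r: "strict_mono r" "\<And>k. r k \<ge> 1" and z: "z \<in> Ws T \<iota>" and \<Phi>z: "\<Phi> (\<iota> \<circ> z) \<in> L2 T"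
    and bound: "\<And>N n. N \<ge> 1 \<Longrightarrow> n \<le> N \<Longrightarrow> norm (zs N n) \<le> C" "\<And>N. N \<ge> 1 \<Longrightarrow> L2_norm T (step_rate N) \<le> C"
    and lim: "AE t in timeM T. (\<lambda>k. \<iota> (step_interpolant T (r k) (zs (r k)) t)) \<longlonglongrightarrow> \<iota> (z t)"
    and weak: "converges_weakly (L2 T) (L2_norm T) (\<lambda>k. step_interpolant T (r k) (zs (r k))) z"
    and Ws_weak: "converges_weakly (Ws T \<iota>) (Ws_norm T \<iota>) (\<lambda>k. affine_interpolant T (r k) (zs (r k))) z"
    and obstacle: "(\<lambda>k. L2_norm T (\<lambda>t. obstacle_step (r k) t - \<Phi> (\<iota> \<circ> z) t)) \<longlonglongrightarrow> 0"
    and v: "v \<in> L2 T" "AE t in timeM T. ord_le K (\<iota> (v t)) (\<iota> (\<Phi> (\<iota> \<circ> z) t))"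
  shows "(\<integral>t. (to_dual \<iota> (wder T z t) + A (z t) - to_dual \<iota> (f t)) (z t - v t) \<partial>timeM T) \<le> 0"
proof -
  define G where "G = \<Phi> (\<iota> \<circ> z)"
  define a where "a k = step_interpolant T (r k) (zs (r k))" for k
  define d where "d k = step_rate (r k)" for k
  define F where "F k = step_interpolant T (r k) (cell_mean T (r k) f)" for k
  define p where "p k t = v t - G t + obstacle_step (r k) t" for k t
  have zL: "z \<in> L2 T" by (rule Ws_L2[OF z])
  have GL: "G \<in> L2 T" using \<Phi>z by (simp add: G_def)
  have aL: "a k \<in> L2 T" and dL: "d k \<in> L2 T" and FL: "F k \<in> L2 T" for k
    unfolding a_def d_def F_def by (rule step_interpolant_L2)+
  have pL: "p k \<in> L2 T" for k
    unfolding p_def[abs_def] by (intro L2_add L2_diff v(1) GL step_interpolant_L2)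
  have eL: "(\<lambda>t. d k t - F k t) \<in> L2 T" for k by (rule L2_diff[OF dL FL])
  have a_bd: "AE t in timeM T. norm (a k t) \<le> C" for k
  proof (rule AE_timeM_I)
    fix t assume "0 < t" "t < T"
    then show "norm (a k t) \<le> C"
      using bound(1)[OF r(2)] cell_index_bounds(3)[OF T_pos r(2), of t k] by (simp add: a_def step_interpolant_eq[OF T_pos r(2)])
  qed
  have C: "C \<ge> 0" using bound(2)[of 1] L2_norm_nonneg[of T "step_rate 1"] by linarith
  have a_norm: "L2_norm T (a k) \<le> C * sqrt T" for k by (rule L2_norm_le[OF aL a_bd T_pos C])
  obtain B where B: "B \<ge> 0" "\<And>x. norm (\<iota> x) \<le> norm x * B" using \<iota>.nonneg_bounded by auto
  have F_weak: "converges_weakly (L2 T) (L2_norm T) F f"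
    unfolding F_def[abs_def] by (rule step_cell_mean_weak_convergence[OF T_pos f_L2 r])
  have F_norm: "L2_norm T (F k) \<le> L2_norm T f" for k
  proof (rule power2_le_imp_le[OF _ L2_norm_nonneg])
    show "(L2_norm T (F k))\<^sup>2 \<le> (L2_norm T f)\<^sup>2"
      using cell_mean_sq_le[OF T_pos r(2) f_L2] by (simp add: F_def L2_norm_step_interpolant[OF T_pos r(2)])
  qed
  have e_norm: "L2_norm T (\<lambda>t. d k t - F k t) \<le> C + L2_norm T f" for k
    using L2_norm_triangle[OF dL[of k] L2_scaleR[OF FL[of k], of "-1"]] L2_norm_scaleR[of T "-1" "F k"]
      bound(2)[OF r(2), of k] F_norm[of k] by (simp add: d_def)
  have d_weak: "(\<lambda>k. \<integral>t. d k t \<bullet> g t \<partial>timeM T) \<longlonglongrightarrow> (\<integral>t. wder T z t \<bullet> g t \<partial>timeM T)" if g: "g \<in> L2 T" for g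
  proof -
    have "(\<integral>t. wder T (affine_interpolant T (r k) (zs (r k))) t \<bullet> g t \<partial>timeM T) = (\<integral>t. d k t \<bullet> g t \<partial>timeM T)" for k
    proof (rule integral_cong_AE)
      show "(\<lambda>t. wder T (affine_interpolant T (r k) (zs (r k))) t \<bullet> g t) \<in> borel_measurable (timeM T)"
        using L2_bilinear_integrable[OF bounded_bilinear_inner Ws_wder(1)[OF affine_wder(1)[OF r(2)]] g] by auto
      show "(\<lambda>t. d k t \<bullet> g t) \<in> borel_measurable (timeM T)"
        using L2_bilinear_integrable[OF bounded_bilinear_inner dL g] by auto
      show "AE t in timeM T. wder T (affine_interpolant T (r k) (zs (r k))) t \<bullet> g t = d k t \<bullet> g t"
        using affine_wder(2)[OF r(2), of k] by eventually_elim (simp add: d_def)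
    qed
    then show ?thesis using wder_weak_convergence[OF Ws_weak g] by simp
  qed
  have e_weak: "(\<lambda>k. \<integral>t. (d k t - F k t) \<bullet> g t \<partial>timeM T) \<longlonglongrightarrow> (\<integral>t. (wder T z t - f t) \<bullet> g t \<partial>timeM T)" if g: "g \<in> L2 T" for g
  proof -
    note int = L2_bilinear_integrable[OF bounded_bilinear_inner _ g]
    have "(\<lambda>k. \<integral>t. F k t \<bullet> g t \<partial>timeM T) \<longlonglongrightarrow> (\<integral>t. f t \<bullet> g t \<partial>timeM T)"
      using F_weak L2_bilinear_functional[OF bounded_bilinear_inner g] unfolding converges_weakly_def by blast
    from tendsto_diff[OF d_weak[OF g] this] show ?thesis
      by (simp add: inner_diff_left int dL FL f_L2 Ws_wder(1)[OF z])
  qed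
  have A_weak: "(\<lambda>k. \<integral>t. A (a k t) (g t) \<partial>timeM T) \<longlonglongrightarrow> (\<integral>t. A (z t) (g t) \<partial>timeM T)" if g: "g \<in> L2 T" for g
    using weak L2_bilinear_functional[OF A_bilinear g] unfolding converges_weakly_def a_def by blast
  have p_strong: "(\<lambda>k. L2_norm T (\<lambda>t. p k t - v t)) \<longlonglongrightarrow> 0"
    using obstacle by (simp add: p_def G_def algebra_simps)
  have \<iota>a_strong: "(\<lambda>k. L2_norm T (\<lambda>t. (\<iota> \<circ> a k) t - (\<iota> \<circ> z) t)) \<longlonglongrightarrow> 0"
  proof (rule L2_bounded_pointwise_limit[OF L2_\<iota>[OF aL] L2_\<iota>[OF zL]])
    show "AE t in timeM T. norm ((\<iota> \<circ> a k) t) \<le> C * B" for k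
      using a_bd[of k]
    proof eventually_elim
      case (elim t)
      show ?case using B(2)[of "a k t"] mult_right_mono[OF elim B(1)] by simp
    qed
    show "AE t in timeM T. (\<lambda>k. (\<iota> \<circ> a k) t) \<longlonglongrightarrow> (\<iota> \<circ> z) t" using lim by (simp add: a_def)
  qed
  have yL: "(\<lambda>t. a k t - p k t) \<in> L2 T" "(\<lambda>t. z t - v t) \<in> L2 T" for k by (intro L2_diff aL pL zL v(1))+
  have y_strong: "(\<lambda>k. L2_norm T (\<lambda>t. \<iota> (a k t - p k t) - \<iota> (z t - v t))) \<longlonglongrightarrow> 0"
  proof (rule Lim_null_comparison)
    show "\<forall>\<^sub>F k in sequentially. norm (L2_norm T (\<lambda>t. \<iota> (a k t - p k t) - \<iota> (z t - v t)))
        \<le> L2_norm T (\<lambda>t. (\<iota> \<circ> a k) t - (\<iota> \<circ> z) t) + B * L2_norm T (\<lambda>t. p k t - v t)"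
    proof (rule always_eventually, rule allI)
      fix k
      have L: "(\<lambda>t. (\<iota> \<circ> a k) t - (\<iota> \<circ> z) t) \<in> L2 T" "(\<lambda>t. p k t - v t) \<in> L2 T"
        by (intro L2_diff L2_\<iota> aL zL pL v(1))+
      have "L2_norm T (\<lambda>t. \<iota> (a k t - p k t) - \<iota> (z t - v t))
          = L2_norm T (\<lambda>t. ((\<iota> \<circ> a k) t - (\<iota> \<circ> z) t) + (-1) *\<^sub>R (\<iota> \<circ> (\<lambda>t. p k t - v t)) t)"
        by (rule arg_cong[where f="L2_norm T"]) (simp add: fun_eq_iff \<iota>.diff)
      also have "\<dots> \<le> L2_norm T (\<lambda>t. (\<iota> \<circ> a k) t - (\<iota> \<circ> z) t) + L2_norm T (\<lambda>t. (-1) *\<^sub>R (\<iota> \<circ> (\<lambda>t. p k t - v t)) t)"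
        by (rule L2_norm_triangle[OF L(1) L2_scaleR[OF L2_\<iota>[OF L(2)]]])
      also have "L2_norm T (\<lambda>t. (-1) *\<^sub>R (\<iota> \<circ> (\<lambda>t. p k t - v t)) t) \<le> B * L2_norm T (\<lambda>t. p k t - v t)"
        unfolding L2_norm_scaleR using L2_norm_\<iota>[OF L(2) B] by (simp add: o_def)
      finally show "norm (L2_norm T (\<lambda>t. \<iota> (a k t - p k t) - \<iota> (z t - v t)))
          \<le> L2_norm T (\<lambda>t. (\<iota> \<circ> a k) t - (\<iota> \<circ> z) t) + B * L2_norm T (\<lambda>t. p k t - v t)"
        by (simp only: real_norm_def abs_of_nonneg[OF L2_norm_nonneg])
    qed
    show "(\<lambda>k. L2_norm T (\<lambda>t. (\<iota> \<circ> a k) t - (\<iota> \<circ> z) t) + B * L2_norm T (\<lambda>t. p k t - v t)) \<longlonglongrightarrow> 0"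
      using tendsto_add[OF \<iota>a_strong tendsto_mult_left[OF p_strong, of B]] by simp
  qed
  have \<iota>yL: "(\<lambda>t. \<iota> (a k t - p k t)) \<in> L2 T" "(\<lambda>t. \<iota> (z t - v t)) \<in> L2 T" for k
    by (intro L2_linear[OF bounded_linear_\<iota>] yL)+
  have T1: "(\<lambda>k. \<integral>t. (d k t - F k t) \<bullet> \<iota> (a k t - p k t) \<partial>timeM T) \<longlonglongrightarrow> (\<integral>t. (wder T z t - f t) \<bullet> \<iota> (z t - v t) \<partial>timeM T)"
    by (rule weak_strong_convergence[OF bounded_bilinear_inner eL \<iota>yL e_norm e_weak[OF \<iota>yL(2)] y_strong])
  have T2: "(\<lambda>k. \<integral>t. A (a k t) (z t) \<partial>timeM T) \<longlonglongrightarrow> (\<integral>t. A (z t) (z t) \<partial>timeM T)" by (rule A_weak[OF zL])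
  have T3: "(\<lambda>k. \<integral>t. A (a k t) (p k t) \<partial>timeM T) \<longlonglongrightarrow> (\<integral>t. A (z t) (v t) \<partial>timeM T)"
    by (rule weak_strong_convergence[OF A_bilinear aL pL v(1) a_norm A_weak[OF v(1)] p_strong])
  note iA = L2_bilinear_integrable[OF A_bilinear]
  note iH = L2_bilinear_integrable[OF bounded_bilinear_inner]
  have le0: "(\<integral>t. (d k t - F k t) \<bullet> \<iota> (a k t - p k t) \<partial>timeM T) + 2 * (\<integral>t. A (a k t) (z t) \<partial>timeM T)
      - (\<integral>t. A (z t) (z t) \<partial>timeM T) - (\<integral>t. A (a k t) (p k t) \<partial>timeM T) \<le> 0" for k
  proof -
    let ?I = "\<lambda>t. (d k t - F k t) \<bullet> \<iota> (a k t - p k t) + 2 * A (a k t) (z t) - A (z t) (z t) - A (a k t) (p k t)"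
    have "AE t in timeM T. ?I t \<le> 0"
      using v(2) AE_space[of "timeM T"]
    proof eventually_elim
      case (elim t)
      then have t: "0 \<le> t" "t < T" by auto
      show ?case
        using discrete_inequality[OF r(2)[of k] elim(1) t, of "z t"]
        by (simp only: a_def d_def F_def p_def G_def)
    qed
    moreover have "integrable (timeM T) ?I"
      by (intro Bochner_Integration.integrable_add Bochner_Integration.integrable_diff integrable_mult_right
          iH[OF eL \<iota>yL(1)] iA[OF aL zL] iA[OF zL zL] iA[OF aL pL])
    ultimately have "(\<integral>t. ?I t \<partial>timeM T) \<le> (\<integral>t. 0 \<partial>timeM T)" by (intro integral_mono_AE) auto
    then show ?thesis
      using iH[OF eL[of k] \<iota>yL(1)[of k]] iA[OF aL[of k] zL] iA[OF zL zL] iA[OF aL[of k] pL[of k]] by simp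
  qed
  \<comment> \<open>Twice the energy of \<open>z\<close> from the linearised term, minus the
    subtracted one, leaves exactly the energy in the claim.\<close>
  have "(\<integral>t. (wder T z t - f t) \<bullet> \<iota> (z t - v t) \<partial>timeM T) + 2 * (\<integral>t. A (z t) (z t) \<partial>timeM T)
      - (\<integral>t. A (z t) (z t) \<partial>timeM T) - (\<integral>t. A (z t) (v t) \<partial>timeM T) \<le> 0"
    by (rule LIMSEQ_le_const2[OF tendsto_diff[OF tendsto_diff[OF tendsto_add[OF T1 tendsto_mult_left[OF T2, of 2]] tendsto_const] T3]])
      (use le0 in blast)
  moreover have "(\<integral>t. (to_dual \<iota> (wder T z t) + A (z t) - to_dual \<iota> (f t)) (z t - v t) \<partial>timeM T)
      = (\<integral>t. (wder T z t - f t) \<bullet> \<iota> (z t - v t) \<partial>timeM T) + (\<integral>t. A (z t) (z t) \<partial>timeM T) - (\<integral>t. A (z t) (v t) \<partial>timeM T)"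
  proof -
    have "(to_dual \<iota> (wder T z t) + A (z t) - to_dual \<iota> (f t)) (z t - v t)
        = (wder T z t - f t) \<bullet> \<iota> (z t - v t) + A (z t) (z t) - A (z t) (v t)" for t
      by (simp only: blinfun.add_left blinfun.diff_left blinfun.diff_right[of "A _"] to_dual inner_diff_left)
    then show ?thesis
      using iH[OF L2_diff[OF Ws_wder(1)[OF z] f_L2] \<iota>yL(2)] iA[OF zL zL] iA[OF zL v(1)] by simp
  qed
  ultimately show ?thesis by simp
qed

lemma qvi_solution:
  "\<exists>z. z \<in> Ws T \<iota> \<and> (AE t in timeM T. ord_le K 0 (\<iota> (z t))) \<and>
     solves_parabolic_qvi T \<iota> K A \<Phi> f z\<^sub>0 z \<and>
     (\<exists>r :: nat \<Rightarrow> nat. strict_mono r \<and>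
        converges_weakly (L2 T) (L2_norm T) (\<lambda>k. step_interpolant T (r k) (zs (r k))) z \<and>
        converges_weak_star_Linf T (\<lambda>k. \<iota> \<circ> step_interpolant T (r k) (zs (r k))) (\<iota> \<circ> z) \<and>
        converges_weakly (Ws T \<iota>) (Ws_norm T \<iota>) (\<lambda>k. affine_interpolant T (r k) (zs (r k))) z) \<and>
     increasing_in_time T K (\<iota> \<circ> z)"
proof -
  obtain C r c z where r: "strict_mono (r :: nat \<Rightarrow> nat)" "\<And>k. r k \<ge> 1"
    and bound: "\<And>N n. N \<ge> 1 \<Longrightarrow> n \<le> N \<Longrightarrow> norm (zs N n) \<le> C" "\<And>N. N \<ge> 1 \<Longrightarrow> L2_norm T (step_rate N) \<le> C"
    and c: "continuous_on {0..T} c" "c 0 = \<iota> z\<^sub>0"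
    and c_mono: "\<And>s t. 0 \<le> s \<Longrightarrow> s \<le> t \<Longrightarrow> t \<le> T \<Longrightarrow> ord_le K (c s) (c t)"
    and lim: "\<And>t. 0 < t \<Longrightarrow> t < T \<Longrightarrow> (\<lambda>k. \<iota> (step_interpolant T (r k) (zs (r k)) t)) \<longlonglongrightarrow> c t"
    and zc: "AE t in timeM T. \<iota> (z t) = c t" and z: "z \<in> Ws T \<iota>"
    and weak: "converges_weakly (L2 T) (L2_norm T) (\<lambda>k. step_interpolant T (r k) (zs (r k))) z"
    and Ws_weak: "converges_weakly (Ws T \<iota>) (Ws_norm T \<iota>) (\<lambda>k. affine_interpolant T (r k) (zs (r k))) z"
    by (rule limit_exists) (rule that)
  define a where "a k = step_interpolant T (r k) (zs (r k))" for k
  have zL: "z \<in> L2 T" by (rule Ws_L2[OF z])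
  have aL: "a k \<in> L2 T" for k unfolding a_def by (rule step_interpolant_L2)
  obtain B where B: "B \<ge> 0" "\<And>x. norm (\<iota> x) \<le> norm x * B" using \<iota>.nonneg_bounded by auto
  have a_bd: "AE t in timeM T. norm ((\<iota> \<circ> a k) t) \<le> C * B" for k
  proof (rule AE_timeM_I)
    fix t assume t: "0 < t" "t < T"
    then have "norm (a k t) \<le> C"
      using bound(1)[OF r(2)] cell_index_bounds(3)[OF T_pos r(2), of t k] by (simp add: a_def step_interpolant_eq[OF T_pos r(2)])
    then show "norm ((\<iota> \<circ> a k) t) \<le> C * B" using B(2)[of "a k t"] mult_right_mono[OF _ B(1)] by fastforce
  qed
  have lim_AE: "AE t in timeM T. (\<lambda>k. \<iota> (a k t)) \<longlonglongrightarrow> \<iota> (z t)"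
    using zc AE_space[of "timeM T"] by eventually_elim (use lim in \<open>auto simp: a_def\<close>)
  have "AE t in timeM T. norm ((\<iota> \<circ> z) t) \<le> C * B"
  proof -
    have "AE t in timeM T. \<forall>k. norm ((\<iota> \<circ> a k) t) \<le> C * B" using a_bd by (simp add: AE_all_countable)
    then show ?thesis
      using lim_AE
    proof eventually_elim
      case (elim t)
      show ?case by (rule LIMSEQ_le_const2[OF tendsto_norm[OF elim(2)], of "C * B", folded o_apply[of \<iota> z]]) (use elim(1) in auto)
    qed
  qed
  then have z_Linf: "\<iota> \<circ> z \<in> Linf T" using L2_measurable[OF L2_\<iota>[OF zL]] by (auto simp: Linf_def)
  \<comment> \<open>Pointwise convergence in H under a uniform bound gives convergence against every
    integrable \<open>g\<close> by dominated convergence.\<close>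
  have star: "converges_weak_star_Linf T (\<lambda>k. \<iota> \<circ> a k) (\<iota> \<circ> z)"
    unfolding converges_weak_star_Linf_def
  proof (intro conjI allI ballI z_Linf)
    show "\<iota> \<circ> a k \<in> Linf T" for k using L2_measurable[OF L2_\<iota>[OF aL]] a_bd[of k] by (auto simp: Linf_def)
    fix g :: "real \<Rightarrow> 'h" assume "g \<in> L1 T"
    then have g: "integrable (timeM T) g" by (simp add: L1_def)
    show "(\<lambda>k. \<integral>t. (\<iota> \<circ> a k) t \<bullet> g t \<partial>timeM T) \<longlonglongrightarrow> (\<integral>t. (\<iota> \<circ> z) t \<bullet> g t \<partial>timeM T)"
    proof (rule integral_dominated_convergence[where w="\<lambda>t. (C * B) * norm (g t)"])
      show "(\<lambda>t. (\<iota> \<circ> z) t \<bullet> g t) \<in> borel_measurable (timeM T)"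
        using L2_measurable[OF L2_\<iota>[OF zL]] g by measurable
      show "(\<lambda>t. (\<iota> \<circ> a k) t \<bullet> g t) \<in> borel_measurable (timeM T)" for k
        using L2_measurable[OF L2_\<iota>[OF aL]] g by measurable
      show "integrable (timeM T) (\<lambda>t. (C * B) * norm (g t))" using g by simp
      show "AE t in timeM T. (\<lambda>k. (\<iota> \<circ> a k) t \<bullet> g t) \<longlonglongrightarrow> (\<iota> \<circ> z) t \<bullet> g t"
        using lim_AE by eventually_elim (auto intro!: tendsto_intros)
      show "AE t in timeM T. norm ((\<iota> \<circ> a k) t \<bullet> g t) \<le> (C * B) * norm (g t)" for k
        using a_bd[of k]
      proof eventually_elim
        case (elim t)
        show ?case
          using Cauchy_Schwarz_ineq2[of "(\<iota> \<circ> a k) t" "g t"] mult_right_mono[OF elim norm_ge_zero[of "g t"]] by simp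
      qed
    qed
  qed
  have \<Phi>z: "\<Phi> (\<iota> \<circ> z) \<in> L2 T" using \<Phi>_map L2_\<iota>[OF zL] by (simp add: increasing_map_def)
  have constraint: "AE t in timeM T. ord_le K (\<iota> (z t)) (\<iota> (\<Phi> (\<iota> \<circ> z) t))"
    by (rule \<Phi>_closed[OF weak star[unfolded a_def]]) (rule step_below_obstacle[OF r(2)])
  note obstacle = obstacle_step_limit[OF r \<Phi>z weak star[unfolded a_def]]
  have "(\<integral>t. (to_dual \<iota> (wder T z t) + A (z t) - to_dual \<iota> (f t)) (z t - v t) \<partial>timeM T) \<le> 0"
    if "v \<in> L2 T" "AE t in timeM T. ord_le K (\<iota> (v t)) (\<iota> (\<Phi> (\<iota> \<circ> z) t))" for v
    by (rule limit_inequality[OF r z \<Phi>z bound lim_AE[unfolded a_def] weak Ws_weak obstacle that])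
  \<comment> \<open>The value at 0 is carried by \<open>c\<close>, which is continuous on the closed
    interval, whereas \<open>z\<close> is determined only up to null sets.\<close>
  moreover have "has_initial_value T (\<iota> \<circ> z) (\<iota> z\<^sub>0)"
    unfolding has_initial_value_def using c zc by (intro exI[of _ c]) simp
  ultimately have solves: "solves_parabolic_qvi T \<iota> K A \<Phi> f z\<^sub>0 z"
    unfolding solves_parabolic_qvi_def using z constraint by blast
  have nonneg: "AE t in timeM T. ord_le K 0 (\<iota> (z t))"
    using zc AE_space[of "timeM T"]
  proof eventually_elim
    case (elim t)
    have "ord_le K (c 0) (c t)" by (rule c_mono) (use elim(2) in auto)
    then show ?case using elim(1) c(2) z0_nonneg ord_le_trans[OF cone] by auto
  qed
  have incr: "increasing_in_time T K (\<iota> \<circ> z)"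
    unfolding increasing_in_time_def
    using zc AE_space[of "timeM T"]
  proof eventually_elim
    case (elim s)
    note s = this
    show ?case
      using zc AE_space[of "timeM T"]
    proof eventually_elim
      case (elim t)
      show ?case using s elim c_mono[of s t] by auto
    qed
  qed
  show ?thesis
    using z nonneg solves r(1) weak star[unfolded a_def] Ws_weak incr by blast
qed

end

text \<open>The first conjunct keeps the second from being vacuous: families of iterates exist, and
  each of them has its own convergent subsequence and limit.\<close>

theorem theorem2p10:
  fixes T :: real
    and \<iota> :: "'v::{real_inner,banach,second_countable_topology}
              \<Rightarrow> 'h::{real_inner,banach,second_countable_topology}"
    and K :: "'h set"
    and A :: "'v \<Rightarrow>\<^sub>L 'v \<Rightarrow>\<^sub>L real"
    and \<Phi> :: "(real \<Rightarrow> 'h) \<Rightarrow> real \<Rightarrow> 'v"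
    and f :: "real \<Rightarrow> 'h"
    and z\<^sub>0 :: 'v
  assumes T_pos: "T > 0"
    and gelfand: "gelfand_embedding \<iota>"
    and cone: "self_dual_cone K"
    and pos_part_sup: "\<And>x y. ord_le K 0 y \<Longrightarrow> ord_le K x y \<Longrightarrow> ord_le K (pos_part K x) y"
    and pos_part_V: "pos_part_bounded_on_V \<iota> K"
    and operator: "admissible_operator \<iota> K A"
    and \<Phi>_map: "increasing_map T \<iota> K \<Phi>"
    and f_L2: "f \<in> L2 T"
    and i_nonneg: "AE t in timeM T. ord_le K 0 (\<iota> (\<Phi> (\<lambda>_. 0) t))"
    and i_cont: "\<And>x. continuous_on {0..T} (\<Phi> (\<lambda>_. x))"
    and ii_f_nonneg: "AE t in timeM T. ord_le K 0 (f t)"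
    and ii_f_incr: "increasing_in_time T K f"
    and ii_z0: "ord_le K 0 (\<iota> z\<^sub>0)"
    and iii_z0: "ord_le K (\<iota> z\<^sub>0) (\<iota> (\<Phi> (\<lambda>_. \<iota> z\<^sub>0) 0))"
    and iii_sub: "\<And>v. ord_le K 0 (\<iota> v) \<Longrightarrow> AE t in timeM T. (A z\<^sub>0 - to_dual \<iota> (f t)) v \<le> 0"
    and iv: "\<And>v. ord_le K 0 (\<iota> v) \<Longrightarrow> increasing_in_time T K (\<iota> \<circ> \<Phi> (\<lambda>_. \<iota> v))"
    and v: "\<And>N (vs :: nat \<Rightarrow> 'v). N \<ge> 1 \<Longrightarrow> (\<And>n. ord_le K 0 (\<iota> (vs n))) \<Longrightarrow>
              AE t in timeM T. ord_le K
                (\<iota> (\<Sum>n=1..N. indicat_real (cell T N (n - 1)) t *\<^sub>R \<Phi> (\<lambda>_. \<iota> (vs n)) t))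
                (\<iota> (\<Phi> (\<iota> \<circ> step_interpolant T N vs) t))"
    and vi: "\<And>(vn :: nat \<Rightarrow> real \<Rightarrow> 'v) w.
              converges_weakly (L2 T) (L2_norm T) vn w \<Longrightarrow>
              converges_weak_star_Linf T (\<lambda>n. \<iota> \<circ> vn n) (\<iota> \<circ> w) \<Longrightarrow>
              (\<And>n. AE t in timeM T. ord_le K (\<iota> (vn n t)) (\<iota> (\<Phi> (\<iota> \<circ> vn n) t))) \<Longrightarrow>
              AE t in timeM T. ord_le K (\<iota> (w t)) (\<iota> (\<Phi> (\<iota> \<circ> w) t))"
    and vii: "\<And>\<epsilon> (wN :: nat \<Rightarrow> real \<Rightarrow> 'v) w. \<epsilon> > 0 \<Longrightarrow>
              converges_weakly (L2 T) (L2_norm T) wN w \<Longrightarrow>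
              converges_weak_star_Linf T (\<lambda>n. \<iota> \<circ> wN n) (\<iota> \<circ> w) \<Longrightarrow>
              \<exists>N\<^sub>0. \<forall>N\<ge>N\<^sub>0.
                (\<Sum>n=1..N. \<integral>\<^sup>+t\<in>cell T N (n - 1).
                   ennreal ((norm (\<Phi> (\<lambda>_. \<iota> (wN N t)) (grid T N (n - 1)) - \<Phi> (\<iota> \<circ> w) t))\<^sup>2)
                   \<partial>timeM T) \<le> ennreal \<epsilon>"
  shows "(\<exists>zb zs. \<forall>N\<ge>1. discrete_solution T \<iota> K A \<Phi> f z\<^sub>0 N (zb N) (zs N)) \<and>
         (\<forall>zb zs. (\<forall>N\<ge>1. discrete_solution T \<iota> K A \<Phi> f z\<^sub>0 N (zb N) (zs N)) \<longrightarrow>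
            (\<exists>z. z \<in> Ws T \<iota> \<and>
                 (AE t in timeM T. ord_le K 0 (\<iota> (z t))) \<and>
                 solves_parabolic_qvi T \<iota> K A \<Phi> f z\<^sub>0 z \<and>
                 (\<exists>r :: nat \<Rightarrow> nat. strict_mono r \<and>
                    converges_weakly (L2 T) (L2_norm T)
                      (\<lambda>k. step_interpolant T (r k) (zs (r k))) z \<and>
                    converges_weak_star_Linf T
                      (\<lambda>k. \<iota> \<circ> step_interpolant T (r k) (zs (r k))) (\<iota> \<circ> z) \<and>
                    converges_weakly (Ws T \<iota>) (Ws_norm T \<iota>)
                      (\<lambda>k. affine_interpolant T (r k) (zs (r k))) z) \<and>
                 increasing_in_time T K (\<iota> \<circ> z)))"
proof -
  interpret qvi_scheme \<iota> K A T \<Phi> f z\<^sub>0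
    by unfold_locales (fact gelfand cone pos_part_sup pos_part_V operator T_pos \<Phi>_map f_L2 i_cont ii_f_incr
        ii_z0 iii_z0 iii_sub iv)+
  have "\<forall>N. \<exists>p. N \<ge> 1 \<longrightarrow> discrete_solution T \<iota> K A \<Phi> f z\<^sub>0 N (fst p) (snd p)"
    using discrete_solution_exists by fastforce
  from choice[OF this] obtain p where
    p: "\<forall>N. N \<ge> 1 \<longrightarrow> discrete_solution T \<iota> K A \<Phi> f z\<^sub>0 N (fst (p N)) (snd (p N))" by blast
  show ?thesis
  proof (intro conjI allI impI)
    show "\<exists>zb zs. \<forall>N\<ge>1. discrete_solution T \<iota> K A \<Phi> f z\<^sub>0 N (zb N) (zs N)"
      using p by (intro exI[of _ "\<lambda>N. fst (p N)"] exI[of _ "\<lambda>N. snd (p N)"])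
    fix zb zs assume "\<forall>N\<ge>1. discrete_solution T \<iota> K A \<Phi> f z\<^sub>0 N (zb N) (zs N)"
    then have d: "\<And>N. N \<ge> 1 \<Longrightarrow> discrete_solution T \<iota> K A \<Phi> f z\<^sub>0 N (zb N) (zs N)" by blast
    interpret qvi_discrete \<iota> K A T \<Phi> f z\<^sub>0 zb zs
      by unfold_locales (fact d v vi vii)+
    show "\<exists>z. z \<in> Ws T \<iota> \<and>
                 (AE t in timeM T. ord_le K 0 (\<iota> (z t))) \<and>
                 solves_parabolic_qvi T \<iota> K A \<Phi> f z\<^sub>0 z \<and>
                 (\<exists>r :: nat \<Rightarrow> nat. strict_mono r \<and>
                    converges_weakly (L2 T) (L2_norm T)
                      (\<lambda>k. step_interpolant T (r k) (zs (r k))) z \<and>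
                    converges_weak_star_Linf T
                      (\<lambda>k. \<iota> \<circ> step_interpolant T (r k) (zs (r k))) (\<iota> \<circ> z) \<and>
                    converges_weakly (Ws T \<iota>) (Ws_norm T \<iota>)
                      (\<lambda>k. affine_interpolant T (r k) (zs (r k))) z) \<and>
                 increasing_in_time T K (\<iota> \<circ> z)"
      by (rule qvi_solution)
  qed
qed

end
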